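(* Let $X$ be a (reduced) complex space such that every point of $X$ has an open neighbourhood biholomorphic to (an open neighbourhood of a point in) a finite union of complex linear subspaces of some $\mathbb{C}^N$. Let $\Omega\subseteq X$ be an open set and let $T\in\mathscr{D}_m(\Omega)$ be an $m$-dimensional local metric current. Then for every $x\in\Omega$ there exist an open set $\omega\ni x$ with $\omega$ relatively compact in $\Omega$, finitely many holomorphic maps $h_i:V_i\to\Omega$, $i=1,\dots,k$, with $V_i\subset\mathbb{C}^{n_i}$ open, and local metric currents $T_i\in\mathscr{D}_m(V_i)$ (with $h_i$ proper on $\mathrm{supp}(T_i)$) such that the current $$T-\sum_{i=1}^k(h_i)_\sharp T_i$$ has support disjoint from $\overline{\omega}$.
   Context: Metric: a complex space $X$ is endowed with a distance which is locally bi-Lipschitz equivalent to the Euclidean distance induced by local embeddings of $X$ in $\mathbb{C}^N$. Local metric currents: for a locally compact metric space $X$, $\mathrm{Lip}_{\mathrm{loc}}(X)$ is the set of functions $X\to\mathbb{C}$ that are Lipschitz on every compact set, and $\mathscr{D}(X)$ is the set of compactly supported Lipschitz functions $X\to\mathbb{C}$. One says $f_j\to f$ in $\mathscr{D}(X)$ if all $f_j$ have supports in a common compact set, have uniformly bounded Lipschitz constants, and $f_j\to f$ pointwise; $\pi_j\to\pi$ in $\mathrm{Lip}_{\mathrm{loc}}(X)$ if on each compact set the Lipschitz constants are uniformly bounded and $\pi_j\to\pi$ pointwise. Put $\mathscr{D}^m(X)=\mathscr{D}(X)\times[\mathrm{Lip}_{\mathrm{loc}}(X)]^m$. An $m$-dimensional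 local metric current is a function $T:\mathscr{D}^m(X)\to\mathbb{C}$ that is $(m+1)$-linear, sequentially continuous in the sense that $T(f^j,\pi_1^j,\dots,\pi_m^j)\to T(f,\pi_1,\dots,\pi_m)$ whenever $f^j\to f$ in $\mathscr{D}(X)$ and $\pi_i^j\to\pi_i$ in $\mathrm{Lip}_{\mathrm{loc}}(X)$ for $i=1,\dots,m$, and local: for $m\ge1$, $T(f,\pi_1,\dots,\pi_m)=0$ whenever some $\pi_i$ is constant on a neighbourhood of $\mathrm{supp}(f)$. The space of these is $\mathscr{D}_m(X)$. The support $\mathrm{supp}(T)$ is the intersection of all closed sets $C$ such that $T(f,\pi)=0$ whenever $\mathrm{supp}(f)\cap C=\emptyset$. If $h:V\to\Omega$ is locally Lipschitz and proper on $\mathrm{supp}(T)$, the pushforward is $h_\sharp T(f,\pi_1,\dots,\pi_m)=T(f\circ h,\pi_1\circ h,\dots,\pi_m\circ h)$ (where $f\circ h$ is multiplied by a compactly supported Lipschitz cut-off equal to $1$ near $\mathrm{supp}(T)\cap\mathrm{supp}(f\circ h)$). *)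

theory Defs
  imports "HOL-Analysis.Analysis"
begin

section \<open>The Hermitian space of dimension \<open>n\<close>\<close>

text \<open>
  The dimension has to be a term, since it varies from chart to chart and is existentially
  quantified.  As for \<open>Euclidean_space\<close> in the library, a vector is a function on the natural
  numbers which vanishes at all indices \<open>i \<ge> n\<close>.
\<close>

definition cspace :: "nat \<Rightarrow> (nat \<Rightarrow> complex) metric" where
  "cspace n = metric ({z. \<forall>i\<ge>n. z i = 0}, \<lambda>z w. L2_set (\<lambda>i. cmod (z i - w i)) {..<n})"

lemma Metric_space_cspace:
  "Metric_space {z :: nat \<Rightarrow> complex. \<forall>i\<ge>n. z i = 0} (\<lambda>z w. L2_set (\<lambda>i. cmod (z i - w i)) {..<n})"
proof
  fix x y z :: "nat \<Rightarrow> complex"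
  show "0 \<le> L2_set (\<lambda>i. cmod (x i - y i)) {..<n}"
    by simp
  show "L2_set (\<lambda>i. cmod (x i - y i)) {..<n} = L2_set (\<lambda>i. cmod (y i - x i)) {..<n}"
    by (simp add: norm_minus_commute)
  assume x: "x \<in> {z. \<forall>i\<ge>n. z i = 0}" and y: "y \<in> {z. \<forall>i\<ge>n. z i = 0}"
  have "x = y" if "\<forall>i<n. x i = y i"
  proof
    fix i show "x i = y i"
      using that x y by (cases "i < n") auto
  qed
  then show "(L2_set (\<lambda>i. cmod (x i - y i)) {..<n} = 0) = (x = y)"
    by (auto simp: L2_set_eq_0_iff)
  have "L2_set (\<lambda>i. cmod (x i - z i)) {..<n}
      \<le> L2_set (\<lambda>i. cmod (x i - y i) + cmod (y i - z i)) {..<n}"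
    by (intro L2_set_mono) (auto intro: norm_triangle_sub order_trans[OF _ norm_triangle_ineq])
  also have "\<dots> \<le> L2_set (\<lambda>i. cmod (x i - y i)) {..<n} + L2_set (\<lambda>i. cmod (y i - z i)) {..<n}"
    by (rule L2_set_triangle_ineq)
  finally show "L2_set (\<lambda>i. cmod (x i - z i)) {..<n}
      \<le> L2_set (\<lambda>i. cmod (x i - y i)) {..<n} + L2_set (\<lambda>i. cmod (y i - z i)) {..<n}" .
qed

lemma mspace_cspace: "mspace (cspace n) = {z. \<forall>i\<ge>n. z i = 0}"
  by (simp add: cspace_def Metric_space.mspace_metric[OF Metric_space_cspace])

lemma mdist_cspace: "mdist (cspace n) z w = L2_set (\<lambda>i. cmod (z i - w i)) {..<n}"
  by (simp add: cspace_def Metric_space.mdist_metric[OF Metric_space_cspace])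

abbreviation ctop :: "nat \<Rightarrow> (nat \<Rightarrow> complex) topology" where
  "ctop n \<equiv> mtopology_of (cspace n)"

definition complex_linear_subspace :: "nat \<Rightarrow> (nat \<Rightarrow> complex) set \<Rightarrow> bool" where
  "complex_linear_subspace n L \<longleftrightarrow>
     L \<subseteq> mspace (cspace n) \<and> (\<lambda>i. 0) \<in> L \<and>
     (\<forall>z\<in>L. \<forall>w\<in>L. (\<lambda>i. z i + w i) \<in> L) \<and>
     (\<forall>c. \<forall>z\<in>L. (\<lambda>i. c * z i) \<in> L)"


section \<open>Holomorphic functions and analytic sets\<close>

text \<open>Complex Frechet differentiability at every point of \<open>D\<close> (meant for \<open>D\<close> open).\<close>

definition complex_differentiable_on ::
    "nat \<Rightarrow> (nat \<Rightarrow> complex) set \<Rightarrow> ((nat \<Rightarrow> complex) \<Rightarrow> complex) \<Rightarrow> bool" where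
  "complex_differentiable_on n D f \<longleftrightarrow>
     (\<forall>z\<in>D. \<exists>a :: nat \<Rightarrow> complex. \<forall>\<epsilon>>0. \<exists>\<delta>>0. \<forall>w\<in>D.
        mdist (cspace n) w z < \<delta> \<longrightarrow>
        cmod (f w - f z - (\<Sum>i<n. a i * (w i - z i))) \<le> \<epsilon> * mdist (cspace n) w z)"

text \<open>
  For an arbitrary \<open>W\<close>: locally the restriction of a holomorphic function of the ambient space.
  For \<open>W\<close> open this is ordinary holomorphy; for \<open>W\<close> open in an analytic set \<open>A\<close>, these are
  the sections over \<open>W\<close> of the reduced structure sheaf of \<open>A\<close>.
\<close>

definition holo :: "nat \<Rightarrow> (nat \<Rightarrow> complex) set \<Rightarrow> ((nat \<Rightarrow> complex) \<Rightarrow> complex) set" where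
  "holo n W = {f. \<forall>p\<in>W. \<exists>D g. openin (ctop n) D \<and> p \<in> D \<and>
     complex_differentiable_on n D g \<and> (\<forall>z\<in>W \<inter> D. f z = g z)}"

definition analytic_subset :: "nat \<Rightarrow> (nat \<Rightarrow> complex) set \<Rightarrow> (nat \<Rightarrow> complex) set \<Rightarrow> bool" where
  "analytic_subset n D A \<longleftrightarrow> A \<subseteq> D \<and>
     (\<forall>p\<in>D. \<exists>U F. openin (ctop n) U \<and> p \<in> U \<and> U \<subseteq> D \<and> finite F \<and>
        (\<forall>g\<in>F. complex_differentiable_on n U g) \<and>
        A \<inter> U = {z\<in>U. \<forall>g\<in>F. g z = 0})"


section \<open>Reduced complex spaces\<close>

text \<open>
  The structure sheaf of a reduced complex space is a sheaf of continuous functions.  Sections over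
  \<open>U\<close> are represented by total functions, whose values outside \<open>U\<close> are irrelevant.
\<close>

definition function_sheaf :: "'a topology \<Rightarrow> ('a set \<Rightarrow> ('a \<Rightarrow> complex) set) \<Rightarrow> bool" where
  "function_sheaf X \<O> \<longleftrightarrow>
     (\<forall>U f g. openin X U \<and> f \<in> \<O> U \<and> (\<forall>x\<in>U. f x = g x) \<longrightarrow> g \<in> \<O> U) \<and>
     (\<forall>U f. openin X U \<and> f \<in> \<O> U \<longrightarrow> continuous_map (subtopology X U) euclidean f) \<and>
     (\<forall>U c. openin X U \<longrightarrow> (\<lambda>x. c) \<in> \<O> U) \<and>
     (\<forall>U f g. openin X U \<and> f \<in> \<O> U \<and> g \<in> \<O> U \<longrightarrow>
        (\<lambda>x. f x + g x) \<in> \<O> U \<and> (\<lambda>x. f x * g x) \<in> \<O> U) \<and>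
     (\<forall>U V f. openin X U \<and> openin X V \<and> V \<subseteq> U \<and> f \<in> \<O> U \<longrightarrow> f \<in> \<O> V) \<and>
     (\<forall>U f. openin X U \<and> (\<forall>x\<in>U. \<exists>V. openin X V \<and> x \<in> V \<and> V \<subseteq> U \<and> f \<in> \<O> V) \<longrightarrow> f \<in> \<O> U)"

definition holomorphic_map ::
    "'a topology \<Rightarrow> ('a set \<Rightarrow> ('a \<Rightarrow> complex) set) \<Rightarrow>
     'b topology \<Rightarrow> ('b set \<Rightarrow> ('b \<Rightarrow> complex) set) \<Rightarrow> ('a \<Rightarrow> 'b) \<Rightarrow> bool" where
  "holomorphic_map X \<O>\<^sub>X Y \<O>\<^sub>Y h \<longleftrightarrow> continuous_map X Y h \<and>
     (\<forall>W f. openin Y W \<and> f \<in> \<O>\<^sub>Y W \<longrightarrow> f \<circ> h \<in> \<O>\<^sub>X {x \<in> topspace X. h x \<in> W})"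

definition biholomorphic_map ::
    "'a topology \<Rightarrow> ('a set \<Rightarrow> ('a \<Rightarrow> complex) set) \<Rightarrow>
     'b topology \<Rightarrow> ('b set \<Rightarrow> ('b \<Rightarrow> complex) set) \<Rightarrow> ('a \<Rightarrow> 'b) \<Rightarrow> bool" where
  "biholomorphic_map X \<O>\<^sub>X Y \<O>\<^sub>Y h \<longleftrightarrow>
     (\<exists>k. holomorphic_map X \<O>\<^sub>X Y \<O>\<^sub>Y h \<and> holomorphic_map Y \<O>\<^sub>Y X \<O>\<^sub>X k \<and>
        (\<forall>x\<in>topspace X. k (h x) = x) \<and> (\<forall>y\<in>topspace Y. h (k y) = y))"

definition local_embedding ::
    "'a topology \<Rightarrow> ('a set \<Rightarrow> ('a \<Rightarrow> complex) set) \<Rightarrow> 'a set \<Rightarrow> nat \<Rightarrow> ('a \<Rightarrow> nat \<Rightarrow> complex) \<Rightarrow> bool" where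
  "local_embedding X \<O> U n \<phi> \<longleftrightarrow> openin X U \<and>
     (\<exists>D A. openin (ctop n) D \<and> analytic_subset n D A \<and>
        biholomorphic_map (subtopology X U) \<O> (subtopology (ctop n) A) (holo n) \<phi>)"

definition reduced_complex_space :: "'a topology \<Rightarrow> ('a set \<Rightarrow> ('a \<Rightarrow> complex) set) \<Rightarrow> bool" where
  "reduced_complex_space X \<O> \<longleftrightarrow> Hausdorff_space X \<and> function_sheaf X \<O> \<and>
     (\<forall>x\<in>topspace X. \<exists>U n \<phi>. x \<in> U \<and> local_embedding X \<O> U n \<phi>)"

text \<open>The distance is locally bi-Lipschitz equivalent to those induced by local embeddings.\<close>

definition compatible_metric :: "'a metric \<Rightarrow> ('a set \<Rightarrow> ('a \<Rightarrow> complex) set) \<Rightarrow> bool" where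
  "compatible_metric X \<O> \<longleftrightarrow>
     (\<forall>U n \<phi>. local_embedding (mtopology_of X) \<O> U n \<phi> \<longrightarrow>
        (\<forall>p\<in>U. \<exists>W L. openin (mtopology_of X) W \<and> p \<in> W \<and> W \<subseteq> U \<and>
           (\<forall>x\<in>W. \<forall>y\<in>W. mdist (cspace n) (\<phi> x) (\<phi> y) \<le> L * mdist X x y \<and>
                          mdist X x y \<le> L * mdist (cspace n) (\<phi> x) (\<phi> y))))"

definition locally_union_of_subspaces ::
    "'a topology \<Rightarrow> ('a set \<Rightarrow> ('a \<Rightarrow> complex) set) \<Rightarrow> bool" where
  "locally_union_of_subspaces X \<O> \<longleftrightarrow>
     (\<forall>x\<in>topspace X. \<exists>U n \<L> B \<phi>. openin X U \<and> x \<in> U \<and>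
        finite \<L> \<and> (\<forall>L\<in>\<L>. complex_linear_subspace n L) \<and>
        openin (subtopology (ctop n) (\<Union>\<L>)) B \<and>
        biholomorphic_map (subtopology X U) \<O> (subtopology (ctop n) B) (holo n) \<phi>)"


section \<open>Local metric currents\<close>

definition locally_Lipschitz :: "'a metric \<Rightarrow> 'b metric \<Rightarrow> ('a \<Rightarrow> 'b) \<Rightarrow> bool" where
  "locally_Lipschitz M M' f \<longleftrightarrow>
     (\<forall>K. compactin (mtopology_of M) K \<longrightarrow> Lipschitz_continuous_map (submetric M K) M' f)"

definition Lip_loc :: "'a metric \<Rightarrow> ('a \<Rightarrow> complex) set" where
  "Lip_loc M = {f. locally_Lipschitz M euclidean_metric f}"

definition fsupp :: "'a metric \<Rightarrow> ('a \<Rightarrow> complex) \<Rightarrow> 'a set" where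
  "fsupp M f = mtopology_of M closure_of {x \<in> mspace M. f x \<noteq> 0}"

definition test_functions :: "'a metric \<Rightarrow> ('a \<Rightarrow> complex) set" where
  "test_functions M =
     {f. Lipschitz_continuous_map M euclidean_metric f \<and> compactin (mtopology_of M) (fsupp M f)}"

definition Lip_bound :: "'a metric \<Rightarrow> 'a set \<Rightarrow> real \<Rightarrow> ('a \<Rightarrow> complex) \<Rightarrow> bool" where
  "Lip_bound M S L f \<longleftrightarrow> (\<forall>x\<in>S. \<forall>y\<in>S. cmod (f x - f y) \<le> L * mdist M x y)"

definition converges_test :: "'a metric \<Rightarrow> (nat \<Rightarrow> 'a \<Rightarrow> complex) \<Rightarrow> ('a \<Rightarrow> complex) \<Rightarrow> bool" where
  "converges_test M F f \<longleftrightarrow>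
     (\<exists>K. compactin (mtopology_of M) K \<and> (\<forall>j. fsupp M (F j) \<subseteq> K)) \<and>
     (\<exists>L. \<forall>j. Lip_bound M (mspace M) L (F j)) \<and>
     (\<forall>x\<in>mspace M. (\<lambda>j. F j x) \<longlonglongrightarrow> f x)"

definition converges_Lip_loc :: "'a metric \<Rightarrow> (nat \<Rightarrow> 'a \<Rightarrow> complex) \<Rightarrow> ('a \<Rightarrow> complex) \<Rightarrow> bool" where
  "converges_Lip_loc M P p \<longleftrightarrow>
     (\<forall>K. compactin (mtopology_of M) K \<longrightarrow> (\<exists>L. \<forall>j. Lip_bound M K L (P j))) \<and>
     (\<forall>x\<in>mspace M. (\<lambda>j. P j x) \<longlonglongrightarrow> p x)"

text \<open>
  The tuple of the \<open>m\<close> functions is a family \<open>\<pi>\<close> of which only the members \<open>\<pi> i\<close> with \<open>i < m\<close>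
  matter.  Sequential continuity, applied to constant sequences, entails that a current depends only
  on the values of \<open>f\<close> and of these \<open>\<pi> i\<close> on the carrier of the metric space.  Values of \<open>T\<close> on
  other arguments are irrelevant.
\<close>

definition local_current ::
    "'a metric \<Rightarrow> nat \<Rightarrow> (('a \<Rightarrow> complex) \<Rightarrow> (nat \<Rightarrow> 'a \<Rightarrow> complex) \<Rightarrow> complex) \<Rightarrow> bool" where
  "local_current M m T \<longleftrightarrow>
     (\<forall>f\<in>test_functions M. \<forall>g\<in>test_functions M. \<forall>a b \<pi>. (\<forall>i<m. \<pi> i \<in> Lip_loc M) \<longrightarrow>
        T (\<lambda>x. a * f x + b * g x) \<pi> = a * T f \<pi> + b * T g \<pi>) \<and>
     (\<forall>f\<in>test_functions M. \<forall>\<pi>. (\<forall>i<m. \<pi> i \<in> Lip_loc M) \<longrightarrow>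
        (\<forall>i<m. \<forall>u\<in>Lip_loc M. \<forall>v\<in>Lip_loc M. \<forall>a b.
          T f (\<pi>(i := \<lambda>x. a * u x + b * v x)) = a * T f (\<pi>(i := u)) + b * T f (\<pi>(i := v)))) \<and>
     (\<forall>F f P \<pi>.
        (\<forall>j. F j \<in> test_functions M) \<and> f \<in> test_functions M \<and>
        (\<forall>i<m. (\<forall>j. P j i \<in> Lip_loc M) \<and> \<pi> i \<in> Lip_loc M) \<and>
        converges_test M F f \<and> (\<forall>i<m. converges_Lip_loc M (\<lambda>j. P j i) (\<pi> i)) \<longrightarrow>
        (\<lambda>j. T (F j) (P j)) \<longlonglongrightarrow> T f \<pi>) \<and>
     (\<forall>f\<in>test_functions M. \<forall>\<pi>. (\<forall>i<m. \<pi> i \<in> Lip_loc M) \<and>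
        (\<exists>i<m. \<exists>U c. openin (mtopology_of M) U \<and> fsupp M f \<subseteq> U \<and> (\<forall>x\<in>U. \<pi> i x = c)) \<longrightarrow>
        T f \<pi> = 0)"

definition csupp ::
    "'a metric \<Rightarrow> nat \<Rightarrow> (('a \<Rightarrow> complex) \<Rightarrow> (nat \<Rightarrow> 'a \<Rightarrow> complex) \<Rightarrow> complex) \<Rightarrow> 'a set" where
  "csupp M m T =
     \<Inter>{C. closedin (mtopology_of M) C \<and>
          (\<forall>f\<in>test_functions M. \<forall>\<pi>. (\<forall>i<m. \<pi> i \<in> Lip_loc M) \<and> fsupp M f \<inter> C = {} \<longrightarrow> T f \<pi> = 0)}"

definition cutoff :: "'a metric \<Rightarrow> 'a set \<Rightarrow> ('a \<Rightarrow> complex) \<Rightarrow> bool" where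
  "cutoff M S \<eta> \<longleftrightarrow> \<eta> \<in> test_functions M \<and>
     (\<exists>U. openin (mtopology_of M) U \<and> S \<subseteq> U \<and> (\<forall>x\<in>U. \<eta> x = 1))"

text \<open>
  Meaningful for \<open>T\<close> a local current of dimension \<open>m\<close> on \<open>V\<close> and \<open>h\<close> locally Lipschitz on \<open>V\<close>
  and proper on \<open>csupp V m T\<close>; the value then does not depend on the choice of the cut-off.
\<close>

definition pushforward ::
    "'a metric \<Rightarrow> nat \<Rightarrow> ('a \<Rightarrow> 'b) \<Rightarrow>
     (('a \<Rightarrow> complex) \<Rightarrow> (nat \<Rightarrow> 'a \<Rightarrow> complex) \<Rightarrow> complex) \<Rightarrow>
     (('b \<Rightarrow> complex) \<Rightarrow> (nat \<Rightarrow> 'b \<Rightarrow> complex) \<Rightarrow> complex)" where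
  "pushforward V m h T f \<pi> =
     (let \<eta> = (SOME \<eta>. cutoff V (csupp V m T \<inter> fsupp V (f \<circ> h)) \<eta>)
      in T (\<lambda>x. \<eta> x * f (h x)) (\<lambda>i. \<pi> i \<circ> h))"

end

theory Submission
  imports Defs "HOL-Library.Function_Algebras"
begin

text \<open>
  In a chart \<open>\<phi>\<close> with values in \<open>Y = \<Union>\<L>\<close>, cut \<open>T\<close> off near \<open>x\<close> and transport it to a compactly
  supported current \<open>Q\<close> on \<open>Y\<close>, where the family \<open>L\<^sub>0, \<dots>, L\<^bsub>k-1\<^esub>\<close> of subspaces may be assumed closed under
  intersections. There are Lipschitz retractions \<open>r\<^sub>j\<close> of \<open>Y\<close> onto \<open>L\<^sub>j\<close> which map every \<open>L\<^sub>i\<close> into itself.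
  Put \<open>Q\<^sub>0 = Q\<close> and let \<open>Q\<^bsub>j+1\<^esub>\<close> be \<open>Q\<^sub>j\<close> minus its push-forward under \<open>r\<^sub>j\<close>. Inductively \<open>Q\<^sub>j\<close> is supported
  in \<open>L\<^sub>j \<union> \<dots> \<union> L\<^bsub>k-1\<^esub>\<close>: if \<open>f\<close> vanishes near the later subspaces, then \<open>(f, \<pi>)\<close> and its composition
  with \<open>r\<^sub>j\<close> agree on the support of \<open>Q\<^sub>j\<close> near the support of \<open>f\<close>. Hence \<open>Q\<^sub>k = 0\<close>, and \<open>Q\<close> is the sum
  of the currents \<open>(r\<^sub>j)\<^sub>\<sharp> Q\<^sub>j\<close>, each of which lives on a single linear subspace.
\<close>

section \<open>Compactly supported currents\<close>

text \<open>The retractions are Lipschitz but need not be holomorphic; metric currents can be pushed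
  forward along them all the same. Holomorphy is asked only of the final maps, each a linear
  parametrisation of one subspace followed by the inverse chart. Closure under intersections makes
  the retractions possible: a retraction onto \<open>L\<close> that preserves a flat
  \<open>F\<close> must send \<open>F\<close> into \<open>L \<inter> F\<close>, and Lipschitz maps
  on two flats that agree on the intersection glue to a Lipschitz map, because linear subspaces meet
  at a positive angle. The inductive step faces a gap: tuples that agree on the support of a current
  may agree on a set with empty interior, while locality speaks of open sets. Sequential continuity
  closes it, since a function that vanishes on a set is a limit, with bounded Lipschitz constants,
  of functions that vanish near that set. As the composition of a test function with
  \<open>r j\<close> can lose compact support, the induction is carried out for currents that accept
  all locally Lipschitz functions.\<close>

lemma Lip_loc_iff:
  "f \<in> Lip_loc M \<longleftrightarrow> (\<forall>K. compactin (mtopology_of M) K \<longrightarrow> (\<exists>L. Lip_bound M K L f))"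
proof -
  have "K \<inter> mspace M = K" if "compactin (mtopology_of M) K" for K
    using compactin_subset_topspace[OF that] by auto
  then show ?thesis
    by (auto simp: Lip_loc_def locally_Lipschitz_def Lipschitz_continuous_map_def Lip_bound_def
        dist_norm)
qed

lemma Lip_bound_mono:
  "\<lbrakk>Lip_bound M S L f; S' \<subseteq> S; S \<subseteq> mspace M; L \<le> L'\<rbrakk> \<Longrightarrow> Lip_bound M S' L' f"
  unfolding Lip_bound_def by (meson mdist_nonneg mult_right_mono order_trans subset_iff)

lemma Lip_bound_obtain_nonneg:
  assumes "Lip_bound M S L f" and "S \<subseteq> mspace M"
  obtains L' where "0 \<le> L'" "Lip_bound M S L' f"
  using Lip_bound_mono[OF assms(1) subset_refl assms(2), of "max L 0"] by (metis max.cobounded1 max.cobounded2)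

lemma Lip_bound_lincomb:
  assumes "Lip_bound M S L f" "Lip_bound M S L' g"
  shows "Lip_bound M S (cmod a * L + cmod b * L') (\<lambda>x. a * f x + b * g x)"
  unfolding Lip_bound_def
proof (intro ballI)
  fix x y assume "x \<in> S" "y \<in> S"
  then have f: "cmod (f x - f y) \<le> L * mdist M x y" and g: "cmod (g x - g y) \<le> L' * mdist M x y"
    using assms by (auto simp: Lip_bound_def)
  have "(a * f x + b * g x) - (a * f y + b * g y) = a * (f x - f y) + b * (g x - g y)"
    by (simp add: algebra_simps)
  then have "cmod ((a * f x + b * g x) - (a * f y + b * g y))
      \<le> cmod a * cmod (f x - f y) + cmod b * cmod (g x - g y)"
    by (metis norm_mult norm_triangle_ineq)
  also have "\<dots> \<le> cmod a * (L * mdist M x y) + cmod b * (L' * mdist M x y)"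
    using f g by (intro add_mono mult_left_mono) auto
  finally show "cmod ((a * f x + b * g x) - (a * f y + b * g y))
      \<le> (cmod a * L + cmod b * L') * mdist M x y"
    by (simp add: algebra_simps)
qed

text \<open>A factor \<open>g\<close> that is controlled only on \<open>E\<close> does no harm,
  because \<open>\<eta>\<close> vanishes off \<open>E\<close>: if just one of the two points lies in
  \<open>E\<close>, the difference of the products is \<open>\<eta> x - \<eta> y\<close> times a
  bounded value of \<open>g\<close>, so \<open>g\<close> is never compared across the boundary of
  \<open>E\<close>.\<close>

lemma Lip_bound_mult_supported:
  assumes \<eta>: "Lip_bound M S A \<eta>" "\<And>x. x \<in> S \<Longrightarrow> cmod (\<eta> x) \<le> H" "\<And>x. x \<in> S - E \<Longrightarrow> \<eta> x = 0"
    and g: "Lip_bound M (S \<inter> E) L g" "\<And>x. x \<in> S \<inter> E \<Longrightarrow> cmod (g x) \<le> G"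
    and S: "S \<subseteq> mspace M" and nn: "0 \<le> A" "0 \<le> H" "0 \<le> L" "0 \<le> G"
  shows "Lip_bound M S (A * G + H * L) (\<lambda>x. \<eta> x * g x)"
  unfolding Lip_bound_def
proof (intro ballI)
  fix x y assume x: "x \<in> S" and y: "y \<in> S"
  have d: "0 \<le> mdist M x y" by simp
  have \<eta>xy: "cmod (\<eta> x - \<eta> y) \<le> A * mdist M x y"
    using \<eta>(1) x y by (auto simp: Lip_bound_def)
  have mixed: "cmod (\<eta> x * g x - \<eta> y * g y) \<le> A * mdist M x y * G + H * (L * mdist M x y)"
  proof (cases "x \<in> E")
    case xE: True
    show ?thesis
    proof (cases "y \<in> E")
      case yE: True
      have "\<eta> x * g x - \<eta> y * g y = (\<eta> x - \<eta> y) * g x + \<eta> y * (g x - g y)"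
        by (simp add: algebra_simps)
      then have "cmod (\<eta> x * g x - \<eta> y * g y) \<le> cmod (\<eta> x - \<eta> y) * cmod (g x) + cmod (\<eta> y) * cmod (g x - g y)"
        by (metis norm_mult norm_triangle_ineq)
      also have "\<dots> \<le> A * mdist M x y * G + H * (L * mdist M x y)"
        using \<eta>xy \<eta>(2)[OF y] g(1) g(2)[of x] x y xE yE nn
        by (intro add_mono mult_mono) (auto simp: Lip_bound_def)
      finally show ?thesis .
    next
      case False
      then have 0: "\<eta> y = 0" using \<eta>(3) y by auto
      have "cmod (\<eta> x * g x - \<eta> y * g y) = cmod (\<eta> x - \<eta> y) * cmod (g x)"
        by (simp add: 0 norm_mult)
      also have "\<dots> \<le> A * mdist M x y * G"
        using \<eta>xy g(2)[of x] x xE nn by (intro mult_mono) auto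
      finally show ?thesis using nn d by (simp add: add_increasing2)
    qed
  next
    case False
    then have 0: "\<eta> x = 0" using \<eta>(3) x by auto
    show ?thesis
    proof (cases "y \<in> E")
      case True
      have "cmod (\<eta> x * g x - \<eta> y * g y) = cmod (\<eta> x - \<eta> y) * cmod (g y)"
        by (simp add: 0 norm_mult)
      also have "\<dots> \<le> A * mdist M x y * G"
        using \<eta>xy g(2)[of y] y True nn by (intro mult_mono) auto
      finally show ?thesis using nn d by (simp add: add_increasing2)
    next
      case False
      then have "\<eta> y = 0" using \<eta>(3) y by auto
      then show ?thesis using 0 nn d by simp
    qed
  qed
  then show "cmod (\<eta> x * g x - \<eta> y * g y) \<le> (A * G + H * L) * mdist M x y"
    by (simp add: algebra_simps)
qed

lemma converges_Lip_loc_const: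
  "f \<in> Lip_loc M \<Longrightarrow> (\<And>x. x \<in> mspace M \<Longrightarrow> f x = g x) \<Longrightarrow> converges_Lip_loc M (\<lambda>j. f) g"
  by (auto simp: converges_Lip_loc_def Lip_loc_iff)

text \<open>The sequence is bounded at one point of \<open>K\<close>, since it converges there; the
  common Lipschitz constant and the finite diameter of \<open>K\<close> spread this bound over
  \<open>K\<close>.\<close>

lemma converges_Lip_loc_uniform_bounds:
  assumes F: "converges_Lip_loc M F f" and K: "compactin (mtopology_of M) K"
  obtains L G where "0 \<le> L" "0 \<le> G" "\<And>j. Lip_bound M K L (F j)" "\<And>j x. x \<in> K \<Longrightarrow> cmod (F j x) \<le> G"
proof -
  interpret Metric_space "mspace M" "mdist M" by simp
  have KM: "K \<subseteq> mspace M" using compactin_subset_topspace[OF K] by simp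
  obtain L0 where L0: "\<And>j. Lip_bound M K L0 (F j)"
    using F K unfolding converges_Lip_loc_def by blast
  define L where "L = max L0 0"
  have L: "Lip_bound M K L (F j)" for j
    using Lip_bound_mono[OF L0 subset_refl KM, of L] by (simp add: L_def)
  show thesis
  proof (cases "K = {}")
    case True
    then show ?thesis using that[of L 0] L by (simp add: L_def)
  next
    case False
    then obtain x0 where x0: "x0 \<in> K" by auto
    have "(\<lambda>j. F j x0) \<longlonglongrightarrow> f x0" using F x0 KM unfolding converges_Lip_loc_def by blast
    then have "Bseq (\<lambda>j. F j x0)" by (rule convergent_imp_Bseq[OF convergentI])
    then obtain b where b: "0 < b" "\<And>j. cmod (F j x0) \<le> b" by (auto simp: Bseq_def)
    have "mbounded K" using K by (simp add: compactin_imp_mbounded mtopology_of_def)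
    then obtain B where B: "0 < B" "\<And>x. x \<in> K \<Longrightarrow> mdist M x0 x \<le> B"
      using x0 unfolding mbounded_alt_pos by meson
    have "cmod (F j x) \<le> b + L * B" if "x \<in> K" for j x
    proof -
      have "cmod (F j x) \<le> cmod (F j x0) + cmod (F j x0 - F j x)"
        by (metis norm_triangle_sub norm_minus_commute)
      also have "cmod (F j x0 - F j x) \<le> L * mdist M x0 x"
        using L[of j] x0 that by (auto simp: Lip_bound_def)
      also have "\<dots> \<le> L * B" using B(2)[OF that] by (intro mult_left_mono) (auto simp: L_def)
      finally show ?thesis using b(2)[of j] by simp
    qed
    moreover have "0 \<le> b + L * B" using b B by (simp add: L_def)
    ultimately show ?thesis using that[of L "b + L * B"] L by (simp add: L_def)
  qed
qed

lemma Lip_loc_bounds: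
  assumes "f \<in> Lip_loc M" and "compactin (mtopology_of M) K"
  obtains L G where "0 \<le> L" "0 \<le> G" "Lip_bound M K L f" "\<And>x. x \<in> K \<Longrightarrow> cmod (f x) \<le> G"
  using converges_Lip_loc_uniform_bounds[OF converges_Lip_loc_const[OF assms(1) refl] assms(2)]
  by metis

lemma Lip_loc_lincomb:
  "\<lbrakk>f \<in> Lip_loc M; g \<in> Lip_loc M\<rbrakk> \<Longrightarrow> (\<lambda>x. a * f x + b * g x) \<in> Lip_loc M"
  unfolding Lip_loc_iff using Lip_bound_lincomb[of M _ _ f _ g a b] by fast

lemma Lip_loc_diff: "\<lbrakk>f \<in> Lip_loc M; g \<in> Lip_loc M\<rbrakk> \<Longrightarrow> (\<lambda>x. f x - g x) \<in> Lip_loc M"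
  using Lip_loc_lincomb[of f M g 1 "-1"] by simp

lemma Lip_loc_const [simp]: "(\<lambda>x. c) \<in> Lip_loc M"
  unfolding Lip_loc_iff Lip_bound_def by (auto intro!: exI[of _ 0])

lemma Lip_loc_mult:
  assumes f: "f \<in> Lip_loc M" and g: "g \<in> Lip_loc M"
  shows "(\<lambda>x. f x * g x) \<in> Lip_loc M"
  unfolding Lip_loc_iff
proof (intro allI impI)
  fix K assume K: "compactin (mtopology_of M) K"
  obtain L G where f': "0 \<le> L" "0 \<le> G" "Lip_bound M K L f" "\<And>x. x \<in> K \<Longrightarrow> cmod (f x) \<le> G"
    using Lip_loc_bounds[OF f K] by metis
  obtain L' G' where g': "0 \<le> L'" "0 \<le> G'" "Lip_bound M K L' g" "\<And>x. x \<in> K \<Longrightarrow> cmod (g x) \<le> G'"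
    using Lip_loc_bounds[OF g K] by metis
  have "K \<subseteq> mspace M" using compactin_subset_topspace[OF K] by simp
  then have "Lip_bound M K (L * G' + G * L') (\<lambda>x. f x * g x)"
    using Lip_bound_mult_supported[of M K L f G UNIV L' g G'] f' g' by simp
  then show "\<exists>L. Lip_bound M K L (\<lambda>x. f x * g x)" by blast
qed

text \<open>Continuity is known only on each compact set, where the function is Lipschitz. A
  metrizable space is a k-space, so closedness of preimages can be tested on compact sets.\<close>

lemma Lip_loc_continuous_map:
  assumes f: "f \<in> Lip_loc M"
  shows "continuous_map (mtopology_of M) euclidean f"
proof -
  have k: "k_space (mtopology_of M)"
    unfolding mtopology_of_def
    by (intro metrizable_imp_k_space Metric_space.metrizable_space_mtopology) simp
  have cont: "continuous_map (subtopology (mtopology_of M) K) euclidean f"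
    if K: "compactin (mtopology_of M) K" for K
  proof -
    have "Lipschitz_continuous_map (submetric M K) euclidean_metric f"
      using f K by (auto simp: Lip_loc_def locally_Lipschitz_def)
    from Lipschitz_continuous_imp_continuous_map[OF this] show ?thesis
      by (simp add: mtopology_of_submetric)
  qed
  show ?thesis
    unfolding continuous_map_closedin
  proof (intro conjI allI impI)
    show "f \<in> topspace (mtopology_of M) \<rightarrow> topspace euclidean" by simp
    fix C :: "complex set" assume C: "closedin euclidean C"
    have closedI: "closedin (mtopology_of M) S"
      if "S \<subseteq> topspace (mtopology_of M)"
        "\<And>K. compactin (mtopology_of M) K \<Longrightarrow> closedin (subtopology (mtopology_of M) K) (K \<inter> S)" for S
      using k that unfolding k_space by blast
    show "closedin (mtopology_of M) {x \<in> topspace (mtopology_of M). f x \<in> C}"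
    proof (rule closedI)
      show "{x \<in> topspace (mtopology_of M). f x \<in> C} \<subseteq> topspace (mtopology_of M)" by auto
    next
      fix K assume K: "compactin (mtopology_of M) K"
      have "closedin (subtopology (mtopology_of M) K)
          {x \<in> topspace (subtopology (mtopology_of M) K). f x \<in> C}"
        using cont[OF K] C by (auto simp: continuous_map_closedin)
      moreover have "{x \<in> topspace (subtopology (mtopology_of M) K). f x \<in> C}
          = K \<inter> {x \<in> topspace (mtopology_of M). f x \<in> C}"
        by auto
      ultimately show "closedin (subtopology (mtopology_of M) K)
          (K \<inter> {x \<in> topspace (mtopology_of M). f x \<in> C})"
        by simp
    qed
  qed
qed

lemma openin_Lip_loc_norm_less:
  assumes "f \<in> Lip_loc M"
  shows "openin (mtopology_of M) {x \<in> mspace M. cmod (f x) < e}"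
proof -
  have "openin (mtopology_of M) {x \<in> topspace (mtopology_of M). f x \<in> ball 0 e}"
    using Lip_loc_continuous_map[OF assms] open_ball
    unfolding continuous_map_def by (metis open_openin)
  then show ?thesis by simp
qed

lemma closedin_Lip_loc_norm_le:
  assumes "f \<in> Lip_loc M"
  shows "closedin (mtopology_of M) {x \<in> mspace M. cmod (f x) \<le> e}"
proof -
  have "closedin (mtopology_of M) {x \<in> topspace (mtopology_of M). f x \<in> cball 0 e}"
    using Lip_loc_continuous_map[OF assms] closed_cball
    unfolding continuous_map_closedin by (metis closed_closedin)
  then show ?thesis by simp
qed

lemma Lip_loc_postcompose:
  assumes "f \<in> Lip_loc M" and "\<And>z w. cmod (s z - s w) \<le> C * cmod (z - w)" and "0 \<le> C"
  shows "(\<lambda>x. s (f x)) \<in> Lip_loc M"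
  unfolding Lip_loc_iff
proof (intro allI impI)
  fix K assume K: "compactin (mtopology_of M) K"
  then obtain L where L: "Lip_bound M K L f" using assms(1) Lip_loc_iff by metis
  have "cmod (s (f x) - s (f y)) \<le> C * L * mdist M x y" if "x \<in> K" "y \<in> K" for x y
    using assms(2)[of "f x" "f y"] L that mult_left_mono[OF _ \<open>0 \<le> C\<close>]
    unfolding Lip_bound_def by (metis mult.assoc order_trans)
  then show "\<exists>L. Lip_bound M K L (\<lambda>x. s (f x))" unfolding Lip_bound_def by blast
qed

lemma Lipschitz_map_compactin_image:
  assumes "Lipschitz_continuous_map M M' r" and "compactin (mtopology_of M) K"
  shows "compactin (mtopology_of M') (r ` K)"
  using Lipschitz_continuous_imp_continuous_map[OF assms(1)] assms(2) by (rule image_compactin[rotated])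

lemma Lip_bound_compose:
  assumes "Lip_bound M' (r ` K) L f" and "0 \<le> L"
    and "\<And>x y. \<lbrakk>x \<in> K; y \<in> K\<rbrakk> \<Longrightarrow> mdist M' (r x) (r y) \<le> C * mdist M x y"
  shows "Lip_bound M K (L * C) (f \<circ> r)"
  unfolding Lip_bound_def
proof (intro ballI)
  fix x y assume "x \<in> K" "y \<in> K"
  then show "cmod ((f \<circ> r) x - (f \<circ> r) y) \<le> L * C * mdist M x y"
    using assms mult_left_mono[OF assms(3) assms(2)]
    unfolding Lip_bound_def by (smt (verit, best) comp_apply imageI mult.assoc)
qed

lemma converges_Lip_loc_compose:
  assumes F: "converges_Lip_loc M' F f" and r: "Lipschitz_continuous_map M M' r"
  shows "converges_Lip_loc M (\<lambda>j. F j \<circ> r) (f \<circ> r)"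
  unfolding converges_Lip_loc_def
proof (intro conjI allI impI ballI)
  fix K assume K: "compactin (mtopology_of M) K"
  obtain L where L: "0 \<le> L" "\<And>j. Lip_bound M' (r ` K) L (F j)"
    using converges_Lip_loc_uniform_bounds[OF F Lipschitz_map_compactin_image[OF r K]] by metis
  obtain C where C: "\<And>x y. \<lbrakk>x \<in> mspace M; y \<in> mspace M\<rbrakk> \<Longrightarrow> mdist M' (r x) (r y) \<le> C * mdist M x y"
    using r unfolding Lipschitz_continuous_map_def by blast
  have "K \<subseteq> mspace M" using compactin_subset_topspace[OF K] by simp
  then have "Lip_bound M K (L * C) (F j \<circ> r)" for j
    by (intro Lip_bound_compose[OF L(2,1)] C) auto
  then show "\<exists>L. \<forall>j. Lip_bound M K L (F j \<circ> r)" by blast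
next
  fix x assume "x \<in> mspace M"
  then have "r x \<in> mspace M'" using r unfolding Lipschitz_continuous_map_def by blast
  then show "(\<lambda>j. (F j \<circ> r) x) \<longlonglongrightarrow> (f \<circ> r) x"
    using F unfolding converges_Lip_loc_def by simp
qed

lemma Lip_loc_if_converges: "converges_Lip_loc M F f \<Longrightarrow> F j \<in> Lip_loc M"
  unfolding converges_Lip_loc_def Lip_loc_iff by blast

lemma Lip_loc_compose:
  assumes f: "f \<in> Lip_loc M'" and r: "Lipschitz_continuous_map M M' r"
  shows "f \<circ> r \<in> Lip_loc M"
proof -
  have "converges_Lip_loc M' (\<lambda>j. f) f" by (rule converges_Lip_loc_const[OF f refl])
  then have "converges_Lip_loc M (\<lambda>j. f \<circ> r) (f \<circ> r)" by (rule converges_Lip_loc_compose[OF _ r])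
  then show ?thesis unfolding converges_Lip_loc_def Lip_loc_iff by blast
qed

text \<open>
  The analogue of \<^const>\<open>local_current\<close> for compactly supported currents, on which arbitrary
  locally Lipschitz functions can be evaluated.
\<close>

definition compact_current ::
    "'a metric \<Rightarrow> nat \<Rightarrow> (('a \<Rightarrow> complex) \<Rightarrow> (nat \<Rightarrow> 'a \<Rightarrow> complex) \<Rightarrow> complex) \<Rightarrow> bool" where
  "compact_current M m Q \<longleftrightarrow>
     (\<forall>f\<in>Lip_loc M. \<forall>g\<in>Lip_loc M. \<forall>a b \<pi>. (\<forall>i<m. \<pi> i \<in> Lip_loc M) \<longrightarrow>
        Q (\<lambda>x. a * f x + b * g x) \<pi> = a * Q f \<pi> + b * Q g \<pi>) \<and>
     (\<forall>f\<in>Lip_loc M. \<forall>\<pi>. (\<forall>i<m. \<pi> i \<in> Lip_loc M) \<longrightarrow>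
        (\<forall>i<m. \<forall>u\<in>Lip_loc M. \<forall>v\<in>Lip_loc M. \<forall>a b.
          Q f (\<pi>(i := \<lambda>x. a * u x + b * v x)) = a * Q f (\<pi>(i := u)) + b * Q f (\<pi>(i := v)))) \<and>
     (\<forall>F f P \<pi>.
        (\<forall>j. F j \<in> Lip_loc M) \<and> f \<in> Lip_loc M \<and>
        (\<forall>i<m. (\<forall>j. P j i \<in> Lip_loc M) \<and> \<pi> i \<in> Lip_loc M) \<and>
        converges_Lip_loc M F f \<and> (\<forall>i<m. converges_Lip_loc M (\<lambda>j. P j i) (\<pi> i)) \<longrightarrow>
        (\<lambda>j. Q (F j) (P j)) \<longlonglongrightarrow> Q f \<pi>) \<and>
     (\<forall>f\<in>Lip_loc M. \<forall>\<pi>. (\<forall>i<m. \<pi> i \<in> Lip_loc M) \<and>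
        (\<exists>i<m. \<exists>U c. openin (mtopology_of M) U \<and> fsupp M f \<subseteq> U \<and> (\<forall>x\<in>U. \<pi> i x = c)) \<longrightarrow>
        Q f \<pi> = 0)"

context
  fixes M :: "'a metric" and m :: nat and Q
  assumes Q: "compact_current M m Q"
begin

lemma compact_current_lincomb:
  "\<lbrakk>f \<in> Lip_loc M; g \<in> Lip_loc M; \<And>i. i < m \<Longrightarrow> \<pi> i \<in> Lip_loc M\<rbrakk> \<Longrightarrow>
    Q (\<lambda>x. a * f x + b * g x) \<pi> = a * Q f \<pi> + b * Q g \<pi>"
  by (rule conjunct1[OF Q[unfolded compact_current_def], rule_format]) auto

lemma compact_current_lincomb_arg:
  "\<lbrakk>f \<in> Lip_loc M; \<And>i. i < m \<Longrightarrow> \<pi> i \<in> Lip_loc M; i < m; u \<in> Lip_loc M; v \<in> Lip_loc M\<rbrakk> \<Longrightarrow>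
    Q f (\<pi>(i := \<lambda>x. a * u x + b * v x)) = a * Q f (\<pi>(i := u)) + b * Q f (\<pi>(i := v))"
  by (rule conjunct1[OF conjunct2[OF Q[unfolded compact_current_def]], rule_format]) auto

lemma compact_current_tendsto:
  "\<lbrakk>\<And>j. F j \<in> Lip_loc M; f \<in> Lip_loc M; \<And>i j. i < m \<Longrightarrow> P j i \<in> Lip_loc M;
    \<And>i. i < m \<Longrightarrow> \<pi> i \<in> Lip_loc M; converges_Lip_loc M F f;
    \<And>i. i < m \<Longrightarrow> converges_Lip_loc M (\<lambda>j. P j i) (\<pi> i)\<rbrakk> \<Longrightarrow>
    (\<lambda>j. Q (F j) (P j)) \<longlonglongrightarrow> Q f \<pi>"
  by (rule conjunct1[OF conjunct2[OF conjunct2[OF Q[unfolded compact_current_def]]], rule_format]) auto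

lemma compact_current_local:
  assumes "f \<in> Lip_loc M" "\<And>i. i < m \<Longrightarrow> \<pi> i \<in> Lip_loc M" "i < m"
    "openin (mtopology_of M) U" "fsupp M f \<subseteq> U" "\<And>x. x \<in> U \<Longrightarrow> \<pi> i x = c"
  shows "Q f \<pi> = 0"
proof -
  have "\<exists>i<m. \<exists>U c. openin (mtopology_of M) U \<and> fsupp M f \<subseteq> U \<and> (\<forall>x\<in>U. \<pi> i x = c)"
    using assms(3-6) by (intro exI[of _ i] exI[of _ U] exI[of _ c] conjI ballI)
  then show ?thesis
    using conjunct2[OF conjunct2[OF conjunct2[OF Q[unfolded compact_current_def]]]] assms(1,2)
    by simp
qed

lemma compact_current_diff:
  "\<lbrakk>f \<in> Lip_loc M; g \<in> Lip_loc M; \<And>i. i < m \<Longrightarrow> \<pi> i \<in> Lip_loc M\<rbrakk> \<Longrightarrow>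
    Q (\<lambda>x. f x - g x) \<pi> = Q f \<pi> - Q g \<pi>"
  using compact_current_lincomb[of f g \<pi> 1 "-1"] by simp

lemma compact_current_diff_arg:
  "\<lbrakk>f \<in> Lip_loc M; \<And>i. i < m \<Longrightarrow> \<pi> i \<in> Lip_loc M; i < m; u \<in> Lip_loc M; v \<in> Lip_loc M\<rbrakk> \<Longrightarrow>
    Q f (\<pi>(i := \<lambda>x. u x - v x)) = Q f (\<pi>(i := u)) - Q f (\<pi>(i := v))"
  using compact_current_lincomb_arg[of f \<pi> i u v 1 "-1"] by simp

text \<open>Off the carrier the two tuples may differ arbitrarily, so linearity alone cannot compare
  the values. The constant sequence \<open>f\<close>, \<open>\<pi>\<close> converges to
  \<open>g\<close>, \<open>\<rho>\<close>, and sequential continuity does the rest.\<close>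

lemma compact_current_cong:
  assumes "f \<in> Lip_loc M" "\<And>i. i < m \<Longrightarrow> \<pi> i \<in> Lip_loc M"
    and "\<And>x. x \<in> mspace M \<Longrightarrow> f x = g x" "\<And>i x. \<lbrakk>i < m; x \<in> mspace M\<rbrakk> \<Longrightarrow> \<pi> i x = \<rho> i x"
  shows "Q f \<pi> = Q g \<rho>"
proof -
  have "h \<in> Lip_loc M" if "k \<in> Lip_loc M" "\<And>x. x \<in> mspace M \<Longrightarrow> k x = h x" for h k
  proof -
    have "Lip_bound M K L h" if K: "compactin (mtopology_of M) K" and "Lip_bound M K L k" for K L
      using that compactin_subset_topspace[OF K] \<open>\<And>x. x \<in> mspace M \<Longrightarrow> k x = h x\<close>
      by (auto simp: Lip_bound_def subset_iff)
    then show ?thesis using that(1) unfolding Lip_loc_iff by blast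
  qed
  then have "g \<in> Lip_loc M" "\<And>i. i < m \<Longrightarrow> \<rho> i \<in> Lip_loc M"
    using assms by blast+
  then have "(\<lambda>j::nat. Q f \<pi>) \<longlonglongrightarrow> Q g \<rho>"
    using assms by (intro compact_current_tendsto converges_Lip_loc_const) auto
  then show ?thesis by (simp add: LIMSEQ_const_iff)
qed

end

lemma fsupp_subset_closedin:
  "\<lbrakk>closedin (mtopology_of M) C; \<And>x. \<lbrakk>x \<in> mspace M; f x \<noteq> 0\<rbrakk> \<Longrightarrow> x \<in> C\<rbrakk> \<Longrightarrow> fsupp M f \<subseteq> C"
  unfolding fsupp_def by (rule closure_of_minimal) auto

lemma subset_fsupp: "\<lbrakk>x \<in> mspace M; f x \<noteq> 0\<rbrakk> \<Longrightarrow> x \<in> fsupp M f"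
  unfolding fsupp_def by (rule subsetD[OF closure_of_subset]) auto

lemma closedin_fsupp: "closedin (mtopology_of M) (fsupp M f)"
  by (simp add: fsupp_def)

text \<open>This is the push-forward of \<open>Q\<close> under \<open>r\<close>: as \<open>Q\<close>
  accepts every locally Lipschitz function, the arguments are simply composed with \<open>r\<close>.
  Locality survives because the support of \<open>f \<circ> r\<close> lies in the preimage of the
  support of \<open>f\<close>.\<close>

lemma compact_current_pullback:
  assumes Q: "compact_current M m Q" and r: "Lipschitz_continuous_map M M' r"
  shows "compact_current M' m (\<lambda>f \<pi>. Q (f \<circ> r) (\<lambda>i. \<pi> i \<circ> r))"
  unfolding compact_current_def
proof (intro conjI ballI allI impI; (elim conjE exE)?)
  fix f g a b \<pi>
  assume *: "f \<in> Lip_loc M'" "g \<in> Lip_loc M'" "\<forall>i<m. \<pi> i \<in> Lip_loc M'"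
  have "(\<lambda>x. a * f x + b * g x) \<circ> r = (\<lambda>x. a * (f \<circ> r) x + b * (g \<circ> r) x)" by auto
  then show "Q ((\<lambda>x. a * f x + b * g x) \<circ> r) (\<lambda>i. \<pi> i \<circ> r) =
      a * Q (f \<circ> r) (\<lambda>i. \<pi> i \<circ> r) + b * Q (g \<circ> r) (\<lambda>i. \<pi> i \<circ> r)"
    using compact_current_lincomb[OF Q, of "f \<circ> r" "g \<circ> r" "\<lambda>i. \<pi> i \<circ> r" a b] * Lip_loc_compose[OF _ r]
    by simp
next
  fix f \<pi> i u v a b
  assume *: "f \<in> Lip_loc M'" "\<forall>i<m. \<pi> i \<in> Lip_loc M'" "i < m" "u \<in> Lip_loc M'" "v \<in> Lip_loc M'"
  have upd: "(\<lambda>j. (\<pi>(i := w)) j \<circ> r) = (\<lambda>j. \<pi> j \<circ> r)(i := w \<circ> r)" for w by auto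
  have "(\<lambda>x. a * u x + b * v x) \<circ> r = (\<lambda>x. a * (u \<circ> r) x + b * (v \<circ> r) x)" by auto
  then show "Q (f \<circ> r) (\<lambda>j. (\<pi>(i := \<lambda>x. a * u x + b * v x)) j \<circ> r) =
      a * Q (f \<circ> r) (\<lambda>j. (\<pi>(i := u)) j \<circ> r) + b * Q (f \<circ> r) (\<lambda>j. (\<pi>(i := v)) j \<circ> r)"
    unfolding upd
    using compact_current_lincomb_arg[OF Q, of "f \<circ> r" "\<lambda>i. \<pi> i \<circ> r" i "u \<circ> r" "v \<circ> r" a b] *
      Lip_loc_compose[OF _ r] by simp
next
  fix F f P \<pi>
  assume "\<forall>j. F j \<in> Lip_loc M'" "f \<in> Lip_loc M'" "\<forall>i<m. (\<forall>j. P j i \<in> Lip_loc M') \<and> \<pi> i \<in> Lip_loc M'"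
    "converges_Lip_loc M' F f" "\<forall>i<m. converges_Lip_loc M' (\<lambda>j. P j i) (\<pi> i)"
  then show "(\<lambda>j. Q (F j \<circ> r) (\<lambda>i. P j i \<circ> r)) \<longlonglongrightarrow> Q (f \<circ> r) (\<lambda>i. \<pi> i \<circ> r)"
    using r by (intro compact_current_tendsto[OF Q]) (auto intro: Lip_loc_compose converges_Lip_loc_compose)
next
  fix f \<pi> i U c
  assume *: "f \<in> Lip_loc M'" "\<forall>i<m. \<pi> i \<in> Lip_loc M'" "i < m" "openin (mtopology_of M') U"
    "fsupp M' f \<subseteq> U" "\<forall>x\<in>U. \<pi> i x = c"
  have cont: "continuous_map (mtopology_of M) (mtopology_of M') r"
    by (rule Lipschitz_continuous_imp_continuous_map[OF r])
  have rM: "r x \<in> mspace M'" if "x \<in> mspace M" for x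
    using r that unfolding Lipschitz_continuous_map_def by blast
  have "fsupp M (f \<circ> r) \<subseteq> {x \<in> topspace (mtopology_of M). r x \<in> fsupp M' f}"
    using closedin_continuous_map_preimage[OF cont closedin_fsupp] rM
    by (intro fsupp_subset_closedin) (auto intro: subset_fsupp)
  then have "fsupp M (f \<circ> r) \<subseteq> {x \<in> topspace (mtopology_of M). r x \<in> U}" using *(5) by auto
  then show "Q (f \<circ> r) (\<lambda>i. \<pi> i \<circ> r) = 0"
    using * r openin_continuous_map_preimage[OF cont *(4)]
    by (intro compact_current_local[OF Q, where i = i and c = c]) (auto intro: Lip_loc_compose)
qed

lemma compact_current_minus:
  assumes Q: "compact_current M m Q" and Q': "compact_current M m Q'"
  shows "compact_current M m (\<lambda>f \<pi>. Q f \<pi> - Q' f \<pi>)"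
  unfolding compact_current_def
proof (intro conjI ballI allI impI; (elim conjE exE)?)
  fix f g a b \<pi>
  assume "f \<in> Lip_loc M" "g \<in> Lip_loc M" "\<forall>i<m. \<pi> i \<in> Lip_loc M"
  then show "Q (\<lambda>x. a * f x + b * g x) \<pi> - Q' (\<lambda>x. a * f x + b * g x) \<pi> =
       a * (Q f \<pi> - Q' f \<pi>) + b * (Q g \<pi> - Q' g \<pi>)"
    by (simp add: compact_current_lincomb[OF Q] compact_current_lincomb[OF Q'] algebra_simps)
next
  fix f \<pi> i u v a b
  assume "f \<in> Lip_loc M" "\<forall>i<m. \<pi> i \<in> Lip_loc M" "i < m" "u \<in> Lip_loc M" "v \<in> Lip_loc M"
  then show "Q f (\<pi>(i := \<lambda>x. a * u x + b * v x)) - Q' f (\<pi>(i := \<lambda>x. a * u x + b * v x)) =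
       a * (Q f (\<pi>(i := u)) - Q' f (\<pi>(i := u))) + b * (Q f (\<pi>(i := v)) - Q' f (\<pi>(i := v)))"
    by (simp add: compact_current_lincomb_arg[OF Q] compact_current_lincomb_arg[OF Q'] algebra_simps)
next
  fix F f P \<pi>
  assume "\<forall>j. F j \<in> Lip_loc M" "f \<in> Lip_loc M" "\<forall>i<m. (\<forall>j. P j i \<in> Lip_loc M) \<and> \<pi> i \<in> Lip_loc M"
    "converges_Lip_loc M F f" "\<forall>i<m. converges_Lip_loc M (\<lambda>j. P j i) (\<pi> i)"
  then show "(\<lambda>j. Q (F j) (P j) - Q' (F j) (P j)) \<longlonglongrightarrow> Q f \<pi> - Q' f \<pi>"
    by (intro tendsto_diff compact_current_tendsto[OF Q] compact_current_tendsto[OF Q']) auto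
next
  fix f \<pi> i U c
  assume *: "f \<in> Lip_loc M" "\<forall>i<m. \<pi> i \<in> Lip_loc M" "i < m" "openin (mtopology_of M) U"
    "fsupp M f \<subseteq> U" "\<forall>x\<in>U. \<pi> i x = c"
  show "Q f \<pi> - Q' f \<pi> = 0"
    using compact_current_local[OF Q, of f \<pi> i U c] compact_current_local[OF Q', of f \<pi> i U c] * by simp
qed


section \<open>Decomposition along retractions\<close>

text \<open>Subtracting the nearest point of the disc of radius \<open>e\<close> annihilates the
  disc and shrinks larger moduli by \<open>e\<close>. Points move by at most \<open>e\<close>, and
  the Lipschitz constant is bounded independently of \<open>e\<close>; so the thresholded functions
  converge in \<open>Lip_loc\<close> as \<open>e\<close> tends to 0, and each of them vanishes near
  the zeros of the given function.\<close>

definition soft_threshold :: "real \<Rightarrow> complex \<Rightarrow> complex" where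
  "soft_threshold e z = z - closest_point (cball 0 e) z"

lemma soft_threshold_Lipschitz:
  assumes "0 \<le> e"
  shows "cmod (soft_threshold e z - soft_threshold e w) \<le> 2 * cmod (z - w)"
proof -
  have "cmod (closest_point (cball 0 e) z - closest_point (cball 0 e) w) \<le> cmod (z - w)"
    using closest_point_lipschitz[of "cball (0::complex) e" z w] assms by (simp add: dist_norm)
  moreover have "cmod (soft_threshold e z - soft_threshold e w)
      \<le> cmod (z - w) + cmod (closest_point (cball 0 e) z - closest_point (cball 0 e) w)"
    unfolding soft_threshold_def using norm_triangle_ineq4[of "z - w"] by (metis diff_diff_eq2 diff_add_eq add_diff_eq diff_diff_add add.commute)
  ultimately show ?thesis by simp
qed

lemma soft_threshold_eq_0: "cmod z \<le> e \<Longrightarrow> soft_threshold e z = 0"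
  by (simp add: soft_threshold_def closest_point_self)

lemma soft_threshold_close:
  assumes "0 \<le> e"
  shows "cmod (soft_threshold e z - z) \<le> e"
  using closest_point_in_set[of "cball (0::complex) e" z] assms by (simp add: soft_threshold_def)

lemma converges_soft_threshold:
  assumes u: "u \<in> Lip_loc M"
  shows "converges_Lip_loc M (\<lambda>j x. soft_threshold (1 / (real j + 1)) (u x)) u"
  unfolding converges_Lip_loc_def
proof (intro conjI allI impI ballI)
  fix K assume K: "compactin (mtopology_of M) K"
  obtain L where L: "Lip_bound M K L u" using u K unfolding Lip_loc_iff by blast
  have "Lip_bound M K (2 * L) (\<lambda>x. soft_threshold (1 / (real j + 1)) (u x))" for j
    unfolding Lip_bound_def
  proof (intro ballI)
    fix x y assume "x \<in> K" "y \<in> K"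
    then have "cmod (u x - u y) \<le> L * mdist M x y" using L by (simp add: Lip_bound_def)
    then show "cmod (soft_threshold (1 / (real j + 1)) (u x) - soft_threshold (1 / (real j + 1)) (u y))
        \<le> 2 * L * mdist M x y"
      using soft_threshold_Lipschitz[of "1 / (real j + 1)" "u x" "u y"] by simp
  qed
  then show "\<exists>L. \<forall>j. Lip_bound M K L (\<lambda>x. soft_threshold (1 / (real j + 1)) (u x))" by blast
next
  fix x
  show "(\<lambda>j. soft_threshold (1 / (real j + 1)) (u x)) \<longlonglongrightarrow> u x"
  proof (rule LIM_zero_cancel, rule Lim_null_comparison)
    show "\<forall>\<^sub>F j in sequentially. cmod (soft_threshold (1 / (real j + 1)) (u x) - u x) \<le> inverse (real (Suc j))"
      using soft_threshold_close[of "1 / (real _ + 1)" "u x"]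
      by (intro always_eventually allI) (simp add: inverse_eq_divide add.commute)
    show "(\<lambda>j. inverse (real (Suc j))) \<longlonglongrightarrow> 0" by (rule LIMSEQ_inverse_real_of_nat)
  qed
qed

definition plateau :: "real \<Rightarrow> real \<Rightarrow> real \<Rightarrow> real" where
  "plateau a b t = max 0 (min 1 ((b - t) / (b - a)))"

lemma plateau_eq_1: "a < b \<Longrightarrow> t \<le> a \<Longrightarrow> plateau a b t = 1"
  by (auto simp: plateau_def min_def max_def field_simps)

lemma plateau_eq_0: "a < b \<Longrightarrow> b \<le> t \<Longrightarrow> plateau a b t = 0"
  by (auto simp: plateau_def min_def max_def field_simps)

lemma plateau_bounds: "0 \<le> plateau a b t" "plateau a b t \<le> 1"
  by (auto simp: plateau_def)

lemma plateau_Lipschitz: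
  assumes "a < b"
  shows "\<bar>plateau a b s - plateau a b t\<bar> \<le> \<bar>s - t\<bar> / (b - a)"
proof -
  have "\<bar>plateau a b s - plateau a b t\<bar> \<le> \<bar>(b - s) / (b - a) - (b - t) / (b - a)\<bar>"
    unfolding plateau_def by linarith
  also have "\<dots> = \<bar>s - t\<bar> / (b - a)"
    using assms by (simp add: diff_divide_distrib[symmetric] abs_minus_commute)
  finally show ?thesis .
qed

text \<open>After soft thresholding, a function that vanishes on \<open>Y\<close> vanishes on a
  neighbourhood of \<open>Y\<close>, and the thresholded functions converge to it. Thus vanishing of
  \<open>Q\<close> passes from functions that are zero near \<open>Y\<close> to functions that are
  zero on \<open>Y\<close>.\<close>

lemma compact_current_vanishes_on:
  assumes Q: "compact_current M m Q" and Y: "Y \<subseteq> mspace M"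
    and van: "\<And>f \<pi> U. \<lbrakk>f \<in> Lip_loc M; \<And>i. i < m \<Longrightarrow> \<pi> i \<in> Lip_loc M; openin (mtopology_of M) U;
      Y \<subseteq> U; \<And>x. x \<in> U \<Longrightarrow> f x = 0\<rbrakk> \<Longrightarrow> Q f \<pi> = 0"
    and f: "f \<in> Lip_loc M" "\<And>x. x \<in> Y \<Longrightarrow> f x = 0" and \<pi>: "\<And>i. i < m \<Longrightarrow> \<pi> i \<in> Lip_loc M"
  shows "Q f \<pi> = 0"
proof -
  define F where "F = (\<lambda>j x. soft_threshold (1 / (real j + 1)) (f x))"
  have conv: "converges_Lip_loc M F f" unfolding F_def by (rule converges_soft_threshold[OF f(1)])
  have F: "F j \<in> Lip_loc M" for j by (rule Lip_loc_if_converges[OF conv])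
  have "Q (F j) \<pi> = 0" for j
  proof (rule van[OF F \<pi>])
    show "openin (mtopology_of M) {x \<in> mspace M. cmod (f x) < 1 / (real j + 1)}"
      by (rule openin_Lip_loc_norm_less[OF f(1)])
    show "Y \<subseteq> {x \<in> mspace M. cmod (f x) < 1 / (real j + 1)}" using Y f(2) by auto
  qed (auto simp: F_def soft_threshold_eq_0)
  moreover have "(\<lambda>j. Q (F j) \<pi>) \<longlonglongrightarrow> Q f \<pi>"
    using F f(1) \<pi> conv by (intro compact_current_tendsto[OF Q]) (auto intro: converges_Lip_loc_const)
  ultimately show ?thesis by (simp add: LIMSEQ_const_iff)
qed

text \<open>Thresholding makes the argument \<open>u\<close> vanish on the open set where its
  modulus is below \<open>e\<close>. A cut-off in the modulus of \<open>u\<close> splits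
  \<open>f\<close> into a part supported in that set, killed by locality, and a part that vanishes
  near \<open>A \<union> B\<close>, killed by \<open>van\<close>: near \<open>A\<close> the modulus
  of \<open>u\<close> is small, near \<open>B\<close> already \<open>f\<close> is zero.\<close>

lemma compact_current_vanishes_arg:
  assumes Q: "compact_current M m Q" and A: "A \<subseteq> mspace M"
    and van: "\<And>f \<pi> U. \<lbrakk>f \<in> Lip_loc M; \<And>i. i < m \<Longrightarrow> \<pi> i \<in> Lip_loc M; openin (mtopology_of M) U;
      A \<union> B \<subseteq> U; \<And>x. x \<in> U \<Longrightarrow> f x = 0\<rbrakk> \<Longrightarrow> Q f \<pi> = 0"
    and f: "f \<in> Lip_loc M" and \<pi>: "\<And>i. i < m \<Longrightarrow> \<pi> i \<in> Lip_loc M"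
    and U: "openin (mtopology_of M) U" "B \<subseteq> U" "\<And>x. x \<in> U \<Longrightarrow> f x = 0"
    and u: "u \<in> Lip_loc M" "\<And>x. x \<in> A \<Longrightarrow> u x = 0" and i: "i < m"
  shows "Q f (\<pi>(i := u)) = 0"
proof -
  define P where "P = (\<lambda>j x. soft_threshold (1 / (real j + 1)) (u x))"
  have conv: "converges_Lip_loc M P u" unfolding P_def by (rule converges_soft_threshold[OF u(1)])
  have P: "P j \<in> Lip_loc M" for j by (rule Lip_loc_if_converges[OF conv])
  have \<pi>P: "(\<pi>(i := P j)) i' \<in> Lip_loc M" if "i' < m" for i' j using P \<pi> that by auto
  have "Q f (\<pi>(i := P j)) = 0" for j
  proof -
    define e where "e = 1 / (real j + 1)"
    have e: "0 < e" by (simp add: e_def)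
    \<comment> \<open>Thirds of \<open>e\<close> leave room on both sides:
      \<open>\<sigma> * f\<close> is supported where the modulus of \<open>u\<close> is at most
      \<open>2*e/3\<close>, inside the open set where it is less than \<open>e\<close>, and
      \<open>\<sigma>\<close> is 1 on the open set around \<open>A\<close> where it is less than
      \<open>e/3\<close>.\<close>
    define \<sigma> where "\<sigma> = (\<lambda>x. complex_of_real (plateau (e/3) (2*e/3) (cmod (u x))))"
    have \<sigma>: "\<sigma> \<in> Lip_loc M"
      unfolding \<sigma>_def
    proof (rule Lip_loc_postcompose[OF u(1)])
      fix z w :: complex
      have "cmod (complex_of_real (plateau (e/3) (2*e/3) (cmod z)) - complex_of_real (plateau (e/3) (2*e/3) (cmod w)))
          = \<bar>plateau (e/3) (2*e/3) (cmod z) - plateau (e/3) (2*e/3) (cmod w)\<bar>"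
        by (metis norm_of_real of_real_diff)
      also have "\<dots> \<le> \<bar>cmod z - cmod w\<bar> / (2*e/3 - e/3)"
        using e by (intro plateau_Lipschitz) simp
      also have "\<dots> \<le> cmod (z - w) / (2*e/3 - e/3)"
        using e norm_triangle_ineq3[of z w] by (intro divide_right_mono) auto
      finally show "cmod (complex_of_real (plateau (e/3) (2*e/3) (cmod z)) - complex_of_real (plateau (e/3) (2*e/3) (cmod w)))
          \<le> (1 / (2*e/3 - e/3)) * cmod (z - w)" by (simp add: mult.commute)
    qed (use e in simp)
    have \<sigma>f: "(\<lambda>x. \<sigma> x * f x) \<in> Lip_loc M" by (rule Lip_loc_mult[OF \<sigma> f])
    have rest: "(\<lambda>x. f x - \<sigma> x * f x) \<in> Lip_loc M" by (rule Lip_loc_diff[OF f \<sigma>f])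
    have "Q (\<lambda>x. \<sigma> x * f x) (\<pi>(i := P j)) = 0"
    proof (rule compact_current_local[OF Q \<sigma>f \<pi>P i])
      show "openin (mtopology_of M) {x \<in> mspace M. cmod (u x) < e}"
        by (rule openin_Lip_loc_norm_less[OF u(1)])
      have "fsupp M (\<lambda>x. \<sigma> x * f x) \<subseteq> {x \<in> mspace M. cmod (u x) \<le> 2*e/3}"
      proof (rule fsupp_subset_closedin[OF closedin_Lip_loc_norm_le[OF u(1)]])
        fix x assume x: "x \<in> mspace M" "\<sigma> x * f x \<noteq> 0"
        have "\<not> 2*e/3 < cmod (u x)"
          using x plateau_eq_0[of "e/3" "2*e/3" "cmod (u x)"] e by (auto simp: \<sigma>_def)
        then show "x \<in> {x \<in> mspace M. cmod (u x) \<le> 2*e/3}" using x by auto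
      qed
      then show "fsupp M (\<lambda>x. \<sigma> x * f x) \<subseteq> {x \<in> mspace M. cmod (u x) < e}" using e by force
      show "(\<pi>(i := P j)) i x = 0" if "x \<in> {x \<in> mspace M. cmod (u x) < e}" for x
        using that by (simp add: P_def e_def soft_threshold_eq_0)
    qed
    moreover have "Q (\<lambda>x. f x - \<sigma> x * f x) (\<pi>(i := P j)) = 0"
    proof (rule van[OF rest \<pi>P])
      show "openin (mtopology_of M) ({x \<in> mspace M. cmod (u x) < e/3} \<union> U)"
        by (intro openin_Un openin_Lip_loc_norm_less u U)
      show "A \<union> B \<subseteq> {x \<in> mspace M. cmod (u x) < e/3} \<union> U" using A U u(2) e by auto
      show "f x - \<sigma> x * f x = 0" if "x \<in> {x \<in> mspace M. cmod (u x) < e/3} \<union> U" for x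
        using that U(3)[of x] plateau_eq_1[of "e/3" "2*e/3" "cmod (u x)"] e by (auto simp: \<sigma>_def)
    qed
    ultimately show ?thesis
      using compact_current_diff[OF Q f \<sigma>f, of "\<pi>(i := P j)"] \<pi>P by simp
  qed
  moreover have "(\<lambda>j. Q f (\<pi>(i := P j))) \<longlonglongrightarrow> Q f (\<pi>(i := u))"
    using f \<pi> P conv u
    by (intro compact_current_tendsto[OF Q]) (auto intro: converges_Lip_loc_const)
  ultimately show ?thesis by (simp add: LIMSEQ_const_iff)
qed

text \<open>On \<open>A\<close> the functions \<open>f \<circ> r\<close> and \<open>f\<close> agree
  because \<open>r\<close> is the identity there, and on \<open>B\<close> because both are zero,
  \<open>r\<close> mapping \<open>B\<close> into itself. The arguments are then exchanged one after
  another: each differs from its composition with \<open>r\<close> by a function that vanishes on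
  \<open>A\<close>, while \<open>f\<close> vanishes near \<open>B\<close>.\<close>

lemma compact_current_retract:
  assumes Q: "compact_current M m Q" and A: "A \<subseteq> mspace M" and B: "B \<subseteq> mspace M"
    and van: "\<And>f \<pi> U. \<lbrakk>f \<in> Lip_loc M; \<And>i. i < m \<Longrightarrow> \<pi> i \<in> Lip_loc M; openin (mtopology_of M) U;
      A \<union> B \<subseteq> U; \<And>x. x \<in> U \<Longrightarrow> f x = 0\<rbrakk> \<Longrightarrow> Q f \<pi> = 0"
    and r: "Lipschitz_continuous_map M M r" "\<And>x. x \<in> A \<Longrightarrow> r x = x" "\<And>x. x \<in> B \<Longrightarrow> r x \<in> B"
    and f: "f \<in> Lip_loc M" and \<pi>: "\<And>i. i < m \<Longrightarrow> \<pi> i \<in> Lip_loc M"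
    and U: "openin (mtopology_of M) U" "B \<subseteq> U" "\<And>x. x \<in> U \<Longrightarrow> f x = 0"
  shows "Q (f \<circ> r) (\<lambda>i. \<pi> i \<circ> r) = Q f \<pi>"
proof -
  have fr: "f \<circ> r \<in> Lip_loc M" and \<pi>r: "\<And>i. i < m \<Longrightarrow> \<pi> i \<circ> r \<in> Lip_loc M"
    using f \<pi> r(1) by (auto intro: Lip_loc_compose)
  have "Q (\<lambda>x. (f \<circ> r) x - f x) (\<lambda>i. \<pi> i \<circ> r) = 0"
  proof (rule compact_current_vanishes_on[OF Q _ van])
    show "A \<union> B \<subseteq> mspace M" using A B by auto
    show "(f \<circ> r) x - f x = 0" if x: "x \<in> A \<union> B" for x
    proof (cases "x \<in> A")
      case False
      then have "x \<in> U" "r x \<in> U" using x r(3) U(2) by auto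
      then show ?thesis using U(3) by simp
    qed (simp add: r(2))
  qed (use Lip_loc_diff[OF fr f] \<pi>r in auto)
  then have 1: "Q (f \<circ> r) (\<lambda>i. \<pi> i \<circ> r) = Q f (\<lambda>i. \<pi> i \<circ> r)"
    using compact_current_diff[OF Q fr f \<pi>r] by simp
  have "Q f (\<lambda>i. if i < n then \<pi> i \<circ> r else \<pi> i) = Q f \<pi>" if "n \<le> m" for n
    using that
  proof (induction n)
    case (Suc n)
    define \<rho> where "\<rho> = (\<lambda>i. if i < n then \<pi> i \<circ> r else \<pi> i)"
    have \<rho>: "\<rho> i \<in> Lip_loc M" if "i < m" for i using that \<pi> \<pi>r by (auto simp: \<rho>_def)
    have n: "n < m" using Suc.prems by simp
    have "Q f (\<rho>(n := \<lambda>x. (\<pi> n \<circ> r) x - \<pi> n x)) = 0"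
      by (rule compact_current_vanishes_arg[OF Q A van f \<rho> U])
        (use n r(2) Lip_loc_diff[OF \<pi>r \<pi>] in auto)
    then have "Q f (\<rho>(n := \<pi> n \<circ> r)) = Q f (\<rho>(n := \<pi> n))"
      using compact_current_diff_arg[OF Q f \<rho> n \<pi>r[OF n] \<pi>[OF n]] by simp
    moreover have "\<rho>(n := \<pi> n) = \<rho>" "\<rho>(n := \<pi> n \<circ> r) = (\<lambda>i. if i < Suc n then \<pi> i \<circ> r else \<pi> i)"
      by (auto simp: \<rho>_def fun_eq_iff less_Suc_eq)
    ultimately show ?case using Suc by (simp add: \<rho>_def)
  qed simp
  from this[of m] have "Q f (\<lambda>i. if i < m then \<pi> i \<circ> r else \<pi> i) = Q f \<pi>" by simp
  moreover have "Q f (\<lambda>i. \<pi> i \<circ> r) = Q f (\<lambda>i. if i < m then \<pi> i \<circ> r else \<pi> i)"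
    by (rule compact_current_cong[OF Q f \<pi>r]) auto
  ultimately show ?thesis using 1 by simp
qed

proposition compact_current_decomposition:
  fixes L :: "nat \<Rightarrow> 'a set"
  assumes Q: "compact_current M m Q"
    and r: "\<And>j. j < k \<Longrightarrow> Lipschitz_continuous_map M M (r j)"
    and L: "\<And>j. j < k \<Longrightarrow> L j \<subseteq> mspace M" "mspace M \<subseteq> (\<Union>j<k. L j)"
    and id: "\<And>j x. \<lbrakk>j < k; x \<in> L j\<rbrakk> \<Longrightarrow> r j x = x"
    and into: "\<And>i j x. \<lbrakk>i < k; j < k; x \<in> L i\<rbrakk> \<Longrightarrow> r j x \<in> L i"
  obtains S where "\<And>j. j < k \<Longrightarrow> compact_current M m (S j)"
    "\<And>f \<pi>. \<lbrakk>f \<in> Lip_loc M; \<And>i. i < m \<Longrightarrow> \<pi> i \<in> Lip_loc M\<rbrakk> \<Longrightarrow>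
       Q f \<pi> = (\<Sum>j<k. S j (f \<circ> r j) (\<lambda>i. \<pi> i \<circ> r j))"
proof -
  \<comment> \<open>\<open>S j\<close> is what remains of \<open>Q\<close> after \<open>j\<close>
    steps. The remainder itself serves as the piece; its composition with \<open>r j\<close> enters
    in the conclusion, where the sum telescopes.\<close>
  define S where "S = rec_nat Q (\<lambda>j Q f \<pi>. Q f \<pi> - Q (f \<circ> r j) (\<lambda>i. \<pi> i \<circ> r j))"
  have S_0: "S 0 = Q"
    and S_Suc: "\<And>j. S (Suc j) = (\<lambda>f \<pi>. S j f \<pi> - S j (f \<circ> r j) (\<lambda>i. \<pi> i \<circ> r j))"
    by (simp_all add: S_def)
  have cc: "compact_current M m (S j)" if "j \<le> k" for j
    using that
  proof (induction j)
    case (Suc j)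
    then show ?case
      unfolding S_Suc by (intro compact_current_minus compact_current_pullback) (auto intro: r)
  qed (simp add: S_0 Q)
  have van: "S j f \<pi> = 0"
    if "j \<le> k" "f \<in> Lip_loc M" "\<And>i. i < m \<Longrightarrow> \<pi> i \<in> Lip_loc M" "openin (mtopology_of M) U"
      "(\<Union>i\<in>{j..<k}. L i) \<subseteq> U" "\<And>x. x \<in> U \<Longrightarrow> f x = 0" for j f \<pi> U
    using that
  proof (induction j arbitrary: f \<pi> U)
    \<comment> \<open>Here \<open>U\<close> contains the whole carrier, so \<open>f\<close> is zero
      as far as \<open>Q\<close> can see.\<close>
    case 0
    then have "\<And>x. x \<in> mspace M \<Longrightarrow> f x = 0" using L(2) by (force simp: atLeast0LessThan)
    then have "Q f \<pi> = Q (\<lambda>x. 0 * f x + 0 * f x) \<pi>"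
      using 0 by (intro compact_current_cong[OF Q]) auto
    also have "\<dots> = 0"
      using compact_current_lincomb[OF Q "0.prems"(2,2,3), where a = 0 and b = 0] by simp
    finally show ?case by (simp add: S_0)
  next
    case (Suc j)
    have *: "(\<Union>i\<in>{j..<k}. L i) = L j \<union> (\<Union>i\<in>{Suc j..<k}. L i)"
    proof -
      have "{j..<k} = insert j {Suc j..<k}" using Suc.prems(1) by auto
      then show ?thesis by simp
    qed
    have LB: "(\<Union>i\<in>{Suc j..<k}. L i) \<subseteq> mspace M" by (intro UN_least L(1)) auto
    have rB: "r j x \<in> (\<Union>i\<in>{Suc j..<k}. L i)" if x: "x \<in> (\<Union>i\<in>{Suc j..<k}. L i)" for x
    proof -
      obtain i where i: "i \<in> {Suc j..<k}" "x \<in> L i" using x by blast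
      then have "r j x \<in> L i" using Suc.prems(1) by (intro into) auto
      then show ?thesis using i(1) by blast
    qed
    have jk: "j < k" "j \<le> k" using Suc.prems(1) by auto
    have vanj: "S j f \<pi> = 0"
      if "f \<in> Lip_loc M" "\<And>i. i < m \<Longrightarrow> \<pi> i \<in> Lip_loc M" "openin (mtopology_of M) U"
        "L j \<union> (\<Union>i\<in>{Suc j..<k}. L i) \<subseteq> U" "\<And>x. x \<in> U \<Longrightarrow> f x = 0" for f \<pi> U
    proof (rule Suc.IH[OF jk(2)])
      show "(\<Union>i\<in>{j..<k}. L i) \<subseteq> U" unfolding * by (rule that(4))
    qed (fact that)+
    have "S j (f \<circ> r j) (\<lambda>i. \<pi> i \<circ> r j) = S j f \<pi>"
    proof (rule compact_current_retract[where Q = "S j" and r = "r j" and f = f and \<pi> = \<pi> and U = U and A = "L j" and B = "\<Union>i\<in>{Suc j..<k}. L i" and M = M and m = m])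
      show "compact_current M m (S j)" by (rule cc[OF jk(2)])
      show "L j \<subseteq> mspace M" by (rule L(1)[OF jk(1)])
      show "Lipschitz_continuous_map M M (r j)" by (rule r[OF jk(1)])
      show "r j x = x" if "x \<in> L j" for x by (rule id[OF jk(1) that])
      show "(\<Union>i\<in>{Suc j..<k}. L i) \<subseteq> mspace M" by (rule LB)
      show "r j x \<in> (\<Union>i\<in>{Suc j..<k}. L i)" if "x \<in> (\<Union>i\<in>{Suc j..<k}. L i)" for x by (rule rB[OF that])
      show "f \<in> Lip_loc M" "openin (mtopology_of M) U" "(\<Union>i\<in>{Suc j..<k}. L i) \<subseteq> U" by fact+
      show "\<pi> i \<in> Lip_loc M" if "i < m" for i by (rule Suc.prems(3)[OF that])
      show "f x = 0" if "x \<in> U" for x by (rule Suc.prems(6)[OF that])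
    qed (rule vanj)
    then show ?case unfolding S_Suc by simp
  qed
  show thesis
  proof
    show "compact_current M m (S j)" if "j < k" for j using cc that by simp
    fix f \<pi> assume f: "f \<in> Lip_loc M" "\<And>i. i < m \<Longrightarrow> \<pi> i \<in> Lip_loc M"
    have "S n f \<pi> = Q f \<pi> - (\<Sum>j<n. S j (f \<circ> r j) (\<lambda>i. \<pi> i \<circ> r j))" for n
      by (induction n) (simp_all add: S_0 S_Suc comp_def)
    from this[of k] have "S k f \<pi> = Q f \<pi> - (\<Sum>j<k. S j (f \<circ> r j) (\<lambda>i. \<pi> i \<circ> r j))" .
    \<comment> \<open>For \<open>j = k\<close> no flat is left, so \<open>U = {}\<close> meets the
      requirements and the last remainder vanishes on all admissible arguments.\<close>
    moreover have "S k f \<pi> = 0"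
      by (rule van[where U = "{}"]) (simp_all add: f)
    ultimately show "Q f \<pi> = (\<Sum>j<k. S j (f \<circ> r j) (\<lambda>i. \<pi> i \<circ> r j))"
      by simp
  qed
qed


section \<open>Matrices and linear subspaces\<close>

definition matrix_map :: "nat \<Rightarrow> nat \<Rightarrow> (nat \<Rightarrow> nat \<Rightarrow> complex) \<Rightarrow> (nat \<Rightarrow> complex) \<Rightarrow> nat \<Rightarrow> complex" where
  "matrix_map n d c z = (\<lambda>j. if j < d then \<Sum>i<n. c j i * z i else 0)"

lemma matrix_map_in_mspace [simp]: "matrix_map n d c z \<in> mspace (cspace d)"
  by (simp add: mspace_cspace matrix_map_def)

lemma coordinate_le_mdist: "i < n \<Longrightarrow> cmod (z i - w i) \<le> mdist (cspace n) z w"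
  unfolding mdist_cspace by (rule member_le_L2_set[of "{..<n}" i "\<lambda>i. cmod (z i - w i)"]) auto

lemma mdist_cspace_le_sum: "mdist (cspace n) z w \<le> (\<Sum>i<n. cmod (z i - w i))"
  unfolding mdist_cspace by (rule L2_set_le_sum) simp

lemma Lipschitz_if_coordinates:
  assumes "\<And>i x y. \<lbrakk>i < n; x \<in> S; y \<in> S\<rbrakk> \<Longrightarrow> cmod (f x i - f y i) \<le> C i * D x y"
    and "x \<in> S" "y \<in> S"
  shows "mdist (cspace n) (f x) (f y) \<le> (\<Sum>i<n. C i) * D x y"
proof -
  have "mdist (cspace n) (f x) (f y) \<le> (\<Sum>i<n. cmod (f x i - f y i))" by (rule mdist_cspace_le_sum)
  also have "\<dots> \<le> (\<Sum>i<n. C i * D x y)" by (intro sum_mono assms) auto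
  finally show ?thesis by (simp add: sum_distrib_right)
qed

lemma matrix_map_Lipschitz:
  obtains C where "0 \<le> C"
    "\<And>z w. mdist (cspace d) (matrix_map n d c z) (matrix_map n d c w) \<le> C * mdist (cspace n) z w"
proof
  show "0 \<le> (\<Sum>j<d. \<Sum>i<n. cmod (c j i))" by (intro sum_nonneg) auto
  fix z w :: "nat \<Rightarrow> complex"
  show "mdist (cspace d) (matrix_map n d c z) (matrix_map n d c w)
      \<le> (\<Sum>j<d. \<Sum>i<n. cmod (c j i)) * mdist (cspace n) z w"
  proof (rule Lipschitz_if_coordinates[where S = UNIV and f = "matrix_map n d c"
        and C = "\<lambda>j. \<Sum>i<n. cmod (c j i)" and D = "mdist (cspace n)"])
    fix j and z w :: "nat \<Rightarrow> complex" assume "j < d"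
    then have "matrix_map n d c z j - matrix_map n d c w j = (\<Sum>i<n. c j i * (z i - w i))"
      by (simp add: matrix_map_def sum_subtractf algebra_simps)
    also have "cmod \<dots> \<le> (\<Sum>i<n. cmod (c j i) * cmod (z i - w i))"
      by (rule sum_norm_le) (simp add: norm_mult)
    also have "\<dots> \<le> (\<Sum>i<n. cmod (c j i) * mdist (cspace n) z w)"
      by (intro sum_mono mult_left_mono coordinate_le_mdist) auto
    finally show "cmod (matrix_map n d c z j - matrix_map n d c w j) \<le> (\<Sum>i<n. cmod (c j i)) * mdist (cspace n) z w"
      by (simp add: sum_distrib_right)
  qed auto
qed

lemma matrix_map_Lipschitz_continuous: "Lipschitz_continuous_map (cspace n) (cspace d) (matrix_map n d c)"
  unfolding Lipschitz_continuous_map_def by (meson matrix_map_Lipschitz matrix_map_in_mspace Pi_I)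

text \<open>All complex sequences with pointwise operations form one vector space that contains
  every \<open>cspace n\<close>, so span, independence and linear extension from the library apply
  although the dimension is a term.\<close>

definition scale_vec :: "complex \<Rightarrow> (nat \<Rightarrow> complex) \<Rightarrow> nat \<Rightarrow> complex" where
  "scale_vec a z = (\<lambda>i. a * z i)"

interpretation vec: vector_space scale_vec
  by unfold_locales (auto simp: scale_vec_def algebra_simps)

interpretation vec: vector_space_pair scale_vec scale_vec ..

definition unit_vec :: "nat \<Rightarrow> nat \<Rightarrow> complex" where
  "unit_vec i = (\<lambda>j. if j = i then 1 else 0)"

lemma sum_fun_apply: "(\<Sum>i\<in>I. f i) x = (\<Sum>i\<in>I. f i x)"
  by (induction I rule: infinite_finite_induct) auto

lemma vec_eq_sum_unit_vec:
  assumes "z \<in> mspace (cspace n)"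
  shows "z = (\<Sum>i<n. scale_vec (z i) (unit_vec i))"
proof
  fix j show "z j = (\<Sum>i<n. scale_vec (z i) (unit_vec i)) j"
    using assms by (simp add: sum_fun_apply scale_vec_def unit_vec_def mspace_cspace if_distrib cong: if_cong)
qed

lemma linear_eq_matrix_map:
  assumes f: "Vector_Spaces.linear scale_vec scale_vec f" and z: "z \<in> mspace (cspace n)" and "j < d"
  shows "f z j = matrix_map n d (\<lambda>j i. f (unit_vec i) j) z j"
proof -
  have "f z = f (\<Sum>i<n. scale_vec (z i) (unit_vec i))" using vec_eq_sum_unit_vec[OF z] by simp
  also have "\<dots> = (\<Sum>i<n. scale_vec (z i) (f (unit_vec i)))"
    by (simp add: vec.linear_sum[OF f] vec.linear_scale[OF f])
  finally show ?thesis
    using assms(3) by (simp add: sum_fun_apply scale_vec_def matrix_map_def mult.commute)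
qed

lemma complex_linear_subspace_imp_subspace:
  "complex_linear_subspace n L \<Longrightarrow> vec.subspace L"
  by (auto simp: complex_linear_subspace_def vec.subspace_def zero_fun_def plus_fun_def scale_vec_def)

lemma complex_linear_subspace_mspace:
  "\<lbrakk>complex_linear_subspace n L; z \<in> L\<rbrakk> \<Longrightarrow> z \<in> mspace (cspace n)"
  by (auto simp: complex_linear_subspace_def)

lemma complex_linear_subspace_Int:
  "\<lbrakk>complex_linear_subspace n L; complex_linear_subspace n L'\<rbrakk> \<Longrightarrow> complex_linear_subspace n (L \<inter> L')"
  by (auto simp: complex_linear_subspace_def)

lemma complex_linear_subspace_singleton_0: "complex_linear_subspace n {\<lambda>i. 0}"
  by (auto simp: complex_linear_subspace_def mspace_cspace)

text \<open>Extend a basis \<open>C\<close> of \<open>G\<close> by vectors of \<open>F\<close> to a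
  basis \<open>B\<close> of \<open>F + G\<close>. The linear map that kills \<open>C\<close> and
  fixes the added vectors has values in \<open>F\<close>, and on \<open>F + G\<close> it changes
  vectors only by elements of \<open>G\<close>. Applied to \<open>x - y\<close> it yields an
  \<open>F\<close>-part and a \<open>G\<close>-part, both depending linearly on
  \<open>x - y\<close>.\<close>

lemma complementary_matrix_map:
  assumes F: "complex_linear_subspace n F" and G: "complex_linear_subspace n G"
  obtains c where "\<And>z. z \<in> mspace (cspace n) \<Longrightarrow> matrix_map n n c z \<in> F"
    "\<And>x y. \<lbrakk>x \<in> F; y \<in> G\<rbrakk> \<Longrightarrow>
      (\<lambda>i. (x i - y i) - matrix_map n n c (\<lambda>i. x i - y i) i) \<in> G"
proof -
  note sF = complex_linear_subspace_imp_subspace[OF F] and sG = complex_linear_subspace_imp_subspace[OF G]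
  obtain C where C: "C \<subseteq> G" "vec.independent C" "G \<subseteq> vec.span C"
    by (rule vec.maximal_independent_subset)
  obtain B where B: "C \<subseteq> B" "B \<subseteq> F \<union> C" "vec.independent B" "F \<union> C \<subseteq> vec.span B"
    using vec.maximal_independent_subset_extend[of C "F \<union> C"] C(2) by auto
  define f where "f = vec.construct B (\<lambda>b. if b \<in> C then 0 else b)"
  have lin: "Vector_Spaces.linear scale_vec scale_vec f"
    unfolding f_def by (rule vec.linear_construct[OF B(3)])
  have fF: "f z \<in> F" for z
  proof -
    have "(\<lambda>b. if b \<in> C then 0 else b) ` B \<subseteq> F"
      using B(2) vec.subspace_0[OF sF] by auto
    then show ?thesis
      using vec.construct_in_span[OF B(3)] vec.span_minimal[OF _ sF] unfolding f_def by blast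
  qed
  have fG: "w - f w \<in> G" if "w \<in> vec.span B" for w
    using that
  proof (induction rule: vec.span_induct)
    case base
    show ?case
    proof (rule vec.subspaceI)
      show "0 \<in> {w. w - f w \<in> G}" using vec.subspace_0[OF sG] by (simp add: vec.linear_0[OF lin])
    next
      fix x y assume "x \<in> {w. w - f w \<in> G}" "y \<in> {w. w - f w \<in> G}"
      then have "(x - f x) + (y - f y) \<in> G" by (intro vec.subspace_add[OF sG]) simp_all
      then show "x + y \<in> {w. w - f w \<in> G}"
        by (simp only: mem_Collect_eq vec.linear_add[OF lin] add_diff_add)
    next
      fix a x assume "x \<in> {w. w - f w \<in> G}"
      then have "scale_vec a (x - f x) \<in> G" by (intro vec.subspace_scale[OF sG]) simp
      then show "scale_vec a x \<in> {w. w - f w \<in> G}"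
        by (simp only: mem_Collect_eq vec.linear_scale[OF lin] vec.scale_right_diff_distrib)
    qed
  next
    case (step b)
    then have "f b = (if b \<in> C then 0 else b)"
      unfolding f_def by (rule vec.construct_basis[OF B(3)])
    then have "b - f b = (if b \<in> C then b else 0)" by (metis diff_self diff_zero)
    then show ?case using C(1) vec.subspace_0[OF sG] by (auto simp only: mem_Collect_eq split: if_splits)
  qed
  define c where "c = (\<lambda>j i. f (unit_vec i) j)"
  have fc: "matrix_map n n c z = f z" if "z \<in> mspace (cspace n)" for z
  proof
    fix j show "matrix_map n n c z j = f z j"
      using linear_eq_matrix_map[OF lin that, of j n] complex_linear_subspace_mspace[OF F fF[of z]]
      by (cases "j < n") (auto simp: c_def mspace_cspace matrix_map_def)
  qed
  show thesis
  proof
    show "matrix_map n n c z \<in> F" if "z \<in> mspace (cspace n)" for z using fc[OF that] fF by simp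
    fix x y assume x: "x \<in> F" and y: "y \<in> G"
    have "(\<lambda>i. x i - y i) \<in> mspace (cspace n)"
      using complex_linear_subspace_mspace[OF F x] complex_linear_subspace_mspace[OF G y] by (simp add: mspace_cspace)
    note 1 = fc[OF this]
    have "y \<in> vec.span B" using y C(3) vec.span_mono[OF B(1)] by auto
    then have "x - y \<in> vec.span B" using x B(4) by (intro vec.span_diff) auto
    then have "(x - y) - f (x - y) \<in> G" by (rule fG)
    moreover have "x - y = (\<lambda>i. x i - y i)" by auto
    ultimately show "(\<lambda>i. (x i - y i) - matrix_map n n c (\<lambda>i. x i - y i) i) \<in> G"
      unfolding 1 by (simp add: fun_diff_def)
  qed
qed

text \<open>This is the preceding construction with \<open>G\<close> equal to zero: the error
  \<open>z - matrix_map n n c z\<close> must then vanish for \<open>z\<close> in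
  \<open>F\<close>.\<close>

lemma projection_matrix_map:
  assumes "complex_linear_subspace n F"
  obtains c where "\<And>z. z \<in> mspace (cspace n) \<Longrightarrow> matrix_map n n c z \<in> F"
    "\<And>z. z \<in> F \<Longrightarrow> matrix_map n n c z = z"
proof -
  obtain c where c: "\<And>z. z \<in> mspace (cspace n) \<Longrightarrow> matrix_map n n c z \<in> F"
    "\<And>x y. \<lbrakk>x \<in> F; y \<in> {\<lambda>i. 0}\<rbrakk> \<Longrightarrow> (\<lambda>i. (x i - y i) - matrix_map n n c (\<lambda>i. x i - y i) i) \<in> {\<lambda>i. 0}"
    by (rule complementary_matrix_map[OF assms complex_linear_subspace_singleton_0]) blast
  show thesis
  proof
    fix z assume "z \<in> F"
    then have "\<forall>i. z i - matrix_map n n c z i = 0"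
      using c(2)[of z "\<lambda>i. 0"] by (simp add: fun_eq_iff)
    then show "matrix_map n n c z = z" by (simp add: fun_eq_iff)
  qed (fact c(1))
qed

text \<open>The columns of \<open>A\<close> are a basis of \<open>L\<close>. The matrix
  \<open>B\<close> comes from a linear extension of the coordinate map of that basis, so it is
  defined and Lipschitz on the whole space and can be composed with maps into
  \<open>L\<close>.\<close>

lemma linear_parametrisation:
  assumes L: "complex_linear_subspace n L"
  obtains d A B where "\<And>w. w \<in> mspace (cspace d) \<Longrightarrow> matrix_map d n A w \<in> L"
    "\<And>w. w \<in> mspace (cspace d) \<Longrightarrow> matrix_map n d B (matrix_map d n A w) = w"
    "\<And>z. z \<in> L \<Longrightarrow> matrix_map d n A (matrix_map n d B z) = z"
proof -
  note sL = complex_linear_subspace_imp_subspace[OF L]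
  obtain E where E: "E \<subseteq> L" "vec.independent E" "L \<subseteq> vec.span E"
    by (rule vec.maximal_independent_subset)
  \<comment> \<open>Finitely many unit vectors span \<open>L\<close>, which bounds the size of the
    independent set \<open>E\<close> and makes the dimension \<open>d\<close> available.\<close>
  have "L \<subseteq> vec.span (unit_vec ` {..<n})"
  proof
    fix z assume "z \<in> L"
    from vec_eq_sum_unit_vec[OF complex_linear_subspace_mspace[OF L this]]
    have "z = (\<Sum>i<n. scale_vec (z i) (unit_vec i))" .
    also have "\<dots> \<in> vec.span (unit_vec ` {..<n})"
      by (intro vec.span_sum vec.span_scale vec.span_base) auto
    finally show "z \<in> vec.span (unit_vec ` {..<n})" .
  qed
  then have fin: "finite E"
    using vec.independent_span_bound[of "unit_vec ` {..<n}" E] E by auto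
  define d where "d = card E"
  obtain e where e: "bij_betw e {..<d} E"
    using ex_bij_betw_nat_finite[OF fin] by (auto simp: d_def atLeast0LessThan)
  have eE: "e j \<in> E" if "j < d" for j using e that by (auto simp: bij_betw_def)
  define f where "f = vec.construct E (\<lambda>b. unit_vec (the_inv_into {..<d} e b))"
  have lin: "Vector_Spaces.linear scale_vec scale_vec f"
    unfolding f_def by (rule vec.linear_construct[OF E(2)])
  have fe: "f (e j) = unit_vec j" if "j < d" for j
    unfolding f_def vec.construct_basis[OF E(2) eE[OF that]]
    using e that by (simp add: the_inv_into_f_f bij_betw_def)
  define A where "A = (\<lambda>i j. e j i)"
  define B where "B = (\<lambda>j i. f (unit_vec i) j)"
  have A: "matrix_map d n A w = (\<Sum>j<d. scale_vec (w j) (e j))" for w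
  proof
    fix i
    have "e j i = 0" if "j < d" "i \<ge> n" for j
      using complex_linear_subspace_mspace[OF L] E(1) eE[OF that(1)] that(2) by (auto simp: mspace_cspace)
    then show "matrix_map d n A w i = (\<Sum>j<d. scale_vec (w j) (e j)) i"
      by (simp add: matrix_map_def A_def sum_fun_apply scale_vec_def mult.commute)
  qed
  have AL: "matrix_map d n A w \<in> L" for w
    unfolding A using E(1) eE by (intro vec.subspace_sum[OF sL] vec.subspace_scale[OF sL]) auto
  have BA: "matrix_map n d B (matrix_map d n A w) = w" if w: "w \<in> mspace (cspace d)" for w
  proof
    fix j
    have fA: "f (matrix_map d n A w) = w"
      unfolding A using vec_eq_sum_unit_vec[OF w]
      by (simp add: vec.linear_sum[OF lin] vec.linear_scale[OF lin] fe)
    show "matrix_map n d B (matrix_map d n A w) j = w j"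
    proof (cases "j < d")
      case True
      have "matrix_map d n A w \<in> mspace (cspace n)" by simp
      from linear_eq_matrix_map[OF lin this True] show ?thesis by (simp add: B_def fA)
    next
      case False
      then show ?thesis using w by (simp add: matrix_map_def mspace_cspace)
    qed
  qed
  show thesis
  proof (rule that[OF AL BA])
    fix z assume "z \<in> L"
    then obtain u where "z = (\<Sum>b\<in>E. scale_vec (u b) b)"
      using E(3) vec.span_finite[OF fin] by auto
    also have "\<dots> = (\<Sum>j<d. scale_vec (u (e j)) (e j))"
      using sum.reindex_bij_betw[OF e, of "\<lambda>b. scale_vec (u b) b"] by simp
    also have "\<dots> = matrix_map d n A (\<lambda>j. if j < d then u (e j) else 0)"
      unfolding A by (intro sum.cong) auto
    finally show "matrix_map d n A (matrix_map n d B z) = z"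
      using BA[of "\<lambda>j. if j < d then u (e j) else 0"] by (simp add: mspace_cspace)
  qed
qed


section \<open>Retractions onto the members of a subspace arrangement\<close>

text \<open>The extension is the infimum of \<open>f y + L * mdist M x y\<close> over
  \<open>y\<close> in \<open>S\<close>, an infimum of \<open>L\<close>-Lipschitz functions of
  \<open>x\<close>. The empty set is treated apart, as an infimum over it carries no
  information.\<close>

lemma McShane_extension:
  fixes f :: "'a \<Rightarrow> real"
  assumes S: "S \<subseteq> mspace M" and L: "0 \<le> L"
    and f: "\<And>x y. \<lbrakk>x \<in> S; y \<in> S\<rbrakk> \<Longrightarrow> \<bar>f x - f y\<bar> \<le> L * mdist M x y"
  obtains g where "\<And>x. x \<in> S \<Longrightarrow> g x = f x"
    "\<And>x y. \<lbrakk>x \<in> mspace M; y \<in> mspace M\<rbrakk> \<Longrightarrow> \<bar>g x - g y\<bar> \<le> L * mdist M x y"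
proof (cases "S = {}")
  case True
  then show ?thesis using that[of "\<lambda>x. 0"] L by simp
next
  case False
  interpret Metric_space "mspace M" "mdist M" by simp
  define g where "g x = (INF y\<in>S. f y + L * mdist M x y)" for x
  have lower: "f y - L * mdist M x y \<le> f z + L * mdist M x z"
    if "x \<in> mspace M" "y \<in> S" "z \<in> S" for x y z
  proof -
    have "f y - f z \<le> L * mdist M y z" using f[OF that(2,3)] by simp
    also have "\<dots> \<le> L * (mdist M y x + mdist M x z)"
      using S that L by (intro mult_left_mono triangle) auto
    finally show ?thesis by (simp add: commute algebra_simps)
  qed
  have bdd: "bdd_below ((\<lambda>y. f y + L * mdist M x y) ` S)" if "x \<in> mspace M" for x
    using lower[OF that] False unfolding bdd_below_def by blast
  have gS: "g x = f x" if x: "x \<in> S" for x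
  proof (rule antisym)
    have xM: "x \<in> mspace M" using x S by auto
    have "g x \<le> f x + L * mdist M x x" unfolding g_def by (rule cINF_lower[OF bdd[OF xM] x])
    then show "g x \<le> f x" using xM by simp
    have "f x \<le> f z + L * mdist M x z" if "z \<in> S" for z using lower[OF xM x that] xM by simp
    then show "f x \<le> g x" unfolding g_def using False by (intro cINF_greatest) auto
  qed
  have step: "g x \<le> g y + L * mdist M x y" if x: "x \<in> mspace M" and y: "y \<in> mspace M" for x y
  proof -
    have "g x - L * mdist M x y \<le> f z + L * mdist M y z" if z: "z \<in> S" for z
    proof -
      have "g x \<le> f z + L * mdist M x z" unfolding g_def by (rule cINF_lower[OF bdd[OF x] z])
      also have "\<dots> \<le> f z + L * (mdist M x y + mdist M y z)"
        using x y z S L by (intro add_left_mono mult_left_mono triangle) auto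
      finally show ?thesis by (simp add: algebra_simps)
    qed
    then have "g x - L * mdist M x y \<le> g y" unfolding g_def[of y] using False by (intro cINF_greatest) auto
    then show ?thesis by simp
  qed
  show ?thesis
  proof (rule that[OF gS])
    show "\<bar>g x - g y\<bar> \<le> L * mdist M x y" if "x \<in> mspace M" "y \<in> mspace M" for x y
      using step[OF that] step[OF that(2,1)] by (simp add: commute abs_le_iff)
  qed
qed

text \<open>Real and imaginary parts of the coordinates are extended separately, which costs
  \<open>2 * C\<close> per coordinate; summing over the coordinates gives \<open>C'\<close>.\<close>

lemma McShane_extension_cspace:
  assumes S: "S \<subseteq> mspace M" and C: "0 \<le> C" and f: "\<And>x. x \<in> S \<Longrightarrow> f x \<in> mspace (cspace n)"
    "\<And>x y. \<lbrakk>x \<in> S; y \<in> S\<rbrakk> \<Longrightarrow> mdist (cspace n) (f x) (f y) \<le> C * mdist M x y"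
  obtains g C' where "\<And>x. x \<in> S \<Longrightarrow> g x = f x" "\<And>x. g x \<in> mspace (cspace n)" "0 \<le> C'"
    "\<And>x y. \<lbrakk>x \<in> mspace M; y \<in> mspace M\<rbrakk> \<Longrightarrow> mdist (cspace n) (g x) (g y) \<le> C' * mdist M x y"
proof -
  have ext: "\<exists>g. (\<forall>x\<in>S. g x = p (f x i)) \<and>
      (\<forall>x\<in>mspace M. \<forall>y\<in>mspace M. \<bar>g x - g y\<bar> \<le> C * mdist M x y)"
    if "i < n" and p: "\<And>z w. \<bar>p z - p w\<bar> \<le> cmod (z - w)" for i and p :: "complex \<Rightarrow> real"
  proof -
    have "\<bar>p (f x i) - p (f y i)\<bar> \<le> C * mdist M x y" if "x \<in> S" "y \<in> S" for x y
      using p[of "f x i" "f y i"] coordinate_le_mdist[OF \<open>i < n\<close>, of "f x" "f y"] f(2)[OF that] by linarith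
    from McShane_extension[OF S C, of "\<lambda>x. p (f x i)", OF this] show ?thesis by metis
  qed
  have Re: "\<bar>Re z - Re w\<bar> \<le> cmod (z - w)" and Im: "\<bar>Im z - Im w\<bar> \<le> cmod (z - w)" for z w
    using abs_Re_le_cmod[of "z - w"] abs_Im_le_cmod[of "z - w"] by auto
  have "\<forall>i\<in>{..<n}. \<exists>g. (\<forall>x\<in>S. g x = Re (f x i)) \<and>
      (\<forall>x\<in>mspace M. \<forall>y\<in>mspace M. \<bar>g x - g y\<bar> \<le> C * mdist M x y)" using ext[OF _ Re] by blast
  then obtain a where a: "\<forall>i\<in>{..<n}. (\<forall>x\<in>S. a i x = Re (f x i)) \<and>
      (\<forall>x\<in>mspace M. \<forall>y\<in>mspace M. \<bar>a i x - a i y\<bar> \<le> C * mdist M x y)" by metis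
  have "\<forall>i\<in>{..<n}. \<exists>g. (\<forall>x\<in>S. g x = Im (f x i)) \<and>
      (\<forall>x\<in>mspace M. \<forall>y\<in>mspace M. \<bar>g x - g y\<bar> \<le> C * mdist M x y)" using ext[OF _ Im] by blast
  then obtain b where b: "\<forall>i\<in>{..<n}. (\<forall>x\<in>S. b i x = Im (f x i)) \<and>
      (\<forall>x\<in>mspace M. \<forall>y\<in>mspace M. \<bar>b i x - b i y\<bar> \<le> C * mdist M x y)" by metis
  define g where "g x = (\<lambda>i. if i < n then Complex (a i x) (b i x) else 0)" for x
  show thesis
  proof (rule that[of g "\<Sum>i<n. 2 * C"])
    fix x assume x: "x \<in> S"
    show "g x = f x"
    proof
      fix i show "g x i = f x i"
        using a b f(1)[OF x] x by (cases "i < n") (auto simp: g_def mspace_cspace)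
    qed
  next
    show "g x \<in> mspace (cspace n)" for x by (simp add: g_def mspace_cspace)
    show "0 \<le> (\<Sum>i<n. 2 * C)" using C by (simp add: sum_nonneg)
    fix x y assume "x \<in> mspace M" "y \<in> mspace M"
    then show "mdist (cspace n) (g x) (g y) \<le> (\<Sum>i<n. 2 * C) * mdist M x y"
    proof (rule Lipschitz_if_coordinates[where S = "mspace M" and f = g and C = "\<lambda>i. 2 * C" and D = "mdist M", rotated])
      fix i x y assume i: "i < n" and xy: "x \<in> mspace M" "y \<in> mspace M"
      have "cmod (g x i - g y i) \<le> \<bar>a i x - a i y\<bar> + \<bar>b i x - b i y\<bar>"
        using i cmod_le[of "g x i - g y i"] by (simp add: g_def)
      then show "cmod (g x i - g y i) \<le> 2 * C * mdist M x y"
        using a b i xy by (smt (verit, best) lessThan_iff distrib_right mult_2)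
    qed
  qed
qed

lemma complex_linear_subspace_lincomb:
  assumes "complex_linear_subspace n L" "z \<in> L" "w \<in> L"
  shows "(\<lambda>i. z i - w i) \<in> L" "(\<lambda>i. z i + w i) \<in> L"
proof -
  have add: "(\<lambda>i. u i + v i) \<in> L" if "u \<in> L" "v \<in> L" for u v
    using assms(1) that unfolding complex_linear_subspace_def by simp
  have scale: "(\<lambda>i. c * u i) \<in> L" if "u \<in> L" for c u
    using assms(1) that unfolding complex_linear_subspace_def by simp
  show "(\<lambda>i. z i - w i) \<in> L" using add[OF assms(2) scale[OF assms(3), of "-1"]] by simp
  show "(\<lambda>i. z i + w i) \<in> L" by (rule add[OF assms(2,3)])
qed

text \<open>Write \<open>x - y\<close> as \<open>a\<close> plus an element of \<open>G\<close>, with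
  \<open>a\<close> in \<open>F\<close> and of norm at most \<open>K\<close> times that of
  \<open>x - y\<close>. Then \<open>z = x - a\<close> lies in \<open>F\<close>, and in
  \<open>G\<close> because it equals \<open>y\<close> plus that element. The estimate serves to glue
  Lipschitz maps on \<open>F\<close> and \<open>G\<close>: the way from \<open>x\<close> to
  \<open>y\<close> is led through \<open>z\<close>, where both maps are defined.\<close>

lemma linear_subspaces_regularly_situated:
  assumes F: "complex_linear_subspace n F" and G: "complex_linear_subspace n G"
  obtains K where "0 \<le> K"
    "\<And>x y. \<lbrakk>x \<in> F; y \<in> G\<rbrakk> \<Longrightarrow> \<exists>z \<in> F \<inter> G. mdist (cspace n) x z \<le> K * mdist (cspace n) x y"
proof -
  obtain c where c: "\<And>z. z \<in> mspace (cspace n) \<Longrightarrow> matrix_map n n c z \<in> F"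
    "\<And>x y. \<lbrakk>x \<in> F; y \<in> G\<rbrakk> \<Longrightarrow> (\<lambda>i. (x i - y i) - matrix_map n n c (\<lambda>i. x i - y i) i) \<in> G"
    using complementary_matrix_map[OF F G] by blast
  obtain K where K: "0 \<le> K" "\<And>z w. mdist (cspace n) (matrix_map n n c z) (matrix_map n n c w) \<le> K * mdist (cspace n) z w"
    using matrix_map_Lipschitz by blast
  show thesis
  proof (rule that[OF K(1)])
    fix x y assume x: "x \<in> F" and y: "y \<in> G"
    have w: "(\<lambda>i. x i - y i) \<in> mspace (cspace n)"
      using complex_linear_subspace_mspace[OF F x] complex_linear_subspace_mspace[OF G y] by (simp add: mspace_cspace)
    define a where "a = matrix_map n n c (\<lambda>i. x i - y i)"
    have a: "a \<in> F" unfolding a_def by (rule c(1)[OF w])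
    have "(\<lambda>i. x i - a i) \<in> F" by (rule complex_linear_subspace_lincomb[OF F x a])
    moreover have "(\<lambda>i. y i + ((x i - y i) - a i)) \<in> G"
      unfolding a_def by (rule complex_linear_subspace_lincomb[OF G y c(2)[OF x y]])
    then have "(\<lambda>i. x i - a i) \<in> G" by (simp add: algebra_simps)
    moreover have "matrix_map n n c (\<lambda>i. 0) = (\<lambda>i. 0)" by (auto simp: matrix_map_def)
    then have "mdist (cspace n) x (\<lambda>i. x i - a i) \<le> K * mdist (cspace n) x y"
      using K(2)[of "\<lambda>i. x i - y i" "\<lambda>i. 0"] unfolding a_def[symmetric]
      by (simp add: mdist_cspace)
    ultimately show "\<exists>z \<in> F \<inter> G. mdist (cspace n) x z \<le> K * mdist (cspace n) x y" by blast
  qed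
qed

text \<open>
  The retraction onto \<open>L\<close> is built flat by flat. Since a flat \<open>F\<close> has to be mapped into the
  linear space \<open>L \<inter> F\<close>, a map that is already defined on smaller flats extends to \<open>F\<close> by
  McShane's theorem, followed by a linear projection.
\<close>

lemma subspace_arrangement_retraction_aux:
  assumes fin: "finite \<L>" and lin: "\<And>F. F \<in> \<L> \<Longrightarrow> complex_linear_subspace n F"
    and Int: "\<And>F G. \<lbrakk>F \<in> \<L>; G \<in> \<L>\<rbrakk> \<Longrightarrow> F \<inter> G \<in> \<L>" and L: "L \<in> \<L>"
    and "\<G> \<subseteq> \<L>" "\<And>F G. \<lbrakk>F \<in> \<L>; G \<in> \<G>\<rbrakk> \<Longrightarrow> F \<inter> G \<in> \<G>"
  shows "\<exists>r C. 0 \<le> C \<and> (\<forall>x\<in>\<Union>\<G> \<union> L. \<forall>y\<in>\<Union>\<G> \<union> L. mdist (cspace n) (r x) (r y) \<le> C * mdist (cspace n) x y) \<and>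
    (\<forall>x\<in>\<Union>\<G> \<union> L. r x \<in> L) \<and> (\<forall>x\<in>L. r x = x) \<and> (\<forall>F\<in>\<G>. \<forall>x\<in>F. r x \<in> F)"
  using finite_subset[OF assms(5) fin] assms(5,6)
proof (induction \<G> rule: finite_psubset_induct)
  case (psubset \<G>)
  interpret Metric_space "mspace (cspace n)" "mdist (cspace n)" by simp
  show ?case
  proof (cases "\<G> = {}")
    case True
    then show ?thesis by (intro exI[of _ "\<lambda>x. x"] exI[of _ 1]) auto
  next
    case False
    \<comment> \<open>Removing a maximal flat keeps the family stable under intersection with
      members of \<open>\<L>\<close>: if \<open>G \<inter> H = F\<close> for some \<open>H\<close>
      among the rest, then \<open>F \<subseteq> H\<close>, and maximality forces
      \<open>H = F\<close>.\<close>
    then obtain F where F: "F \<in> \<G>" and max: "\<And>G. \<lbrakk>G \<in> \<G>; F \<subseteq> G\<rbrakk> \<Longrightarrow> G = F"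
      using finite_has_maximal[OF psubset.hyps] by metis
    define \<H> where "\<H> = \<G> - {F}"
    have \<H>Int: "G \<inter> H \<in> \<H>" if "G \<in> \<L>" "H \<in> \<H>" for G H
      using psubset.prems(2)[of G H] max[of H] that unfolding \<H>_def by blast
    have "\<H> \<subset> \<G>" "\<H> \<subseteq> \<L>" using F psubset.prems(1) by (auto simp: \<H>_def)
    have "\<exists>r C. 0 \<le> C \<and> (\<forall>x\<in>\<Union>\<H> \<union> L. \<forall>y\<in>\<Union>\<H> \<union> L. mdist (cspace n) (r x) (r y) \<le> C * mdist (cspace n) x y) \<and>
        (\<forall>x\<in>\<Union>\<H> \<union> L. r x \<in> L) \<and> (\<forall>x\<in>L. r x = x) \<and> (\<forall>F\<in>\<H>. \<forall>x\<in>F. r x \<in> F)"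
    proof (rule psubset.IH)
      show "F \<inter> G \<in> \<H>" if "F \<in> \<L>" "G \<in> \<H>" for F G using \<H>Int that .
    qed fact+
    then obtain r C where
      "0 \<le> C \<and> (\<forall>x\<in>\<Union>\<H> \<union> L. \<forall>y\<in>\<Union>\<H> \<union> L. mdist (cspace n) (r x) (r y) \<le> C * mdist (cspace n) x y) \<and>
        (\<forall>x\<in>\<Union>\<H> \<union> L. r x \<in> L) \<and> (\<forall>x\<in>L. r x = x) \<and> (\<forall>F\<in>\<H>. \<forall>x\<in>F. r x \<in> F)"
      by (elim exE)
    then have C: "0 \<le> C"
      and rLip: "\<And>x y. \<lbrakk>x \<in> \<Union>\<H> \<union> L; y \<in> \<Union>\<H> \<union> L\<rbrakk> \<Longrightarrow> mdist (cspace n) (r x) (r y) \<le> C * mdist (cspace n) x y"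
      and rL: "\<And>x. x \<in> \<Union>\<H> \<union> L \<Longrightarrow> r x \<in> L" and rid: "\<And>x. x \<in> L \<Longrightarrow> r x = x"
      and rH: "\<And>H x. \<lbrakk>H \<in> \<H>; x \<in> H\<rbrakk> \<Longrightarrow> r x \<in> H" by (simp_all del: Un_iff Union_iff)
    define D where "D = \<Union>\<H> \<union> L"
    have F\<L>: "F \<in> \<L>" using F psubset.prems by auto
    have sub: "D \<union> F \<subseteq> mspace (cspace n)"
      using \<open>\<H> \<subseteq> \<L>\<close> L F\<L> complex_linear_subspace_mspace[OF lin] unfolding D_def by blast
    \<comment> \<open>A point of \<open>F\<close> on a flat \<open>H\<close> of the smaller family
      lies on \<open>F \<inter> H\<close>, which belongs to that family too and is preserved by
      \<open>r\<close>; on \<open>L\<close> the map \<open>r\<close> is the identity.\<close>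
    have rF: "r x \<in> L \<inter> F" if x: "x \<in> D \<inter> F" for x
    proof -
      have "r x \<in> F"
      proof (cases "x \<in> L")
        case False
        then obtain H where H: "H \<in> \<H>" "x \<in> H" using x by (auto simp: D_def)
        then show ?thesis using rH[OF \<H>Int[OF F\<L> H(1)], of x] x by auto
      qed (use rid x in auto)
      then show ?thesis using rL x by (auto simp: D_def)
    qed
    have LF: "complex_linear_subspace n (L \<inter> F)" by (rule lin[OF Int[OF L F\<L>]])
    obtain e C' where e: "\<And>x. x \<in> D \<inter> F \<Longrightarrow> e x = r x" "\<And>x. e x \<in> mspace (cspace n)" "0 \<le> C'"
      "\<And>x y. \<lbrakk>x \<in> mspace (cspace n); y \<in> mspace (cspace n)\<rbrakk> \<Longrightarrow>
         mdist (cspace n) (e x) (e y) \<le> C' * mdist (cspace n) x y"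
    proof (rule McShane_extension_cspace[of "D \<inter> F" "cspace n" C r n])
      show "r x \<in> mspace (cspace n)" if "x \<in> D \<inter> F" for x
        using complex_linear_subspace_mspace[OF LF rF[OF that]] .
    qed (use sub C rLip in \<open>auto simp: D_def\<close>)
    obtain c where c: "\<And>z. z \<in> mspace (cspace n) \<Longrightarrow> matrix_map n n c z \<in> L \<inter> F"
      "\<And>z. z \<in> L \<inter> F \<Longrightarrow> matrix_map n n c z = z"
      using projection_matrix_map[OF LF] by blast
    obtain K where K: "0 \<le> K" "\<And>z w. mdist (cspace n) (matrix_map n n c z) (matrix_map n n c w) \<le> K * mdist (cspace n) z w"
      using matrix_map_Lipschitz by blast
    \<comment> \<open>The extension \<open>e\<close> may leave \<open>L \<inter> F\<close>. The
      projection brings it back and changes nothing on \<open>D \<inter> F\<close>, where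
      \<open>e\<close> already takes values in \<open>L \<inter> F\<close>.\<close>
    define s where "s x = matrix_map n n c (e x)" for x
    define C1 where "C1 = K * C'"
    have C1: "0 \<le> C1" using K e(3) by (simp add: C1_def)
    have s_eq: "s x = r x" if "x \<in> D \<inter> F" for x
      using e(1)[OF that] c(2)[OF rF[OF that]] by (simp add: s_def)
    have sLip: "mdist (cspace n) (s x) (s y) \<le> C1 * mdist (cspace n) x y" if "x \<in> F" "y \<in> F" for x y
    proof -
      have "mdist (cspace n) (s x) (s y) \<le> K * mdist (cspace n) (e x) (e y)" unfolding s_def by (rule K(2))
      also have "\<dots> \<le> K * (C' * mdist (cspace n) x y)"
        using sub that K(1) by (intro mult_left_mono e(4)) auto
      finally show ?thesis by (simp add: C1_def)
    qed
    have sLF: "s x \<in> L \<inter> F" for x unfolding s_def by (rule c(1)[OF e(2)])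
    have "\<forall>G\<in>insert L \<H>. \<exists>K\<ge>0. \<forall>x\<in>F. \<forall>y\<in>G. \<exists>z\<in>F \<inter> G. mdist (cspace n) x z \<le> K * mdist (cspace n) x y"
    proof
      fix G assume "G \<in> insert L \<H>"
      then have "G \<in> \<L>" using L \<open>\<H> \<subseteq> \<L>\<close> by auto
      from linear_subspaces_regularly_situated[OF lin[OF F\<L>] lin[OF this]]
      show "\<exists>K\<ge>0. \<forall>x\<in>F. \<forall>y\<in>G. \<exists>z\<in>F \<inter> G. mdist (cspace n) x z \<le> K * mdist (cspace n) x y" by metis
    qed
    then obtain \<kappa> where \<kappa>: "\<And>G. G \<in> insert L \<H> \<Longrightarrow> 0 \<le> \<kappa> G"
      "\<And>G x y. \<lbrakk>G \<in> insert L \<H>; x \<in> F; y \<in> G\<rbrakk> \<Longrightarrow> \<exists>z\<in>F \<inter> G. mdist (cspace n) x z \<le> \<kappa> G * mdist (cspace n) x y"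
      by metis
    define \<kappa>' where "\<kappa>' = sum \<kappa> (insert L \<H>)"
    have fin\<H>: "finite (insert L \<H>)" using psubset.hyps by (simp add: \<H>_def)
    have \<kappa>': "0 \<le> \<kappa>'" unfolding \<kappa>'_def by (intro sum_nonneg \<kappa>(1))
    define q where "q x = (if x \<in> D then r x else s x)" for x
    have qF: "q x = s x" if "x \<in> F" for x using that s_eq by (auto simp: q_def)
    have qD: "q x = r x" if "x \<in> D" for x using that by (simp add: q_def)
    have qM: "q x \<in> mspace (cspace n)" if "x \<in> D \<union> F" for x
    proof -
      have "q x \<in> L" using that sLF rL[of x] qF by (cases "x \<in> D") (auto simp: q_def D_def)
      then show ?thesis using complex_linear_subspace_mspace[OF lin[OF L]] by blast
    qed
    define B where "B = C + C1 + C1 * \<kappa>' + C * (\<kappa>' + 1)"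
    \<comment> \<open>Go from \<open>x\<close> inside \<open>F\<close> to a point \<open>z\<close>
      on the flat of \<open>y\<close>, then inside \<open>D\<close> to \<open>y\<close>. The first
      leg is at most \<open>\<kappa>'\<close> and the second at most \<open>\<kappa>' + 1\<close>
      times the distance of \<open>x\<close> and \<open>y\<close>; at \<open>z\<close> the maps
      \<open>s\<close> and \<open>r\<close> agree.\<close>
    have mixed: "mdist (cspace n) (q x) (q y) \<le> (C1 * \<kappa>' + C * (\<kappa>' + 1)) * mdist (cspace n) x y"
      if x: "x \<in> F" and y: "y \<in> D" for x y
    proof -
      obtain G where G: "G \<in> insert L \<H>" "y \<in> G" using y by (auto simp: D_def)
      obtain z where z: "z \<in> F \<inter> G" "mdist (cspace n) x z \<le> \<kappa> G * mdist (cspace n) x y"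
        using \<kappa>(2)[OF G(1) x G(2)] by blast
      have zD: "z \<in> D" using z G by (auto simp: D_def)
      have "\<kappa> G \<le> \<kappa>'" unfolding \<kappa>'_def by (rule member_le_sum[OF G(1) _ fin\<H>]) (use \<kappa>(1) in auto)
      then have xz: "mdist (cspace n) x z \<le> \<kappa>' * mdist (cspace n) x y"
        using z(2) mult_right_mono[of "\<kappa> G" \<kappa>' "mdist (cspace n) x y"] by simp
      have "mdist (cspace n) z y \<le> mdist (cspace n) z x + mdist (cspace n) x y"
        using sub x y z by (intro triangle) auto
      then have zy: "mdist (cspace n) z y \<le> (\<kappa>' + 1) * mdist (cspace n) x y"
        using xz by (simp add: commute algebra_simps)
      have "mdist (cspace n) (q x) (q y) \<le> mdist (cspace n) (q x) (q z) + mdist (cspace n) (q z) (q y)"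
        using x y z by (intro triangle qM) auto
      also have "mdist (cspace n) (q x) (q z) \<le> C1 * mdist (cspace n) x z"
        using sLip[of x z] x z qF by auto
      also have "mdist (cspace n) (q z) (q y) \<le> C * mdist (cspace n) z y"
        using rLip[of z y] y zD qD by (auto simp: D_def)
      also have "C1 * mdist (cspace n) x z + C * mdist (cspace n) z y
          \<le> C1 * (\<kappa>' * mdist (cspace n) x y) + C * ((\<kappa>' + 1) * mdist (cspace n) x y)"
        using xz zy C C1 by (intro add_mono mult_left_mono) auto
      finally show ?thesis by (simp add: algebra_simps)
    qed
    have "0 \<le> B" using C C1 \<kappa>' by (simp add: B_def)
    have B_ge: "C \<le> B" "C1 \<le> B" "C1 * \<kappa>' + C * (\<kappa>' + 1) \<le> B" using C C1 \<kappa>' by (simp_all add: B_def)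
    have qLip: "mdist (cspace n) (q x) (q y) \<le> B * mdist (cspace n) x y"
      if x: "x \<in> D \<union> F" and y: "y \<in> D \<union> F" for x y
    proof -
      have *: "t \<le> b * mdist (cspace n) x y \<Longrightarrow> b \<le> B \<Longrightarrow> t \<le> B * mdist (cspace n) x y" for t b
        by (meson mult_right_mono nonneg order_trans)
      consider "x \<in> D" "y \<in> D" | "x \<in> F" "y \<in> F" | "x \<in> F" "y \<in> D" | "y \<in> F" "x \<in> D"
        using x y by auto
      then show ?thesis
      proof cases
        case 1
        then show ?thesis using rLip[of x y] qD by (intro *[OF _ B_ge(1)]) (auto simp: D_def)
      next
        case 2
        then show ?thesis using sLip[of x y] qF by (intro *[OF _ B_ge(2)]) auto
      next
        case 3
        then show ?thesis by (intro *[OF mixed B_ge(3)])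
      next
        case 4
        then show ?thesis using mixed[OF 4] by (intro *[OF _ B_ge(3)]) (simp add: commute)
      qed
    qed
    have un: "\<Union>\<G> \<union> L = D \<union> F" using F by (auto simp: \<H>_def D_def)
    show ?thesis
    proof (intro exI[of _ q] exI[of _ B] conjI ballI)
      show "0 \<le> B" by fact
      show "mdist (cspace n) (q x) (q y) \<le> B * mdist (cspace n) x y"
        if "x \<in> \<Union>\<G> \<union> L" "y \<in> \<Union>\<G> \<union> L" for x y
        by (rule qLip) (use that un in simp_all)
      show "q x \<in> L" if "x \<in> \<Union>\<G> \<union> L" for x
      proof (cases "x \<in> D")
        case True
        then show ?thesis using rL qD by (simp add: D_def)
      next
        case False
        then show ?thesis using sLF by (simp add: q_def)
      qed
      show "q x = x" if "x \<in> L" for x using that rid by (simp add: q_def D_def)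
      show "q x \<in> G" if "G \<in> \<G>" "x \<in> G" for G x
      proof (cases "G = F")
        case True
        then show ?thesis using that qF sLF by auto
      next
        case False
        then have "G \<in> \<H>" using that by (simp add: \<H>_def)
        moreover from this have "x \<in> D" using that by (auto simp: D_def)
        ultimately show ?thesis using rH that qD[of x] by simp
      qed
    qed
  qed
qed

proposition subspace_arrangement_retraction:
  assumes fin: "finite \<L>" and lin: "\<And>F. F \<in> \<L> \<Longrightarrow> complex_linear_subspace n F"
    and Int: "\<And>F G. \<lbrakk>F \<in> \<L>; G \<in> \<L>\<rbrakk> \<Longrightarrow> F \<inter> G \<in> \<L>" and L: "L \<in> \<L>"
  obtains r where "Lipschitz_continuous_map (submetric (cspace n) (\<Union>\<L>)) (submetric (cspace n) (\<Union>\<L>)) r"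
    "\<And>x. x \<in> \<Union>\<L> \<Longrightarrow> r x \<in> L" "\<And>x. x \<in> L \<Longrightarrow> r x = x" "\<And>F x. \<lbrakk>F \<in> \<L>; x \<in> F\<rbrakk> \<Longrightarrow> r x \<in> F"
proof -
  have un: "\<Union>\<L> \<union> L = \<Union>\<L>" using L by auto
  have "\<exists>r C. 0 \<le> C \<and> (\<forall>x\<in>\<Union>\<L> \<union> L. \<forall>y\<in>\<Union>\<L> \<union> L. mdist (cspace n) (r x) (r y) \<le> C * mdist (cspace n) x y) \<and>
      (\<forall>x\<in>\<Union>\<L> \<union> L. r x \<in> L) \<and> (\<forall>x\<in>L. r x = x) \<and> (\<forall>F\<in>\<L>. \<forall>x\<in>F. r x \<in> F)"
    by (rule subspace_arrangement_retraction_aux[where \<L> = \<L>]) (use assms in auto)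
  then obtain r C where "0 \<le> C \<and> (\<forall>x\<in>\<Union>\<L> \<union> L. \<forall>y\<in>\<Union>\<L> \<union> L. mdist (cspace n) (r x) (r y) \<le> C * mdist (cspace n) x y) \<and>
      (\<forall>x\<in>\<Union>\<L> \<union> L. r x \<in> L) \<and> (\<forall>x\<in>L. r x = x) \<and> (\<forall>F\<in>\<L>. \<forall>x\<in>F. r x \<in> F)"
    by (elim exE)
  then have r: "\<forall>x\<in>\<Union>\<L>. \<forall>y\<in>\<Union>\<L>. mdist (cspace n) (r x) (r y) \<le> C * mdist (cspace n) x y"
    "\<forall>x\<in>\<Union>\<L>. r x \<in> L" "\<forall>x\<in>L. r x = x" "\<forall>F\<in>\<L>. \<forall>x\<in>F. r x \<in> F"
    unfolding un by simp_all
  have "\<Union>\<L> \<subseteq> mspace (cspace n)" using complex_linear_subspace_mspace[OF lin] by blast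
  then have "Lipschitz_continuous_map (submetric (cspace n) (\<Union>\<L>)) (submetric (cspace n) (\<Union>\<L>)) r"
    unfolding Lipschitz_continuous_map_def using r(1)
    by (intro conjI exI[of _ C] Pi_I) (use r(2) L in \<open>auto 4 3\<close>)
  then show thesis by (rule that) (rule r(2,3)[THEN bspec] r(4)[THEN bspec, THEN bspec]; assumption)+
qed


section \<open>Localisation of currents\<close>

text \<open>
  A map \<open>g\<close> which need only be defined near the support of a bounded Lipschitz cut-off \<open>\<eta>\<close>, so that
  \<open>\<eta> * (f \<circ> g)\<close> makes sense on all of \<open>M\<close>.
\<close>

definition localised_map :: "'a metric \<Rightarrow> 'b metric \<Rightarrow> 'a set \<Rightarrow> ('a \<Rightarrow> 'b) \<Rightarrow> ('a \<Rightarrow> complex) \<Rightarrow> bool" where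
  "localised_map M M' E g \<eta> \<longleftrightarrow>
     (\<exists>K. compactin (mtopology_of M') K \<and> (\<forall>x\<in>E \<inter> mspace M. g x \<in> K)) \<and>
     (\<exists>C. \<forall>x\<in>E \<inter> mspace M. \<forall>y\<in>E \<inter> mspace M. mdist M' (g x) (g y) \<le> C * mdist M x y) \<and>
     (\<exists>A. Lip_bound M (mspace M) A \<eta>) \<and>
     (\<forall>x\<in>mspace M. cmod (\<eta> x) \<le> 1) \<and> (\<forall>x\<in>mspace M - E. \<eta> x = 0)"

text \<open>On \<open>E\<close> the map \<open>g\<close> is Lipschitz with values in a compact set,
  so the functions \<open>F j \<circ> g\<close> have bounds there that are uniform in
  \<open>j\<close>; off \<open>E\<close> the cut-off vanishes.\<close>

lemma localised_map_uniform_Lip_bound: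
  assumes loc: "localised_map M M' E g \<eta>" and F: "converges_Lip_loc M' F f"
  obtains L where "\<And>j. Lip_bound M (mspace M) L (\<lambda>x. \<eta> x * F j (g x))"
proof -
  obtain K C A where K: "compactin (mtopology_of M') K" "\<And>x. x \<in> E \<inter> mspace M \<Longrightarrow> g x \<in> K"
    and C: "\<And>x y. \<lbrakk>x \<in> E \<inter> mspace M; y \<in> E \<inter> mspace M\<rbrakk> \<Longrightarrow> mdist M' (g x) (g y) \<le> C * mdist M x y"
    and A: "Lip_bound M (mspace M) A \<eta>" and \<eta>: "\<And>x. x \<in> mspace M \<Longrightarrow> cmod (\<eta> x) \<le> 1"
      "\<And>x. x \<in> mspace M - E \<Longrightarrow> \<eta> x = 0"
    using loc unfolding localised_map_def by metis
  obtain A' where A': "0 \<le> A'" "Lip_bound M (mspace M) A' \<eta>"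
    using Lip_bound_obtain_nonneg[OF A] by blast
  obtain L G where L: "0 \<le> L" "0 \<le> G" "\<And>j. Lip_bound M' K L (F j)" "\<And>j x. x \<in> K \<Longrightarrow> cmod (F j x) \<le> G"
    using converges_Lip_loc_uniform_bounds[OF F K(1)] by metis
  have *: "Lip_bound M (E \<inter> mspace M) (L * \<bar>C\<bar>) (F j \<circ> g)" for j
  proof (rule Lip_bound_compose[OF _ L(1)])
    show "Lip_bound M' (g ` (E \<inter> mspace M)) L (F j)"
      using L(3)[of j] K(2) unfolding Lip_bound_def by blast
    show "mdist M' (g x) (g y) \<le> \<bar>C\<bar> * mdist M x y" if "x \<in> E \<inter> mspace M" "y \<in> E \<inter> mspace M" for x y
    proof -
      have "C * mdist M x y \<le> \<bar>C\<bar> * mdist M x y" by (intro mult_right_mono) auto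
      then show ?thesis using C[OF that] by linarith
    qed
  qed
  show thesis
  proof (rule that)
    fix j
    show "Lip_bound M (mspace M) (A' * G + 1 * (L * \<bar>C\<bar>)) (\<lambda>x. \<eta> x * F j (g x))"
    proof (rule Lip_bound_mult_supported[where E = E])
      show "Lip_bound M (mspace M \<inter> E) (L * \<bar>C\<bar>) (\<lambda>x. F j (g x))"
        using *[of j] by (simp add: Int_commute comp_def)
      show "cmod (F j (g x)) \<le> G" if "x \<in> mspace M \<inter> E" for x using that by (intro L(4) K(2)) auto
    qed (use A' \<eta> L in auto)
  qed
qed

lemma localised_map_converges:
  assumes loc: "localised_map M M' E g \<eta>" and F: "converges_Lip_loc M' F f"
  shows "converges_Lip_loc M (\<lambda>j x. \<eta> x * F j (g x)) (\<lambda>x. \<eta> x * f (g x))"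
  unfolding converges_Lip_loc_def
proof (intro conjI allI impI ballI)
  obtain L where L: "\<And>j. Lip_bound M (mspace M) L (\<lambda>x. \<eta> x * F j (g x))"
    using localised_map_uniform_Lip_bound[OF loc F] by blast
  fix K assume "compactin (mtopology_of M) K"
  then have "K \<subseteq> mspace M" using compactin_subset_topspace by fastforce
  then show "\<exists>L. \<forall>j. Lip_bound M K L (\<lambda>x. \<eta> x * F j (g x))"
    using Lip_bound_mono[OF L _ order_refl order_refl] by blast
next
  fix x assume x: "x \<in> mspace M"
  show "(\<lambda>j. \<eta> x * F j (g x)) \<longlonglongrightarrow> \<eta> x * f (g x)"
  proof (cases "x \<in> E")
    case True
    then have "g x \<in> mspace M'"
      using loc x compactin_subset_topspace unfolding localised_map_def by fastforce
    then have "(\<lambda>j. F j (g x)) \<longlonglongrightarrow> f (g x)" using F unfolding converges_Lip_loc_def by simp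
    then show ?thesis by (rule tendsto_mult_left)
  next
    case False
    then have "\<eta> x = 0" using loc x unfolding localised_map_def by blast
    then show ?thesis by simp
  qed
qed

lemma localised_map_Lip_loc:
  assumes "localised_map M M' E g \<eta>" and "f \<in> Lip_loc M'"
  shows "(\<lambda>x. \<eta> x * f (g x)) \<in> Lip_loc M"
proof -
  have "converges_Lip_loc M' (\<lambda>j. f) f" by (rule converges_Lip_loc_const[OF assms(2) refl])
  from localised_map_converges[OF assms(1) this] show ?thesis
    unfolding converges_Lip_loc_def Lip_loc_iff by blast
qed

text \<open>There are two nested cut-offs: \<open>\<eta>\<close> localises the function,
  \<open>\<theta>\<close> the arguments, and \<open>\<theta>\<close> is 1 on an open neighbourhood
  \<open>N\<close> of the set \<open>E1\<close> that carries \<open>\<eta>\<close>. With the same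
  cut-off for both, an argument constant near the support of \<open>f\<close> would in general not
  stay constant near the support of the localised function, and locality would be lost.\<close>

proposition compact_current_transfer:
  assumes Q: "compact_current M m Q"
    and loc1: "localised_map M M' E1 g \<eta>" and loc2: "localised_map M M' E2 g \<theta>"
    and E1: "closedin (mtopology_of M) E1" "E1 \<subseteq> N"
    and N: "openin (mtopology_of M) N" "N \<subseteq> E2" "\<And>x. x \<in> N \<Longrightarrow> \<theta> x = 1"
  shows "compact_current M' m (\<lambda>f \<pi>. Q (\<lambda>x. \<eta> x * f (g x)) (\<lambda>i x. \<theta> x * \<pi> i (g x)))"
  unfolding compact_current_def
proof (intro conjI ballI allI impI; (elim conjE exE)?)
  fix f h a b \<pi>
  assume *: "f \<in> Lip_loc M'" "h \<in> Lip_loc M'" "\<forall>i<m. \<pi> i \<in> Lip_loc M'"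
  have "(\<lambda>x. \<eta> x * (a * f (g x) + b * h (g x))) = (\<lambda>x. a * (\<eta> x * f (g x)) + b * (\<eta> x * h (g x)))"
    by (simp add: algebra_simps)
  then show "Q (\<lambda>x. \<eta> x * (a * f (g x) + b * h (g x))) (\<lambda>i x. \<theta> x * \<pi> i (g x)) =
      a * Q (\<lambda>x. \<eta> x * f (g x)) (\<lambda>i x. \<theta> x * \<pi> i (g x)) + b * Q (\<lambda>x. \<eta> x * h (g x)) (\<lambda>i x. \<theta> x * \<pi> i (g x))"
    using * localised_map_Lip_loc[OF loc1] localised_map_Lip_loc[OF loc2]
    by (simp add: compact_current_lincomb[OF Q])
next
  fix f \<pi> i u v a b
  assume *: "f \<in> Lip_loc M'" "\<forall>i<m. \<pi> i \<in> Lip_loc M'" "i < m" "u \<in> Lip_loc M'" "v \<in> Lip_loc M'"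
  have upd: "(\<lambda>j x. \<theta> x * (\<pi>(i := w)) j (g x)) = (\<lambda>j x. \<theta> x * \<pi> j (g x))(i := \<lambda>x. \<theta> x * w (g x))" for w by auto
  have "(\<lambda>x. \<theta> x * (a * u (g x) + b * v (g x))) = (\<lambda>x. a * (\<theta> x * u (g x)) + b * (\<theta> x * v (g x)))"
    by (simp add: algebra_simps)
  then show "Q (\<lambda>x. \<eta> x * f (g x)) (\<lambda>j x. \<theta> x * (\<pi>(i := \<lambda>x. a * u x + b * v x)) j (g x)) =
      a * Q (\<lambda>x. \<eta> x * f (g x)) (\<lambda>j x. \<theta> x * (\<pi>(i := u)) j (g x)) +
      b * Q (\<lambda>x. \<eta> x * f (g x)) (\<lambda>j x. \<theta> x * (\<pi>(i := v)) j (g x))"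
    unfolding upd
    using * localised_map_Lip_loc[OF loc1] localised_map_Lip_loc[OF loc2]
    by (simp add: compact_current_lincomb_arg[OF Q])
next
  fix F f P \<pi>
  assume "\<forall>j. F j \<in> Lip_loc M'" "f \<in> Lip_loc M'" "\<forall>i<m. (\<forall>j. P j i \<in> Lip_loc M') \<and> \<pi> i \<in> Lip_loc M'"
    "converges_Lip_loc M' F f" "\<forall>i<m. converges_Lip_loc M' (\<lambda>j. P j i) (\<pi> i)"
  then show "(\<lambda>j. Q (\<lambda>x. \<eta> x * F j (g x)) (\<lambda>i x. \<theta> x * P j i (g x))) \<longlonglongrightarrow>
      Q (\<lambda>x. \<eta> x * f (g x)) (\<lambda>i x. \<theta> x * \<pi> i (g x))"
    by (intro compact_current_tendsto[OF Q] localised_map_Lip_loc[OF loc1] localised_map_Lip_loc[OF loc2]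
        localised_map_converges[OF loc1] localised_map_converges[OF loc2]) auto
next
  fix f \<pi> i U c
  assume *: "f \<in> Lip_loc M'" "\<forall>i<m. \<pi> i \<in> Lip_loc M'" "i < m" "openin (mtopology_of M') U"
    "fsupp M' f \<subseteq> U" "\<forall>x\<in>U. \<pi> i x = c"
  have NM: "N \<subseteq> mspace M" using openin_subset[OF N(1)] by simp
  have gM: "g x \<in> mspace M'" if "x \<in> E2 \<inter> mspace M" for x
    using loc2 that compactin_subset_topspace unfolding localised_map_def by fastforce
  obtain C where "\<And>x y. \<lbrakk>x \<in> E2 \<inter> mspace M; y \<in> E2 \<inter> mspace M\<rbrakk> \<Longrightarrow> mdist M' (g x) (g y) \<le> C * mdist M x y"
    using loc2 unfolding localised_map_def by metis
  then have "Lipschitz_continuous_map (submetric M N) M' g"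
    unfolding Lipschitz_continuous_map_def
    by (intro conjI exI[of _ C] Pi_I) (use gM N(2) in auto)
  then have cont: "continuous_map (subtopology (mtopology_of M) N) (mtopology_of M') g"
    using Lipschitz_continuous_imp_continuous_map mtopology_of_submetric by metis
  \<comment> \<open>Continuity of \<open>g\<close> is at hand only on \<open>N\<close>. The open
    neighbourhood is therefore sought inside the open set \<open>N\<close>, and the closed set that
    contains the support inside the closed set \<open>E1\<close>, where relative openness and
    closedness are absolute.\<close>
  have "openin (subtopology (mtopology_of M) N) {x \<in> topspace (subtopology (mtopology_of M) N). g x \<in> U}"
    by (rule openin_continuous_map_preimage[OF cont *(4)])
  then have V: "openin (mtopology_of M) {x \<in> N. g x \<in> U}"
    using N(1) NM by (simp add: openin_open_subtopology Int_absorb1 Int_absorb2)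
  have "subtopology (subtopology (mtopology_of M) N) E1 = subtopology (mtopology_of M) E1"
    using E1(2) by (simp add: subtopology_subtopology Int_absorb1)
  then have cont1: "continuous_map (subtopology (mtopology_of M) E1) (mtopology_of M') g"
    using continuous_map_from_subtopology[OF cont, of E1] by simp
  have "closedin (subtopology (mtopology_of M) E1) {x \<in> topspace (subtopology (mtopology_of M) E1). g x \<in> fsupp M' f}"
    by (rule closedin_continuous_map_preimage[OF cont1 closedin_fsupp])
  then have W: "closedin (mtopology_of M) {x \<in> E1. g x \<in> fsupp M' f}"
    using E1 NM closedin_closed_subtopology[OF E1(1)] by (simp add: Int_absorb1)
  have "fsupp M (\<lambda>x. \<eta> x * f (g x)) \<subseteq> {x \<in> E1. g x \<in> fsupp M' f}"
  proof (rule fsupp_subset_closedin[OF W])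
    fix x assume x: "x \<in> mspace M" "\<eta> x * f (g x) \<noteq> 0"
    then have "x \<in> E1" using loc1 unfolding localised_map_def by auto
    moreover have "g x \<in> mspace M'" using gM x E1(2) N(2) \<open>x \<in> E1\<close> by auto
    ultimately show "x \<in> {x \<in> E1. g x \<in> fsupp M' f}" using x subset_fsupp[of "g x" M' f] by auto
  qed
  also have "\<dots> \<subseteq> {x \<in> N. g x \<in> U}" using E1(2) *(5) by auto
  finally have supp: "fsupp M (\<lambda>x. \<eta> x * f (g x)) \<subseteq> {x \<in> N. g x \<in> U}" .
  show "Q (\<lambda>x. \<eta> x * f (g x)) (\<lambda>i x. \<theta> x * \<pi> i (g x)) = 0"
  proof (rule compact_current_local[OF Q _ _ *(3) V supp])
    show "\<theta> x * \<pi> i (g x) = c" if "x \<in> {x \<in> N. g x \<in> U}" for x using that N(3) *(6) by simp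
  qed (use * localised_map_Lip_loc[OF loc1] localised_map_Lip_loc[OF loc2] in auto)
qed

section \<open>Test functions, and the passage between local and compactly supported
  currents\<close>

lemma test_functions_iff:
  "f \<in> test_functions M \<longleftrightarrow> (\<exists>L. Lip_bound M (mspace M) L f) \<and> compactin (mtopology_of M) (fsupp M f)"
  by (auto simp: test_functions_def Lipschitz_continuous_map_def Lip_bound_def dist_norm)

lemma Lip_bound_imp_Lip_loc: "Lip_bound M (mspace M) L f \<Longrightarrow> f \<in> Lip_loc M"
  unfolding Lip_loc_iff
proof (intro allI impI)
  fix K assume L: "Lip_bound M (mspace M) L f" and "compactin (mtopology_of M) K"
  then have "K \<subseteq> mspace M" using compactin_subset_topspace by fastforce
  from Lip_bound_mono[OF L this order_refl order_refl] show "\<exists>L. Lip_bound M K L f" by blast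
qed

lemma test_functions_Lip_loc: "f \<in> test_functions M \<Longrightarrow> f \<in> Lip_loc M"
  using Lip_bound_imp_Lip_loc unfolding test_functions_iff by blast

lemma converges_test_imp_Lip_loc: "converges_test M F f \<Longrightarrow> converges_Lip_loc M F f"
  unfolding converges_test_def converges_Lip_loc_def
proof (elim conjE exE, intro conjI allI impI)
  fix L K K' assume L: "\<forall>j. Lip_bound M (mspace M) L (F j)" and "compactin (mtopology_of M) K'"
  then have "K' \<subseteq> mspace M" using compactin_subset_topspace by fastforce
  then show "\<exists>L. \<forall>j. Lip_bound M K' L (F j)"
    using Lip_bound_mono[OF L[rule_format] _ order_refl order_refl] by blast
qed

lemma compactin_fsupp_subset:
  "\<lbrakk>compactin (mtopology_of M) K; fsupp M f \<subseteq> K\<rbrakk> \<Longrightarrow> compactin (mtopology_of M) (fsupp M f)"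
  using closed_compactin closedin_fsupp by blast

lemma fsupp_mult_subset: "fsupp M (\<lambda>x. f x * u x) \<subseteq> fsupp M f"
  by (rule fsupp_subset_closedin[OF closedin_fsupp]) (simp add: subset_fsupp)

lemma test_functions_if_converges:
  assumes "converges_test M F f"
  shows "F j \<in> test_functions M"
proof -
  obtain K L where "compactin (mtopology_of M) K" "fsupp M (F j) \<subseteq> K" "Lip_bound M (mspace M) L (F j)"
    using assms unfolding converges_test_def by blast
  then show ?thesis unfolding test_functions_iff using compactin_fsupp_subset by blast
qed

lemma converges_test_const:
  "\<lbrakk>f \<in> test_functions M; \<And>x. x \<in> mspace M \<Longrightarrow> f x = g x\<rbrakk> \<Longrightarrow> converges_test M (\<lambda>j. f) g"
  unfolding test_functions_iff converges_test_def by auto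

text \<open>All products live on the compact set that carries the \<open>F j\<close>, so bounds for
  the \<open>G j\<close> on that set give a Lipschitz bound on the whole space.\<close>

lemma converges_test_mult:
  assumes F: "converges_test M F f" and G: "converges_Lip_loc M G g"
  shows "converges_test M (\<lambda>j x. F j x * G j x) (\<lambda>x. f x * g x)"
proof -
  obtain K A where K: "compactin (mtopology_of M) K" "\<And>j. fsupp M (F j) \<subseteq> K"
    and A0: "\<And>j. Lip_bound M (mspace M) A (F j)"
    using F unfolding converges_test_def by blast
  have KM: "K \<subseteq> mspace M" using compactin_subset_topspace[OF K(1)] by simp
  define A' where "A' = max A 0"
  have A': "Lip_bound M (mspace M) A' (F j)" for j
    using Lip_bound_mono[OF A0 order_refl order_refl, of A'] by (simp add: A'_def)
  obtain L1 H where H: "0 \<le> H" "\<And>j x. x \<in> K \<Longrightarrow> cmod (F j x) \<le> H"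
    using converges_Lip_loc_uniform_bounds[OF converges_test_imp_Lip_loc[OF F] K(1)] by metis
  obtain L B where L: "0 \<le> L" "0 \<le> B" "\<And>j. Lip_bound M K L (G j)" "\<And>j x. x \<in> K \<Longrightarrow> cmod (G j x) \<le> B"
    using converges_Lip_loc_uniform_bounds[OF G K(1)] by metis
  have off: "F j x = 0" if "x \<in> mspace M - K" for j x using that K(2)[of j] subset_fsupp[of x M "F j"] by auto
  have "cmod (F j x) \<le> H" if "x \<in> mspace M" for j x using that H off by (cases "x \<in> K") auto
  then have bound: "Lip_bound M (mspace M) (A' * B + H * L) (\<lambda>x. F j x * G j x)" for j
    using A' off L H(1) Int_absorb1[OF KM]
    by (intro Lip_bound_mult_supported[where E = K]) (auto simp: A'_def)
  show ?thesis
    unfolding converges_test_def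
  proof (intro conjI ballI)
    have "fsupp M (\<lambda>x. F j x * G j x) \<subseteq> K" for j using fsupp_mult_subset[of M "F j" "G j"] K(2)[of j] by blast
    then show "\<exists>K. compactin (mtopology_of M) K \<and> (\<forall>j. fsupp M (\<lambda>x. F j x * G j x) \<subseteq> K)" using K(1) by blast
    show "\<exists>L. \<forall>j. Lip_bound M (mspace M) L (\<lambda>x. F j x * G j x)" using bound by blast
    fix x assume "x \<in> mspace M"
    then show "(\<lambda>j. F j x * G j x) \<longlonglongrightarrow> f x * g x"
      using F G unfolding converges_test_def converges_Lip_loc_def by (intro tendsto_mult) auto
  qed
qed

lemma test_functions_mult:
  assumes "f \<in> test_functions M" "u \<in> Lip_loc M"
  shows "(\<lambda>x. f x * u x) \<in> test_functions M"
  using test_functions_if_converges[OF converges_test_mult[OF converges_test_const[OF assms(1) refl]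
        converges_Lip_loc_const[OF assms(2) refl]]] .

context
  fixes M :: "'a metric" and m :: nat and T
  assumes T: "local_current M m T"
begin

lemma local_current_lincomb:
  "\<lbrakk>f \<in> test_functions M; g \<in> test_functions M; \<And>i. i < m \<Longrightarrow> \<pi> i \<in> Lip_loc M\<rbrakk> \<Longrightarrow>
    T (\<lambda>x. a * f x + b * g x) \<pi> = a * T f \<pi> + b * T g \<pi>"
  by (rule conjunct1[OF T[unfolded local_current_def], rule_format]) auto

lemma local_current_lincomb_arg:
  "\<lbrakk>f \<in> test_functions M; \<And>i. i < m \<Longrightarrow> \<pi> i \<in> Lip_loc M; i < m; u \<in> Lip_loc M; v \<in> Lip_loc M\<rbrakk> \<Longrightarrow>
    T f (\<pi>(i := \<lambda>x. a * u x + b * v x)) = a * T f (\<pi>(i := u)) + b * T f (\<pi>(i := v))"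
  by (rule conjunct1[OF conjunct2[OF T[unfolded local_current_def]], rule_format]) auto

lemma local_current_tendsto:
  "\<lbrakk>\<And>j. F j \<in> test_functions M; f \<in> test_functions M; \<And>i j. i < m \<Longrightarrow> P j i \<in> Lip_loc M;
    \<And>i. i < m \<Longrightarrow> \<pi> i \<in> Lip_loc M; converges_test M F f;
    \<And>i. i < m \<Longrightarrow> converges_Lip_loc M (\<lambda>j. P j i) (\<pi> i)\<rbrakk> \<Longrightarrow>
    (\<lambda>j. T (F j) (P j)) \<longlonglongrightarrow> T f \<pi>"
  by (rule conjunct1[OF conjunct2[OF conjunct2[OF T[unfolded local_current_def]]], rule_format]) auto

lemma local_current_local:
  assumes "f \<in> test_functions M" "\<And>i. i < m \<Longrightarrow> \<pi> i \<in> Lip_loc M" "i < m"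
    "openin (mtopology_of M) U" "fsupp M f \<subseteq> U" "\<And>x. x \<in> U \<Longrightarrow> \<pi> i x = c"
  shows "T f \<pi> = 0"
proof -
  have "\<exists>i<m. \<exists>U c. openin (mtopology_of M) U \<and> fsupp M f \<subseteq> U \<and> (\<forall>x\<in>U. \<pi> i x = c)"
    using assms(3-6) by (intro exI[of _ i] exI[of _ U] exI[of _ c] conjI ballI)
  then show ?thesis
    using conjunct2[OF conjunct2[OF conjunct2[OF T[unfolded local_current_def]]]] assms(1,2)
    by simp
qed

lemma local_current_cong:
  assumes "f \<in> test_functions M" "g \<in> test_functions M" "\<And>i. i < m \<Longrightarrow> \<pi> i \<in> Lip_loc M"
    and "\<And>i. i < m \<Longrightarrow> \<rho> i \<in> Lip_loc M"
    and "\<And>x. x \<in> mspace M \<Longrightarrow> f x = g x" "\<And>i x. \<lbrakk>i < m; x \<in> mspace M\<rbrakk> \<Longrightarrow> \<pi> i x = \<rho> i x"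
  shows "T f \<pi> = T g \<rho>"
proof -
  have "(\<lambda>j::nat. T f \<pi>) \<longlonglongrightarrow> T g \<rho>"
    using assms by (intro local_current_tendsto converges_Lip_loc_const converges_test_const) auto
  then show ?thesis by (simp add: LIMSEQ_const_iff)
qed

text \<open>The remainder of the final decomposition is \<open>T\<close> multiplied by 1 minus a
  cut-off; this lemma makes it a current.\<close>

lemma local_current_mult:
  assumes u: "u \<in> Lip_loc M"
  shows "local_current M m (\<lambda>f \<pi>. T (\<lambda>x. f x * u x) \<pi>)"
  unfolding local_current_def
proof (intro conjI ballI allI impI; (elim conjE exE)?)
  fix f g a b \<pi>
  assume *: "f \<in> test_functions M" "g \<in> test_functions M" "\<forall>i<m. \<pi> i \<in> Lip_loc M"
  have "(\<lambda>x. (a * f x + b * g x) * u x) = (\<lambda>x. a * (f x * u x) + b * (g x * u x))"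
    by (simp add: algebra_simps)
  then show "T (\<lambda>x. (a * f x + b * g x) * u x) \<pi> = a * T (\<lambda>x. f x * u x) \<pi> + b * T (\<lambda>x. g x * u x) \<pi>"
    using * u by (simp add: local_current_lincomb test_functions_mult)
next
  fix f \<pi> i v w a b
  assume "f \<in> test_functions M" "\<forall>i<m. \<pi> i \<in> Lip_loc M" "i < m" "v \<in> Lip_loc M" "w \<in> Lip_loc M"
  then show "T (\<lambda>x. f x * u x) (\<pi>(i := \<lambda>x. a * v x + b * w x)) =
      a * T (\<lambda>x. f x * u x) (\<pi>(i := v)) + b * T (\<lambda>x. f x * u x) (\<pi>(i := w))"
    using u by (simp add: local_current_lincomb_arg test_functions_mult)
next
  fix F f P \<pi>
  assume "\<forall>j. F j \<in> test_functions M" "f \<in> test_functions M"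
    "\<forall>i<m. (\<forall>j. P j i \<in> Lip_loc M) \<and> \<pi> i \<in> Lip_loc M"
    "converges_test M F f" "\<forall>i<m. converges_Lip_loc M (\<lambda>j. P j i) (\<pi> i)"
  then show "(\<lambda>j. T (\<lambda>x. F j x * u x) (P j)) \<longlonglongrightarrow> T (\<lambda>x. f x * u x) \<pi>"
    using u by (intro local_current_tendsto test_functions_mult converges_test_mult converges_Lip_loc_const) auto
next
  fix f \<pi> i U c
  assume *: "f \<in> test_functions M" "\<forall>i<m. \<pi> i \<in> Lip_loc M" "i < m" "openin (mtopology_of M) U"
    "fsupp M f \<subseteq> U" "\<forall>x\<in>U. \<pi> i x = c"
  show "T (\<lambda>x. f x * u x) \<pi> = 0"
    by (rule local_current_local[where i = i and U = U and c = c])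
      (use * u fsupp_mult_subset[of M f u] in \<open>auto intro: test_functions_mult\<close>)
qed

text \<open>A test function times any locally Lipschitz function is again a test function, so the
  cut-off current accepts functions without compact support.\<close>

lemma compact_current_mult:
  assumes \<eta>: "\<eta> \<in> test_functions M"
  shows "compact_current M m (\<lambda>f \<pi>. T (\<lambda>x. \<eta> x * f x) \<pi>)"
  unfolding compact_current_def
proof (intro conjI ballI allI impI; (elim conjE exE)?)
  fix f g a b \<pi>
  assume *: "f \<in> Lip_loc M" "g \<in> Lip_loc M" "\<forall>i<m. \<pi> i \<in> Lip_loc M"
  have "(\<lambda>x. \<eta> x * (a * f x + b * g x)) = (\<lambda>x. a * (\<eta> x * f x) + b * (\<eta> x * g x))"
    by (simp add: algebra_simps)
  then show "T (\<lambda>x. \<eta> x * (a * f x + b * g x)) \<pi> = a * T (\<lambda>x. \<eta> x * f x) \<pi> + b * T (\<lambda>x. \<eta> x * g x) \<pi>"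
    using * \<eta> by (simp add: local_current_lincomb test_functions_mult)
next
  fix f \<pi> i v w a b
  assume "f \<in> Lip_loc M" "\<forall>i<m. \<pi> i \<in> Lip_loc M" "i < m" "v \<in> Lip_loc M" "w \<in> Lip_loc M"
  then show "T (\<lambda>x. \<eta> x * f x) (\<pi>(i := \<lambda>x. a * v x + b * w x)) =
      a * T (\<lambda>x. \<eta> x * f x) (\<pi>(i := v)) + b * T (\<lambda>x. \<eta> x * f x) (\<pi>(i := w))"
    using \<eta> by (simp add: local_current_lincomb_arg test_functions_mult)
next
  fix F f P \<pi>
  assume "\<forall>j. F j \<in> Lip_loc M" "f \<in> Lip_loc M"
    "\<forall>i<m. (\<forall>j. P j i \<in> Lip_loc M) \<and> \<pi> i \<in> Lip_loc M"
    "converges_Lip_loc M F f" "\<forall>i<m. converges_Lip_loc M (\<lambda>j. P j i) (\<pi> i)"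
  then show "(\<lambda>j. T (\<lambda>x. \<eta> x * F j x) (P j)) \<longlonglongrightarrow> T (\<lambda>x. \<eta> x * f x) \<pi>"
    using \<eta> by (intro local_current_tendsto test_functions_mult converges_test_mult converges_test_const) auto
next
  fix f \<pi> i U c
  assume *: "f \<in> Lip_loc M" "\<forall>i<m. \<pi> i \<in> Lip_loc M" "i < m" "openin (mtopology_of M) U"
    "fsupp M f \<subseteq> U" "\<forall>x\<in>U. \<pi> i x = c"
  have "fsupp M (\<lambda>x. \<eta> x * f x) \<subseteq> U"
    using fsupp_mult_subset[of M f \<eta>] *(5) by (simp add: mult.commute)
  then show "T (\<lambda>x. \<eta> x * f x) \<pi> = 0"
    using * \<eta> by (intro local_current_local[where i = i and U = U and c = c]) (auto intro: test_functions_mult)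
qed

text \<open>As \<open>f\<close> may be nonzero off the carrier, sequential continuity first replaces
  it by the zero function, written as a trivial linear combination to which linearity
  applies.\<close>

lemma local_current_0:
  assumes "f \<in> test_functions M" "\<And>i. i < m \<Longrightarrow> \<pi> i \<in> Lip_loc M" "\<And>x. x \<in> mspace M \<Longrightarrow> f x = 0"
  shows "T f \<pi> = 0"
proof -
  have "(\<lambda>x. 0 * f x + 0 * f x) \<in> test_functions M"
    using test_functions_mult[OF assms(1), of "\<lambda>x. 0"] by simp
  then have "T f \<pi> = T (\<lambda>x. 0 * f x + 0 * f x) \<pi>"
    using assms by (intro local_current_cong) auto
  also have "\<dots> = 0" using local_current_lincomb[OF assms(1,1,2), where a = 0 and b = 0] by simp
  finally show ?thesis .
qed

end

lemma compact_current_imp_local_current: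
  assumes Q: "compact_current M m Q"
  shows "local_current M m Q"
  unfolding local_current_def
proof (intro conjI ballI allI impI; (elim conjE exE)?)
  fix f g a b \<pi>
  assume "f \<in> test_functions M" "g \<in> test_functions M" "\<forall>i<m. \<pi> i \<in> Lip_loc M"
  then show "Q (\<lambda>x. a * f x + b * g x) \<pi> = a * Q f \<pi> + b * Q g \<pi>"
    by (intro compact_current_lincomb[OF Q]) (auto intro: test_functions_Lip_loc)
next
  fix f \<pi> i v w a b
  assume "f \<in> test_functions M" "\<forall>i<m. \<pi> i \<in> Lip_loc M" "i < m" "v \<in> Lip_loc M" "w \<in> Lip_loc M"
  then show "Q f (\<pi>(i := \<lambda>x. a * v x + b * w x)) = a * Q f (\<pi>(i := v)) + b * Q f (\<pi>(i := w))"
    by (intro compact_current_lincomb_arg[OF Q]) (auto intro: test_functions_Lip_loc)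
next
  fix F f P \<pi>
  assume "\<forall>j. F j \<in> test_functions M" "f \<in> test_functions M"
    "\<forall>i<m. (\<forall>j. P j i \<in> Lip_loc M) \<and> \<pi> i \<in> Lip_loc M"
    "converges_test M F f" "\<forall>i<m. converges_Lip_loc M (\<lambda>j. P j i) (\<pi> i)"
  then show "(\<lambda>j. Q (F j) (P j)) \<longlonglongrightarrow> Q f \<pi>"
    by (intro compact_current_tendsto[OF Q]) (auto intro: test_functions_Lip_loc converges_test_imp_Lip_loc)
next
  fix f \<pi> i U c
  assume *: "f \<in> test_functions M" "\<forall>i<m. \<pi> i \<in> Lip_loc M" "i < m" "openin (mtopology_of M) U"
    "fsupp M f \<subseteq> U" "\<forall>x\<in>U. \<pi> i x = c"
  show "Q f \<pi> = 0"
    by (rule compact_current_local[OF Q, where i = i and U = U and c = c])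
      (use * in \<open>auto intro: test_functions_Lip_loc\<close>)
qed


section \<open>Supports and push-forwards\<close>

definition vanishes_off :: "'a metric \<Rightarrow> nat \<Rightarrow> (('a \<Rightarrow> complex) \<Rightarrow> (nat \<Rightarrow> 'a \<Rightarrow> complex) \<Rightarrow> complex) \<Rightarrow> 'a set \<Rightarrow> bool" where
  "vanishes_off M m T C \<longleftrightarrow> closedin (mtopology_of M) C \<and>
     (\<forall>f\<in>test_functions M. \<forall>\<pi>. (\<forall>i<m. \<pi> i \<in> Lip_loc M) \<and> fsupp M f \<inter> C = {} \<longrightarrow> T f \<pi> = 0)"

lemma csupp_eq: "csupp M m T = \<Inter>{C. vanishes_off M m T C}"
  by (simp add: csupp_def vanishes_off_def)

lemma vanishes_off_mspace:
  assumes "local_current M m T"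
  shows "vanishes_off M m T (mspace M)"
proof -
  have "T f \<pi> = 0" if f: "f \<in> test_functions M" "\<forall>i<m. \<pi> i \<in> Lip_loc M" "fsupp M f \<inter> mspace M = {}" for f \<pi>
    by (rule local_current_0[OF assms f(1)]) (use f subset_fsupp[of _ M f] in auto)
  moreover have "closedin (mtopology_of M) (mspace M)"
    using closedin_topspace[of "mtopology_of M"] by simp
  ultimately show ?thesis by (simp add: vanishes_off_def)
qed

text \<open>If the support of \<open>f\<close> misses \<open>C1 \<inter> C2\<close>, its compact
  intersections with \<open>C1\<close> and with \<open>C2\<close> have positive distance. A
  Lipschitz function that is 1 near the former and 0 near the latter splits \<open>f\<close> into
  two test functions, one supported off \<open>C2\<close> and the other off
  \<open>C1\<close>.\<close>

lemma vanishes_off_Int: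
  assumes T: "local_current M m T" and C1: "vanishes_off M m T C1" and C2: "vanishes_off M m T C2"
  shows "vanishes_off M m T (C1 \<inter> C2)"
  unfolding vanishes_off_def
proof (intro conjI ballI allI impI; (elim conjE)?)
  show "closedin (mtopology_of M) (C1 \<inter> C2)" using C1 C2 unfolding vanishes_off_def by blast
  fix f \<pi> assume f: "f \<in> test_functions M" and \<pi>: "\<forall>i<m. \<pi> i \<in> Lip_loc M" and disj: "fsupp M f \<inter> (C1 \<inter> C2) = {}"
  interpret Metric_space "mspace M" "mdist M" by simp
  have top: "mtopology_of M = mtopology" by (simp add: mtopology_of_def)
  define K1 K2 where "K1 = fsupp M f \<inter> C1" and "K2 = fsupp M f \<inter> C2"
  have cpt: "compactin mtopology (fsupp M f)" using f top unfolding test_functions_iff by simp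
  then have sub: "fsupp M f \<subseteq> mspace M" using compactin_subset_topspace by fastforce
  have "openin mtopology (mspace M - C1)" "openin mtopology (mspace M - C2)"
    using C1 C2 top unfolding vanishes_off_def closedin_def by auto
  \<comment> \<open>A Lebesgue number of the cover by the two complements bounds the distance of
    \<open>K1\<close> and \<open>K2\<close> from below.\<close>
  then have "\<exists>e>0. \<forall>x\<in>fsupp M f. \<exists>U\<in>{mspace M - C1, mspace M - C2}. mball x e \<subseteq> U"
    using sub disj by (intro lebesgue_number[OF cpt]) auto
  then obtain e where e: "0 < e" "\<And>x. x \<in> fsupp M f \<Longrightarrow> mball x e \<subseteq> mspace M - C1 \<or> mball x e \<subseteq> mspace M - C2"
    by blast
  have far: "e \<le> mdist M x y" if "x \<in> K1" "y \<in> K2" for x y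
  proof (rule ccontr)
    assume "\<not> e \<le> mdist M x y"
    then have "y \<in> mball x e" "x \<in> mball x e" using that sub e(1) by (auto simp: K1_def K2_def)
    then show False using e(2)[of x] that by (auto simp: K1_def K2_def)
  qed
  obtain v where v: "\<And>x. x \<in> K1 \<union> K2 \<Longrightarrow> v x = indicat_real K2 x"
    "\<And>x y. \<lbrakk>x \<in> mspace M; y \<in> mspace M\<rbrakk> \<Longrightarrow> \<bar>v x - v y\<bar> \<le> (1 / e) * mdist M x y"
  proof (rule McShane_extension[of "K1 \<union> K2" M "1 / e" "indicat_real K2"])
    show "K1 \<union> K2 \<subseteq> mspace M" using sub by (auto simp: K1_def K2_def)
    show "0 \<le> 1 / e" using e by simp
    have disj': "K1 \<inter> K2 = {}" using disj by (auto simp: K1_def K2_def)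
    fix x y assume xy: "x \<in> K1 \<union> K2" "y \<in> K1 \<union> K2"
    show "\<bar>indicat_real K2 x - indicat_real K2 y\<bar> \<le> 1 / e * mdist M x y"
    proof (cases "x \<in> K2 \<longleftrightarrow> y \<in> K2")
      case True
      then show ?thesis using e by (simp add: indicator_def)
    next
      case False
      then have "e \<le> mdist M x y" using xy far[of x y] far[of y x] by (auto simp: commute)
      then have "1 \<le> 1 / e * mdist M x y" using e by (simp add: field_simps)
      moreover have "\<bar>indicat_real K2 x - indicat_real K2 y\<bar> \<le> 1" by (simp add: indicator_def)
      ultimately show ?thesis by linarith
    qed
  qed blast
  \<comment> \<open>The extension \<open>v\<close> is 0 on \<open>K1\<close> and 1 on
    \<open>K2\<close>, but need not be constant near either set; flattening it at the levels 1/3 and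
    2/3 achieves this.\<close>
  define u where "u x = complex_of_real (plateau (1/3) (2/3) \<bar>v x\<bar>)" for x
  have vL: "(\<lambda>x. complex_of_real (v x)) \<in> Lip_loc M"
    by (rule Lip_bound_imp_Lip_loc[of _ "1/e"])
      (use v(2) in \<open>auto simp: Lip_bound_def simp flip: of_real_diff\<close>)
  have "Lip_bound M (mspace M) (3 * (1 / e)) u"
    unfolding Lip_bound_def
  proof (intro ballI)
    fix x y assume xy: "x \<in> mspace M" "y \<in> mspace M"
    have "cmod (u x - u y) = \<bar>plateau (1/3) (2/3) \<bar>v x\<bar> - plateau (1/3) (2/3) \<bar>v y\<bar>\<bar>"
      unfolding u_def by (metis norm_of_real of_real_diff)
    also have "\<dots> \<le> \<bar>\<bar>v x\<bar> - \<bar>v y\<bar>\<bar> / (2/3 - 1/3)" by (rule plateau_Lipschitz) simp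
    also have "\<dots> \<le> 3 * \<bar>v x - v y\<bar>" by simp
    also have "\<dots> \<le> 3 * ((1 / e) * mdist M x y)" using v(2)[OF xy] by simp
    finally show "cmod (u x - u y) \<le> 3 * (1 / e) * mdist M x y" by simp
  qed
  then have u: "u \<in> Lip_loc M" by (rule Lip_bound_imp_Lip_loc)
  then have u': "(\<lambda>x. 1 - u x) \<in> Lip_loc M" using Lip_loc_diff[OF Lip_loc_const u] by simp
  have "fsupp M (\<lambda>x. f x * u x) \<subseteq> fsupp M f \<inter> {x \<in> mspace M. cmod (complex_of_real (v x)) \<le> 2/3}"
  proof (rule fsupp_subset_closedin[OF closedin_Int[OF closedin_fsupp closedin_Lip_loc_norm_le[OF vL]]])
    fix x assume x: "x \<in> mspace M" "f x * u x \<noteq> 0"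
    then have "\<not> 2/3 \<le> \<bar>v x\<bar>" using plateau_eq_0[of "1/3" "2/3" "\<bar>v x\<bar>"] by (auto simp: u_def)
    then show "x \<in> fsupp M f \<inter> {x \<in> mspace M. cmod (complex_of_real (v x)) \<le> 2/3}"
      using x subset_fsupp[of x M f] by auto
  qed
  moreover have "v x = 1" if "x \<in> fsupp M f \<inter> C2" for x
    using v(1)[of x] that by (auto simp: K2_def indicator_def)
  ultimately have "fsupp M (\<lambda>x. f x * u x) \<inter> C2 = {}" by fastforce
  then have 1: "T (\<lambda>x. f x * u x) \<pi> = 0"
    using C2 \<pi> test_functions_mult[OF f u] unfolding vanishes_off_def by simp
  have cl: "closedin (mtopology_of M) (mspace M - {x \<in> mspace M. cmod (complex_of_real (v x)) < 1/3})"
    using openin_Lip_loc_norm_less[OF vL] closedin_topspace[of "mtopology_of M"]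
    by (metis closedin_diff topspace_mtopology_of)
  have "fsupp M (\<lambda>x. f x * (1 - u x)) \<subseteq> fsupp M f \<inter> (mspace M - {x \<in> mspace M. cmod (complex_of_real (v x)) < 1/3})"
  proof (rule fsupp_subset_closedin[OF closedin_Int[OF closedin_fsupp cl]])
    fix x assume x: "x \<in> mspace M" "f x * (1 - u x) \<noteq> 0"
    then have "\<not> \<bar>v x\<bar> \<le> 1/3" using plateau_eq_1[of "1/3" "2/3" "\<bar>v x\<bar>"] by (auto simp: u_def)
    then show "x \<in> fsupp M f \<inter> (mspace M - {x \<in> mspace M. cmod (complex_of_real (v x)) < 1/3})"
      using x subset_fsupp[of x M f] by auto
  qed
  moreover have "v x = 0" if "x \<in> fsupp M f \<inter> C1" for x
    using v(1)[of x] that disj by (auto simp: K1_def K2_def indicator_def)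
  ultimately have "fsupp M (\<lambda>x. f x * (1 - u x)) \<inter> C1 = {}" by fastforce
  then have 2: "T (\<lambda>x. f x * (1 - u x)) \<pi> = 0"
    using C1 \<pi> test_functions_mult[OF f u'] unfolding vanishes_off_def by simp
  have "f = (\<lambda>x. 1 * (f x * u x) + 1 * (f x * (1 - u x)))" by (simp add: algebra_simps)
  moreover have "T (\<lambda>x. 1 * (f x * u x) + 1 * (f x * (1 - u x))) \<pi> = 0"
    using local_current_lincomb[OF T test_functions_mult[OF f u] test_functions_mult[OF f u'], of \<pi> 1 1] \<pi> 1 2
    by simp
  ultimately show "T f \<pi> = 0" by simp
qed

text \<open>The support is an intersection of possibly infinitely many closed sets, so it does not
  inherit their defining property at once. The compact support of \<open>f\<close> is covered by
  finitely many of the complements, and \<open>vanishes_off_Int\<close> combines the corresponding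
  sets.\<close>

lemma local_current_vanishes_off_csupp:
  assumes T: "local_current M m T" and f: "f \<in> test_functions M"
    and \<pi>: "\<And>i. i < m \<Longrightarrow> \<pi> i \<in> Lip_loc M" and disj: "fsupp M f \<inter> csupp M m T = {}"
  shows "T f \<pi> = 0"
proof -
  let ?\<C> = "{C. vanishes_off M m T C}"
  have cpt: "compactin (mtopology_of M) (fsupp M f)" using f unfolding test_functions_iff by simp
  then have sub: "fsupp M f \<subseteq> mspace M" using compactin_subset_topspace by fastforce
  have "\<exists>\<F>. finite \<F> \<and> \<F> \<subseteq> (\<lambda>C. mspace M - C) ` ?\<C> \<and> fsupp M f \<subseteq> \<Union>\<F>"
  proof (rule compactinD[OF cpt])
    show "openin (mtopology_of M) U" if "U \<in> (\<lambda>C. mspace M - C) ` ?\<C>" for U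
      using that unfolding vanishes_off_def by (auto simp: closedin_def)
    show "fsupp M f \<subseteq> \<Union>((\<lambda>C. mspace M - C) ` ?\<C>)"
      using sub disj unfolding csupp_eq by auto
  qed
  then obtain \<F> where \<F>: "finite \<F>" "\<F> \<subseteq> ?\<C>" "fsupp M f \<subseteq> (\<Union>C\<in>\<F>. mspace M - C)"
    by (metis (no_types, lifting) finite_subset_image)
  have "vanishes_off M m T (mspace M \<inter> \<Inter>\<F>)"
    using \<F>(1,2)
  proof (induction \<F> rule: finite_induct)
    case (insert C \<F>)
    then have "vanishes_off M m T (C \<inter> (mspace M \<inter> \<Inter>\<F>))" by (intro vanishes_off_Int[OF T, of C]) auto
    then show ?case by (simp add: Int_left_commute)
  qed (simp add: vanishes_off_mspace[OF T])
  moreover have "fsupp M f \<inter> (mspace M \<inter> \<Inter>\<F>) = {}" using \<F>(3) by auto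
  ultimately show ?thesis using f \<pi> unfolding vanishes_off_def by simp
qed

text \<open>By \<open>dep\<close>, the current sees its first argument only on \<open>C\<close>, and
  a test function supported off \<open>C\<close> agrees there with zero.\<close>

lemma csupp_subset:
  assumes S: "compact_current M m S" and C: "closedin (mtopology_of M) C"
    and dep: "\<And>f g \<pi>. \<lbrakk>f \<in> Lip_loc M; g \<in> Lip_loc M; \<And>i. i < m \<Longrightarrow> \<pi> i \<in> Lip_loc M;
      \<And>x. x \<in> C \<Longrightarrow> f x = g x\<rbrakk> \<Longrightarrow> S f \<pi> = S g \<pi>"
  shows "csupp M m S \<subseteq> C"
proof -
  have "S f \<pi> = 0" if f: "f \<in> test_functions M" "\<forall>i<m. \<pi> i \<in> Lip_loc M" "fsupp M f \<inter> C = {}" for f \<pi>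
  proof -
    have "C \<subseteq> mspace M" using closedin_subset[OF C] by simp
    then have "f x = 0 * f x + 0 * f x" if "x \<in> C" for x using f(3) subset_fsupp[of x M f] that by auto
    then have "S f \<pi> = S (\<lambda>x. 0 * f x + 0 * f x) \<pi>"
      using f(2) test_functions_Lip_loc[OF f(1)] by (intro dep Lip_loc_lincomb) auto
    also have "\<dots> = 0"
      using compact_current_lincomb[OF S, where a = 0 and b = 0 and f = f and g = f and \<pi> = \<pi>]
        test_functions_Lip_loc[OF f(1)] f(2) by simp
    finally show ?thesis .
  qed
  then have "vanishes_off M m S C" using C by (simp add: vanishes_off_def)
  then show ?thesis unfolding csupp_eq by blast
qed

text \<open>The cut-off picked by \<open>SOME\<close> exists because \<open>\<xi>\<close> is one for
  the larger set \<open>C\<close>. Let \<open>g\<close> be the error made by inserting it. The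
  factor \<open>\<xi>\<close> changes \<open>g\<close> only off \<open>C\<close>, hence invisibly to
  \<open>S\<close>, and \<open>\<xi> * g\<close> is a test function whose support misses that of
  \<open>S\<close>.\<close>

lemma pushforward_eq:
  assumes S: "compact_current M m S" and C: "closedin (mtopology_of M) C"
    and dep: "\<And>f g \<pi>. \<lbrakk>f \<in> Lip_loc M; g \<in> Lip_loc M; \<And>i. i < m \<Longrightarrow> \<pi> i \<in> Lip_loc M;
      \<And>x. x \<in> C \<Longrightarrow> f x = g x\<rbrakk> \<Longrightarrow> S f \<pi> = S g \<pi>"
    and \<xi>: "cutoff M C \<xi>"
    and f: "f \<circ> h \<in> Lip_loc M" and \<pi>: "\<And>i. i < m \<Longrightarrow> \<pi> i \<circ> h \<in> Lip_loc M"
  shows "pushforward M m h S f \<pi> = S (f \<circ> h) (\<lambda>i. \<pi> i \<circ> h)"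
proof -
  define K where "K = csupp M m S \<inter> fsupp M (f \<circ> h)"
  define \<zeta> where "\<zeta> = (SOME \<eta>. cutoff M K \<eta>)"
  have "csupp M m S \<subseteq> C" using S C dep by (rule csupp_subset)
  then have "K \<subseteq> C" by (auto simp: K_def)
  then have "cutoff M K \<xi>" using \<xi> unfolding cutoff_def by blast
  then have \<zeta>: "cutoff M K \<zeta>" unfolding \<zeta>_def by (rule someI[of "cutoff M K"])
  then have \<zeta>t: "\<zeta> \<in> test_functions M" by (simp add: cutoff_def)
  obtain U where U: "openin (mtopology_of M) U" "K \<subseteq> U" "\<And>x. x \<in> U \<Longrightarrow> \<zeta> x = 1"
    using \<zeta> unfolding cutoff_def by blast
  have \<xi>t: "\<xi> \<in> test_functions M" and \<xi>1: "\<And>x. x \<in> C \<Longrightarrow> \<xi> x = 1" using \<xi> unfolding cutoff_def by auto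
  define g where "g = (\<lambda>x. (f \<circ> h) x - \<zeta> x * (f \<circ> h) x)"
  have \<zeta>f: "(\<lambda>x. \<zeta> x * (f \<circ> h) x) \<in> Lip_loc M" by (rule Lip_loc_mult[OF test_functions_Lip_loc[OF \<zeta>t] f])
  have g: "g \<in> Lip_loc M" unfolding g_def by (rule Lip_loc_diff[OF f \<zeta>f])
  have \<xi>g: "(\<lambda>x. \<xi> x * g x) \<in> test_functions M" by (rule test_functions_mult[OF \<xi>t g])
  \<comment> \<open>On this open set \<open>g\<close> vanishes: on \<open>U\<close> because
    \<open>\<zeta>\<close> is 1 there, off the support of \<open>f \<circ> h\<close> because that
    function is zero there. What is left of the space misses the support of \<open>S\<close>, as
    \<open>U\<close> contains \<open>K\<close>.\<close>
  define W where "W = U \<union> (mspace M - fsupp M (f \<circ> h))"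
  have "openin (mtopology_of M) (mspace M - fsupp M (f \<circ> h))"
    using closedin_fsupp[of M "f \<circ> h"] by (simp add: closedin_def)
  then have "openin (mtopology_of M) W" unfolding W_def using U(1) by (rule openin_Un[rotated])
  then have W: "closedin (mtopology_of M) (mspace M - W)"
    using closedin_diff[OF closedin_topspace] by (metis topspace_mtopology_of)
  have "fsupp M (\<lambda>x. \<xi> x * g x) \<subseteq> mspace M - W"
  proof (rule fsupp_subset_closedin[OF W])
    fix x assume x: "x \<in> mspace M" "\<xi> x * g x \<noteq> 0"
    then have "g x \<noteq> 0" by auto
    then have "x \<notin> U" "(f \<circ> h) x \<noteq> 0" using U(3) by (auto simp: g_def)
    then show "x \<in> mspace M - W" using x(1) subset_fsupp[of x M "f \<circ> h"] by (auto simp: W_def)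
  qed
  moreover have "csupp M m S \<inter> (mspace M - W) = {}" using U(2) by (auto simp: W_def K_def)
  ultimately have disj: "fsupp M (\<lambda>x. \<xi> x * g x) \<inter> csupp M m S = {}" by blast
  have "S g (\<lambda>i. \<pi> i \<circ> h) = S (\<lambda>x. \<xi> x * g x) (\<lambda>i. \<pi> i \<circ> h)" 
    using g test_functions_Lip_loc[OF \<xi>g] \<pi> by (intro dep) (simp_all add: \<xi>1)
  also have "\<dots> = 0"
    by (rule local_current_vanishes_off_csupp[OF compact_current_imp_local_current[OF S] \<xi>g _ disj]) (rule \<pi>)
  finally have "S (f \<circ> h) (\<lambda>i. \<pi> i \<circ> h) = S (\<lambda>x. \<zeta> x * (f \<circ> h) x) (\<lambda>i. \<pi> i \<circ> h)"
    using compact_current_diff[OF S f \<zeta>f, of "\<lambda>i. \<pi> i \<circ> h"] \<pi> by (simp add: g_def)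
  then show ?thesis
    by (simp add: pushforward_def Let_def comp_def flip: K_def[unfolded comp_def] \<zeta>_def)
qed


section \<open>Compactness and holomorphy in complex number space\<close>

text \<open>On sequences that vanish from index \<open>n\<close> on, the product topology is at
  least as fine as that of the Hermitian metric, so compactness obtained from Tychonoff's theorem
  carries over to \<open>cspace n\<close>.\<close>

lemma continuous_map_product_cspace:
  "continuous_map (subtopology euclidean (mspace (cspace n))) (ctop n) (\<lambda>z. z)"
proof -
  interpret Metric_space "mspace (cspace n)" "mdist (cspace n)" by simp
  have "continuous_map (subtopology euclidean (mspace (cspace n))) mtopology (\<lambda>z. z)"
    unfolding continuous_map_to_metric
  proof (intro ballI allI impI)
    fix x e assume x: "x \<in> topspace (subtopology euclidean (mspace (cspace n)))" and e: "(0::real) < e"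
    define U where "U = {y :: nat \<Rightarrow> complex. (\<Sum>i<n. cmod (x i - y i)) < e}"
    have "continuous_on UNIV (\<lambda>y :: nat \<Rightarrow> complex. \<Sum>i<n. cmod (x i - y i))"
      by (intro continuous_intros continuous_on_product_coordinates)
    then have "open U" unfolding U_def by (intro open_Collect_less continuous_on_const)
    then have "openin (subtopology euclidean (mspace (cspace n))) (mspace (cspace n) \<inter> U)"
      by (simp add: openin_open_Int)
    moreover have "x \<in> mspace (cspace n) \<inter> U" using x e by (simp add: U_def)
    moreover have "y \<in> mball x e" if "y \<in> mspace (cspace n) \<inter> U" for y
      using that x mdist_cspace_le_sum[of n x y] by (simp add: U_def)
    ultimately show "\<exists>U. openin (subtopology euclidean (mspace (cspace n))) U \<and> x \<in> U \<and> (\<forall>y\<in>U. y \<in> mball x e)"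
      by blast
  qed
  then show ?thesis by (simp add: mtopology_of_def)
qed

lemma compactin_cspace_cube:
  "compactin (ctop n) {z \<in> mspace (cspace n). \<forall>i<n. cmod (z i) \<le> R}"
proof -
  define P where "P = (PiE UNIV (\<lambda>i. if i < n then cball 0 R else {0 :: complex}))"
  have "compactin (product_topology (\<lambda>i. euclidean) UNIV) P"
    unfolding P_def compactin_PiE by (intro disjI2 ballI) simp
  then have "compactin euclidean P" by (simp add: euclidean_product_topology)
  moreover have P: "P = {z \<in> mspace (cspace n). \<forall>i<n. cmod (z i) \<le> R}"
  proof (rule set_eqI)
    fix z
    have "z \<in> P \<longleftrightarrow> (\<forall>i. z i \<in> (if i < n then cball 0 R else {0}))" by (simp add: P_def PiE_UNIV_domain Pi_iff)
    also have "\<dots> \<longleftrightarrow> (\<forall>i\<ge>n. z i = 0) \<and> (\<forall>i<n. cmod (z i) \<le> R)"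
      by (simp add: all_conj_distrib if_bool_eq_conj if_distrib[of "\<lambda>A. z _ \<in> A"] not_less) blast
    finally show "z \<in> P \<longleftrightarrow> z \<in> {z \<in> mspace (cspace n). \<forall>i<n. cmod (z i) \<le> R}"
      by (simp add: mspace_cspace)
  qed
  ultimately have "compactin (subtopology euclidean (mspace (cspace n))) P"
    by (auto simp: compactin_subtopology)
  from image_compactin[OF this continuous_map_product_cspace] show ?thesis
    unfolding P by simp
qed

lemma compactin_cspace_bounded:
  assumes C: "closedin (ctop n) C" and b: "\<And>z. z \<in> C \<Longrightarrow> mdist (cspace n) z b \<le> R"
  shows "compactin (ctop n) C"
proof (rule closed_compactin[OF _ _ C])
  show "compactin (ctop n) {z \<in> mspace (cspace n). \<forall>i<n. cmod (z i) \<le> R + (\<Sum>i<n. cmod (b i))}"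
    by (rule compactin_cspace_cube)
  show "C \<subseteq> {z \<in> mspace (cspace n). \<forall>i<n. cmod (z i) \<le> R + (\<Sum>i<n. cmod (b i))}"
  proof safe
    fix z assume z: "z \<in> C"
    then show "z \<in> mspace (cspace n)" using closedin_subset[OF C] by auto
    fix i assume i: "i < n"
    have "cmod (z i) \<le> cmod (z i - b i) + cmod (b i)" by (metis norm_triangle_sub add.commute)
    also have "cmod (z i - b i) \<le> R" using coordinate_le_mdist[OF i, of z b] b[OF z] by linarith
    also have "cmod (b i) \<le> (\<Sum>i<n. cmod (b i))" using i by (intro member_le_sum) auto
    finally show "cmod (z i) \<le> R + (\<Sum>i<n. cmod (b i))" by simp
  qed
qed

lemma coordinate_Lip_bound: "Lip_bound (cspace n) (mspace (cspace n)) 1 (\<lambda>z. z i)"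
  unfolding Lip_bound_def
proof (intro ballI)
  fix x y assume "x \<in> mspace (cspace n)" "y \<in> mspace (cspace n)"
  then show "cmod (x i - y i) \<le> 1 * mdist (cspace n) x y"
    using coordinate_le_mdist[of i n x y] by (cases "i < n") (auto simp: mspace_cspace)
qed

text \<open>\<open>L\<close> is the fixed-point set of a linear projection, hence the common zero
  set of continuous functions.\<close>

lemma closedin_complex_linear_subspace:
  assumes L: "complex_linear_subspace n L"
  shows "closedin (ctop n) L"
proof -
  obtain c where c: "\<And>z. z \<in> mspace (cspace n) \<Longrightarrow> matrix_map n n c z \<in> L"
    "\<And>z. z \<in> L \<Longrightarrow> matrix_map n n c z = z"
    using projection_matrix_map[OF L] by blast
  have coord: "(\<lambda>z. z i) \<in> Lip_loc (cspace n)" for i by (rule Lip_bound_imp_Lip_loc[OF coordinate_Lip_bound])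
  have "(\<lambda>z. z i) \<circ> matrix_map n n c \<in> Lip_loc (cspace n)" for i
    by (rule Lip_loc_compose[OF coord matrix_map_Lipschitz_continuous])
  then have d: "(\<lambda>z. matrix_map n n c z i - z i) \<in> Lip_loc (cspace n)" for i
    using Lip_loc_diff[OF _ coord] by (fastforce simp: comp_def)
  have "L = (\<Inter>i. {z \<in> mspace (cspace n). cmod (matrix_map n n c z i - z i) \<le> 0})" (is "_ = ?R")
  proof safe
    fix z i assume "z \<in> L"
    then show "z \<in> mspace (cspace n)" "cmod (matrix_map n n c z i - z i) \<le> 0"
      using c(2) complex_linear_subspace_mspace[OF L] by auto
  next
    fix z assume z: "z \<in> ?R"
    then have "matrix_map n n c z = z" by (auto simp: fun_eq_iff)
    then show "z \<in> L" using c(1)[of z] z by auto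
  qed
  also have "closedin (ctop n) \<dots>"
    using closedin_Lip_loc_norm_le[OF d] by (intro closedin_Inter) blast+
  finally show ?thesis .
qed

section \<open>Complex differentiability, and zero loci in complex number space\<close>

lemma complex_differentiable_on_subset:
  assumes "complex_differentiable_on n D f" "D' \<subseteq> D"
  shows "complex_differentiable_on n D' f"
  unfolding complex_differentiable_on_def
proof
  fix z assume "z \<in> D'"
  then obtain a where a: "\<forall>\<epsilon>>0. \<exists>\<delta>>0. \<forall>w\<in>D. mdist (cspace n) w z < \<delta> \<longrightarrow>
      cmod (f w - f z - (\<Sum>i<n. a i * (w i - z i))) \<le> \<epsilon> * mdist (cspace n) w z"
    using assms unfolding complex_differentiable_on_def by blast
  show "\<exists>a. \<forall>\<epsilon>>0. \<exists>\<delta>>0. \<forall>w\<in>D'. mdist (cspace n) w z < \<delta> \<longrightarrow>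
      cmod (f w - f z - (\<Sum>i<n. a i * (w i - z i))) \<le> \<epsilon> * mdist (cspace n) w z"
    using a assms(2) by (intro exI[of _ a]) (meson subsetD)
qed

lemma complex_differentiable_on_affine:
  assumes "\<And>z. z \<in> D \<Longrightarrow> f z = c0 + (\<Sum>i<n. c i * z i)"
  shows "complex_differentiable_on n D f"
  unfolding complex_differentiable_on_def
proof (intro ballI exI allI impI conjI)
  fix z w and e :: real assume "z \<in> D" "w \<in> D" "0 < e"
  then have "f w - f z - (\<Sum>i<n. c i * (w i - z i)) = 0"
    using assms by (simp add: right_diff_distrib sum_subtractf)
  then show "cmod (f w - f z - (\<Sum>i<n. c i * (w i - z i))) \<le> e * mdist (cspace n) w z"
    using \<open>0 < e\<close> by simp
qed (rule zero_less_one)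

lemma sum_mult_diff_le_mdist:
  "cmod (\<Sum>i<n. a i * (w i - z i)) \<le> (\<Sum>i<n. cmod (a i)) * mdist (cspace n) w z"
proof -
  have "cmod (\<Sum>i<n. a i * (w i - z i)) \<le> (\<Sum>i<n. cmod (a i) * cmod (w i - z i))"
    by (rule sum_norm_le) (simp add: norm_mult)
  also have "\<dots> \<le> (\<Sum>i<n. cmod (a i) * mdist (cspace n) w z)"
    by (intro sum_mono mult_left_mono coordinate_le_mdist) auto
  finally show ?thesis by (simp add: sum_distrib_right)
qed

lemma complex_differentiable_on_mult:
  assumes f: "complex_differentiable_on n D f" and g: "complex_differentiable_on n D g"
  shows "complex_differentiable_on n D (\<lambda>z. f z * g z)"
  unfolding complex_differentiable_on_def
proof
  fix z assume z: "z \<in> D"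
  obtain a where a: "\<And>\<epsilon>. 0 < \<epsilon> \<Longrightarrow> \<exists>\<delta>>0. \<forall>w\<in>D. mdist (cspace n) w z < \<delta> \<longrightarrow>
      cmod (f w - f z - (\<Sum>i<n. a i * (w i - z i))) \<le> \<epsilon> * mdist (cspace n) w z"
    using f z unfolding complex_differentiable_on_def by blast
  obtain b where b: "\<And>\<epsilon>. 0 < \<epsilon> \<Longrightarrow> \<exists>\<delta>>0. \<forall>w\<in>D. mdist (cspace n) w z < \<delta> \<longrightarrow>
      cmod (g w - g z - (\<Sum>i<n. b i * (w i - z i))) \<le> \<epsilon> * mdist (cspace n) w z"
    using g z unfolding complex_differentiable_on_def by blast
  \<comment> \<open>The added 1 absorbs the error term: with \<open>e1 \<le> 1\<close> the
    increments of \<open>f\<close> and \<open>g\<close> are at most \<open>A * t\<close> and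
    \<open>B * t\<close>.\<close>
  define A B where "A = (\<Sum>i<n. cmod (a i)) + 1" and "B = (\<Sum>i<n. cmod (b i)) + 1"
  have AB: "1 \<le> A" "1 \<le> B" by (auto simp: A_def B_def sum_nonneg)
  define S where "S = cmod (g z) + cmod (f z) + 1"
  have S: "1 \<le> S" by (simp add: S_def)
  show "\<exists>a. \<forall>\<epsilon>>0. \<exists>\<delta>>0. \<forall>w\<in>D. mdist (cspace n) w z < \<delta> \<longrightarrow>
      cmod (f w * g w - f z * g z - (\<Sum>i<n. a i * (w i - z i))) \<le> \<epsilon> * mdist (cspace n) w z"
  proof (intro exI[of _ "\<lambda>i. a i * g z + f z * b i"] allI impI)
    fix e :: real assume e: "0 < e"
    define e1 where "e1 = min 1 (e / (2 * S))"
    have e1: "0 < e1" "e1 \<le> 1" "e1 * S \<le> e / 2"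
    proof -
      have "e1 * S \<le> e / (2 * S) * S" using S by (intro mult_right_mono) (auto simp: e1_def)
      then show "e1 * S \<le> e / 2" using S by simp
    qed (use e S in \<open>auto simp: e1_def\<close>)
    obtain d1 where d1: "0 < d1" "\<And>w. \<lbrakk>w \<in> D; mdist (cspace n) w z < d1\<rbrakk> \<Longrightarrow>
        cmod (f w - f z - (\<Sum>i<n. a i * (w i - z i))) \<le> e1 * mdist (cspace n) w z"
      using a[OF e1(1)] by blast
    obtain d2 where d2: "0 < d2" "\<And>w. \<lbrakk>w \<in> D; mdist (cspace n) w z < d2\<rbrakk> \<Longrightarrow>
        cmod (g w - g z - (\<Sum>i<n. b i * (w i - z i))) \<le> e1 * mdist (cspace n) w z"
      using b[OF e1(1)] by blast
    \<comment> \<open>The choice of \<open>e1\<close> keeps the two first-order errors together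
      below half of the allowed bound; \<open>d3\<close> does the same for the product of the two
      increments, which is of second order in \<open>t\<close>.\<close>
    define d3 where "d3 = e / (2 * (A * B))"
    have d3: "0 < d3" using e AB by (simp add: d3_def)
    show "\<exists>\<delta>>0. \<forall>w\<in>D. mdist (cspace n) w z < \<delta> \<longrightarrow>
        cmod (f w * g w - f z * g z - (\<Sum>i<n. (a i * g z + f z * b i) * (w i - z i))) \<le> e * mdist (cspace n) w z"
    proof (intro exI[of _ "min d1 (min d2 d3)"] conjI ballI impI)
      show "0 < min d1 (min d2 d3)" using d1 d2 d3 by simp
      fix w assume w: "w \<in> D" "mdist (cspace n) w z < min d1 (min d2 d3)"
      define t where "t = mdist (cspace n) w z"
      have t: "0 \<le> t" "t < d3" using w by (auto simp: t_def)
      define p q where "p = (\<Sum>i<n. a i * (w i - z i))" and "q = (\<Sum>i<n. b i * (w i - z i))"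
      have f1: "cmod (f w - f z - p) \<le> e1 * t" and g1: "cmod (g w - g z - q) \<le> e1 * t"
        using d1(2)[of w] d2(2)[of w] w by (auto simp: p_def q_def t_def)
      have p: "cmod p \<le> (A - 1) * t" and q: "cmod q \<le> (B - 1) * t"
        unfolding p_def q_def t_def A_def B_def using sum_mult_diff_le_mdist by simp_all
      have e1t: "e1 * t \<le> t" using e1 t mult_right_mono[of e1 1 t] by simp
      have f2: "cmod (f w - f z) \<le> A * t"
        using norm_triangle_ineq[of "f w - f z - p" p] f1 p e1t by (simp add: algebra_simps)
      have g2: "cmod (g w - g z) \<le> B * t"
        using norm_triangle_ineq[of "g w - g z - q" q] g1 q e1t by (simp add: algebra_simps)
      have "(\<Sum>i<n. (a i * g z + f z * b i) * (w i - z i)) = p * g z + f z * q"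
        unfolding p_def q_def 
        unfolding sum_distrib_left sum_distrib_right sum.distrib[symmetric]
        by (intro sum.cong) (simp_all add: algebra_simps)
      then have eq: "f w * g w - f z * g z - (\<Sum>i<n. (a i * g z + f z * b i) * (w i - z i))
          = ((f w - f z - p) * g z + f z * (g w - g z - q)) + (f w - f z) * (g w - g z)"
        by (simp add: algebra_simps)
      have "cmod (((f w - f z - p) * g z + f z * (g w - g z - q)) + (f w - f z) * (g w - g z))
          \<le> (e1 * t * cmod (g z) + cmod (f z) * (e1 * t)) + A * t * (B * t)"
      proof (intro norm_triangle_mono)
        show "cmod ((f w - f z - p) * g z) \<le> e1 * t * cmod (g z)"
          unfolding norm_mult by (intro mult_right_mono f1) simp
        show "cmod (f z * (g w - g z - q)) \<le> cmod (f z) * (e1 * t)"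
          unfolding norm_mult by (intro mult_left_mono g1) simp
        show "cmod ((f w - f z) * (g w - g z)) \<le> A * t * (B * t)"
          unfolding norm_mult using f2 g2 AB t by (intro mult_mono) auto
      qed
      also have "e1 * t * cmod (g z) + cmod (f z) * (e1 * t) \<le> (e1 * S) * t"
        using e1 t by (simp add: S_def algebra_simps)
      also have "\<dots> \<le> e / 2 * t" using e1(3) t(1) by (rule mult_right_mono)
      also have "A * t * (B * t) \<le> e / 2 * t"
      proof -
        have "A * B * t \<le> A * B * d3" using AB t by (intro mult_left_mono) auto
        also have "\<dots> = e / 2" using AB by (simp add: d3_def)
        finally show ?thesis using mult_right_mono[OF _ t(1)] by (metis mult.assoc mult.commute)
      qed
      finally show "cmod (f w * g w - f z * g z - (\<Sum>i<n. (a i * g z + f z * b i) * (w i - z i)))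
          \<le> e * mdist (cspace n) w z"
        unfolding eq t_def[symmetric] by simp
    qed
  qed
qed

text \<open>The equations are finite in number and global, so that finite unions are described by
  products of equations; this is how a union of subspaces is recognised as an analytic set.\<close>

definition zero_locus :: "nat \<Rightarrow> (nat \<Rightarrow> complex) set \<Rightarrow> bool" where
  "zero_locus n Z \<longleftrightarrow> (\<exists>F. finite F \<and> (\<forall>g\<in>F. complex_differentiable_on n (mspace (cspace n)) g) \<and>
     Z = {z \<in> mspace (cspace n). \<forall>g\<in>F. g z = 0})"

lemma zero_locus_subspace:
  assumes L: "complex_linear_subspace n L"
  shows "zero_locus n L"
proof -
  obtain c where c: "\<And>z. z \<in> mspace (cspace n) \<Longrightarrow> matrix_map n n c z \<in> L"
    "\<And>z. z \<in> L \<Longrightarrow> matrix_map n n c z = z"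
    using projection_matrix_map[OF L] by blast
  define g where "g = (\<lambda>i z. matrix_map n n c z i - z i)"
  have "complex_differentiable_on n (mspace (cspace n)) (g i)" if "i < n" for i
  proof (rule complex_differentiable_on_affine)
    fix z :: "nat \<Rightarrow> complex"
    show "g i z = 0 + (\<Sum>l<n. (c i l - (if l = i then 1 else 0)) * z l)"
      using that by (simp add: g_def matrix_map_def left_diff_distrib sum_subtractf if_distribR
          if_distrib[of "\<lambda>x. x * _"] cong: if_cong)
  qed
  moreover have "L = {z \<in> mspace (cspace n). \<forall>h\<in>g ` {..<n}. h z = 0}"
  proof safe
    fix z i assume "z \<in> L"
    then show "z \<in> mspace (cspace n)" "g i z = 0"
      using c(2) complex_linear_subspace_mspace[OF L] by (auto simp: g_def)
  next
    fix z assume z: "z \<in> mspace (cspace n)" "\<forall>h\<in>g ` {..<n}. h z = 0"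
    have "matrix_map n n c z = z"
    proof
      fix i show "matrix_map n n c z i = z i"
        using z by (cases "i < n") (auto simp: g_def matrix_map_def mspace_cspace)
    qed
    then show "z \<in> L" using c(1)[OF z(1)] by simp
  qed
  ultimately show ?thesis unfolding zero_locus_def by (intro exI[of _ "g ` {..<n}"]) auto
qed

text \<open>Take all products of an equation of \<open>Y\<close> with an equation of
  \<open>Z\<close>: off both sets some equation of each is nonzero, and so is their product.\<close>

lemma zero_locus_Un:
  assumes "zero_locus n Y" "zero_locus n Z"
  shows "zero_locus n (Y \<union> Z)"
proof -
  obtain F G where F: "finite F" "\<forall>g\<in>F. complex_differentiable_on n (mspace (cspace n)) g"
      "Y = {z \<in> mspace (cspace n). \<forall>g\<in>F. g z = 0}"
    and G: "finite G" "\<forall>g\<in>G. complex_differentiable_on n (mspace (cspace n)) g"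
      "Z = {z \<in> mspace (cspace n). \<forall>g\<in>G. g z = 0}"
    using assms unfolding zero_locus_def by blast
  define H where "H = (\<lambda>(f, g) z. f z * g z) ` (F \<times> G)"
  have "finite H" using F G by (simp add: H_def)
  moreover have "\<forall>h\<in>H. complex_differentiable_on n (mspace (cspace n)) h"
    using F(2) G(2) by (auto simp: H_def intro: complex_differentiable_on_mult)
  moreover have "Y \<union> Z = {z \<in> mspace (cspace n). \<forall>h\<in>H. h z = 0}"
    unfolding F(3) G(3) H_def by auto
  ultimately show ?thesis unfolding zero_locus_def by blast
qed

lemma zero_locus_Union_subspaces:
  assumes "finite \<L>" and "\<And>L. L \<in> \<L> \<Longrightarrow> complex_linear_subspace n L"
  shows "zero_locus n (\<Union>\<L>)"
  using assms
proof (induction \<L> rule: finite_induct)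
  case empty
  \<comment> \<open>The empty union is the zero set of the constant 1.\<close>
  have "complex_differentiable_on n (mspace (cspace n)) (\<lambda>z. 1)"
    by (rule complex_differentiable_on_affine[where c = "\<lambda>i. 0" and ?c0.0 = 1]) simp
  then show ?case unfolding zero_locus_def by (intro exI[of _ "{\<lambda>z. 1}"]) simp
next
  case (insert L \<L>)
  then show ?case by (simp add: zero_locus_Un zero_locus_subspace)
qed

lemma analytic_subset_zero_locus:
  assumes D: "openin (ctop n) D" and Z: "zero_locus n Z"
  shows "analytic_subset n D (D \<inter> Z)"
proof -
  obtain F where F: "finite F" "\<forall>g\<in>F. complex_differentiable_on n (mspace (cspace n)) g"
      "Z = {z \<in> mspace (cspace n). \<forall>g\<in>F. g z = 0}"
    using Z unfolding zero_locus_def by blast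
  have DM: "D \<subseteq> mspace (cspace n)" using openin_subset[OF D] by simp
  have "\<forall>g\<in>F. complex_differentiable_on n D g" using F(2) DM complex_differentiable_on_subset by blast
  moreover have "(D \<inter> Z) \<inter> D = {z \<in> D. \<forall>g\<in>F. g z = 0}" using F(3) DM by auto
  ultimately show ?thesis
    unfolding analytic_subset_def using D F(1) by (intro conjI ballI exI[of _ D] exI[of _ F]) auto
qed

lemma openin_matrix_map_vimage:
  "openin (ctop n) D \<Longrightarrow> openin (ctop d) {w \<in> mspace (cspace d). matrix_map d n A w \<in> D}"
  using openin_continuous_map_preimage[OF Lipschitz_continuous_imp_continuous_map[OF matrix_map_Lipschitz_continuous[of d n A]]]
  by simp

lemma complex_differentiable_on_matrix_map:
  assumes g: "complex_differentiable_on n D g"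
  shows "complex_differentiable_on d {w \<in> mspace (cspace d). matrix_map d n A w \<in> D} (g \<circ> matrix_map d n A)"
  unfolding complex_differentiable_on_def
proof
  fix z assume "z \<in> {w \<in> mspace (cspace d). matrix_map d n A w \<in> D}"
  then have Az: "matrix_map d n A z \<in> D" by simp
  obtain a where a: "\<And>\<epsilon>. 0 < \<epsilon> \<Longrightarrow> \<exists>\<delta>>0. \<forall>w\<in>D. mdist (cspace n) w (matrix_map d n A z) < \<delta> \<longrightarrow>
      cmod (g w - g (matrix_map d n A z) - (\<Sum>i<n. a i * (w i - matrix_map d n A z i)))
        \<le> \<epsilon> * mdist (cspace n) w (matrix_map d n A z)"
    using g Az unfolding complex_differentiable_on_def by blast
  obtain K where K: "0 \<le> K" "\<And>z w. mdist (cspace n) (matrix_map d n A z) (matrix_map d n A w) \<le> K * mdist (cspace d) z w"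
    using matrix_map_Lipschitz by blast
  show "\<exists>b. \<forall>\<epsilon>>0. \<exists>\<delta>>0. \<forall>w\<in>{w \<in> mspace (cspace d). matrix_map d n A w \<in> D}. mdist (cspace d) w z < \<delta> \<longrightarrow>
      cmod ((g \<circ> matrix_map d n A) w - (g \<circ> matrix_map d n A) z - (\<Sum>j<d. b j * (w j - z j)))
        \<le> \<epsilon> * mdist (cspace d) w z"
  \<comment> \<open>The derivative of the composition is the row vector \<open>a\<close> times the
    matrix \<open>A\<close>.\<close>
  proof (intro exI[of _ "\<lambda>j. \<Sum>i<n. a i * A i j"] allI impI)
    fix e :: real assume e: "0 < e"
    \<comment> \<open>Dividing by \<open>K + 1\<close> covers the case \<open>K = 0\<close>.\<close>
    have "0 < e / (K + 1)" using e K by simp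
    from a[OF this] obtain \<delta> where \<delta>: "0 < \<delta>" "\<And>w. \<lbrakk>w \<in> D; mdist (cspace n) w (matrix_map d n A z) < \<delta>\<rbrakk> \<Longrightarrow>
      cmod (g w - g (matrix_map d n A z) - (\<Sum>i<n. a i * (w i - matrix_map d n A z i)))
        \<le> e / (K + 1) * mdist (cspace n) w (matrix_map d n A z)" by blast
    show "\<exists>\<delta>>0. \<forall>w\<in>{w \<in> mspace (cspace d). matrix_map d n A w \<in> D}. mdist (cspace d) w z < \<delta> \<longrightarrow>
      cmod ((g \<circ> matrix_map d n A) w - (g \<circ> matrix_map d n A) z - (\<Sum>j<d. (\<Sum>i<n. a i * A i j) * (w j - z j)))
        \<le> e * mdist (cspace d) w z"
    proof (intro exI[of _ "\<delta> / (K + 1)"] conjI ballI impI)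
      show "0 < \<delta> / (K + 1)" using \<delta> K by simp
      fix w assume w: "w \<in> {w \<in> mspace (cspace d). matrix_map d n A w \<in> D}" "mdist (cspace d) w z < \<delta> / (K + 1)"
      define t where "t = mdist (cspace d) w z"
      have t: "0 \<le> t" "(K + 1) * t < \<delta>" using w(2) K by (auto simp: t_def field_simps)
      have AA: "mdist (cspace n) (matrix_map d n A w) (matrix_map d n A z) \<le> (K + 1) * t"
        using K(2)[of w z] t(1) unfolding t_def[symmetric] by (simp add: algebra_simps)
      have "(\<Sum>j<d. (\<Sum>i<n. a i * A i j) * (w j - z j)) = (\<Sum>j<d. \<Sum>i<n. a i * (A i j * (w j - z j)))"
        by (simp add: sum_distrib_right mult.assoc)
      also have "\<dots> = (\<Sum>i<n. \<Sum>j<d. a i * (A i j * (w j - z j)))" by (rule sum.swap)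
      also have "\<dots> = (\<Sum>i<n. a i * (matrix_map d n A w i - matrix_map d n A z i))"
        by (intro sum.cong) (auto simp: matrix_map_def sum_distrib_left sum_subtractf[symmetric] right_diff_distrib)
      finally have "cmod ((g \<circ> matrix_map d n A) w - (g \<circ> matrix_map d n A) z - (\<Sum>j<d. (\<Sum>i<n. a i * A i j) * (w j - z j)))
          \<le> e / (K + 1) * mdist (cspace n) (matrix_map d n A w) (matrix_map d n A z)"
        using \<delta>(2)[of "matrix_map d n A w"] AA t(2) w(1) by simp
      also have "\<dots> \<le> e / (K + 1) * ((K + 1) * t)" using AA e K by (intro mult_left_mono) auto
      also have "\<dots> = e * t" using K by simp
      finally show "cmod ((g \<circ> matrix_map d n A) w - (g \<circ> matrix_map d n A) z - (\<Sum>j<d. (\<Sum>i<n. a i * A i j) * (w j - z j)))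
          \<le> e * mdist (cspace d) w z" by (simp add: t_def)
    qed
  qed
qed

text \<open>What gets composed is a local extension of \<open>f\<close> to the ambient space: the
  linear map is defined on the whole parameter space, so the preimage of the open domain of the
  extension is open.\<close>

lemma holo_compose_matrix_map:
  assumes f: "f \<in> holo n W" and V: "V \<subseteq> mspace (cspace d)" "\<And>w. w \<in> V \<Longrightarrow> matrix_map d n A w \<in> W"
  shows "f \<circ> matrix_map d n A \<in> holo d V"
  unfolding holo_def
proof (rule CollectI, rule ballI)
  fix p assume p: "p \<in> V"
  then obtain D g where D: "openin (ctop n) D" "matrix_map d n A p \<in> D" "complex_differentiable_on n D g"
    "\<forall>z\<in>W \<inter> D. f z = g z"
    using f V(2)[OF p] unfolding holo_def by blast
  show "\<exists>D g. openin (ctop d) D \<and> p \<in> D \<and> complex_differentiable_on d D g \<and> (\<forall>z\<in>V \<inter> D. (f \<circ> matrix_map d n A) z = g z)"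
  proof (intro exI conjI ballI)
    show "openin (ctop d) {w \<in> mspace (cspace d). matrix_map d n A w \<in> D}" by (rule openin_matrix_map_vimage[OF D(1)])
    show "complex_differentiable_on d {w \<in> mspace (cspace d). matrix_map d n A w \<in> D} (g \<circ> matrix_map d n A)"
      by (rule complex_differentiable_on_matrix_map[OF D(3)])
    show "p \<in> {w \<in> mspace (cspace d). matrix_map d n A w \<in> D}" using p V D by auto
    show "(f \<circ> matrix_map d n A) z = (g \<circ> matrix_map d n A) z"
      if "z \<in> V \<inter> {w \<in> mspace (cspace d). matrix_map d n A w \<in> D}" for z
      using that D(4) V(2) by auto
  qed
qed


section \<open>Currents on a single subspace\<close>

lemma mdist_Lipschitz:
  assumes "p \<in> mspace M" "x \<in> mspace M" "y \<in> mspace M"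
  shows "\<bar>mdist M x p - mdist M y p\<bar> \<le> mdist M x y"
proof -
  interpret Metric_space "mspace M" "mdist M" by simp
  show ?thesis using triangle[of x y p] triangle[of y x p] assms by (simp add: commute abs_le_iff)
qed

section \<open>Cut-offs that are plateau functions of a Lipschitz radius\<close>

context
  fixes M :: "'a metric" and \<rho> :: "'a \<Rightarrow> real" and C :: real
  assumes Lip: "\<And>x y. \<lbrakk>x \<in> mspace M; y \<in> mspace M\<rbrakk> \<Longrightarrow> \<bar>\<rho> x - \<rho> y\<bar> \<le> C * mdist M x y"
    and nonneg: "\<And>x. 0 \<le> \<rho> x"
begin

lemma Lipschitz_radius_Lip_loc: "(\<lambda>x. complex_of_real (\<rho> x)) \<in> Lip_loc M"
  by (rule Lip_bound_imp_Lip_loc[of _ C]) (use Lip in \<open>auto simp: Lip_bound_def simp flip: of_real_diff\<close>)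

lemma openin_sublevel: "openin (mtopology_of M) {x \<in> mspace M. \<rho> x < a}"
  using openin_Lip_loc_norm_less[OF Lipschitz_radius_Lip_loc] nonneg by simp

lemma closedin_sublevel: "closedin (mtopology_of M) {x \<in> mspace M. \<rho> x \<le> a}"
  using closedin_Lip_loc_norm_le[OF Lipschitz_radius_Lip_loc] nonneg by simp

lemma plateau_Lip_bound:
  assumes "a < b"
  shows "Lip_bound M (mspace M) (C / (b - a)) (\<lambda>x. complex_of_real (plateau a b (\<rho> x)))"
  unfolding Lip_bound_def
proof (intro ballI)
  fix x y assume xy: "x \<in> mspace M" "y \<in> mspace M"
  have "cmod (complex_of_real (plateau a b (\<rho> x)) - complex_of_real (plateau a b (\<rho> y)))
      = \<bar>plateau a b (\<rho> x) - plateau a b (\<rho> y)\<bar>" by (metis norm_of_real of_real_diff)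
  also have "\<dots> \<le> \<bar>\<rho> x - \<rho> y\<bar> / (b - a)" by (rule plateau_Lipschitz[OF assms])
  also have "\<dots> \<le> C * mdist M x y / (b - a)" using Lip[OF xy] assms by (intro divide_right_mono) auto
  finally show "cmod (complex_of_real (plateau a b (\<rho> x)) - complex_of_real (plateau a b (\<rho> y)))
      \<le> C / (b - a) * mdist M x y" by simp
qed

lemma plateau_test_function:
  assumes ab: "a < b" and K: "compactin (mtopology_of M) {x \<in> mspace M. \<rho> x \<le> b}"
  shows "(\<lambda>x. complex_of_real (plateau a b (\<rho> x))) \<in> test_functions M"
    and "fsupp M (\<lambda>x. complex_of_real (plateau a b (\<rho> x))) \<subseteq> {x \<in> mspace M. \<rho> x \<le> b}"
proof -
  show *: "fsupp M (\<lambda>x. complex_of_real (plateau a b (\<rho> x))) \<subseteq> {x \<in> mspace M. \<rho> x \<le> b}"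
  proof (rule fsupp_subset_closedin[OF closedin_sublevel])
    fix x assume "x \<in> mspace M" "complex_of_real (plateau a b (\<rho> x)) \<noteq> 0"
    then show "x \<in> {x \<in> mspace M. \<rho> x \<le> b}" using plateau_eq_0[OF ab, of "\<rho> x"] by fastforce
  qed
  show "(\<lambda>x. complex_of_real (plateau a b (\<rho> x))) \<in> test_functions M"
    unfolding test_functions_iff using plateau_Lip_bound[OF ab] compactin_fsupp_subset[OF K *] by blast
qed

lemma localised_map_plateau:
  assumes ab: "a < b" and K: "compactin (mtopology_of M') K" "\<And>x. \<lbrakk>x \<in> mspace M; \<rho> x \<le> b\<rbrakk> \<Longrightarrow> g x \<in> K"
    and g: "\<And>x y. \<lbrakk>x \<in> mspace M; y \<in> mspace M; \<rho> x \<le> b; \<rho> y \<le> b\<rbrakk> \<Longrightarrow> mdist M' (g x) (g y) \<le> C' * mdist M x y"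
  shows "localised_map M M' {x \<in> mspace M. \<rho> x \<le> b} g (\<lambda>x. complex_of_real (plateau a b (\<rho> x)))"
  unfolding localised_map_def
proof (intro conjI)
  show "\<exists>K. compactin (mtopology_of M') K \<and> (\<forall>x\<in>{x \<in> mspace M. \<rho> x \<le> b} \<inter> mspace M. g x \<in> K)"
    using K by blast
  show "\<exists>C. \<forall>x\<in>{x \<in> mspace M. \<rho> x \<le> b} \<inter> mspace M. \<forall>y\<in>{x \<in> mspace M. \<rho> x \<le> b} \<inter> mspace M.
      mdist M' (g x) (g y) \<le> C * mdist M x y" using g by (intro exI[of _ C']) simp
  show "\<exists>A. Lip_bound M (mspace M) A (\<lambda>x. complex_of_real (plateau a b (\<rho> x)))"
    using plateau_Lip_bound[OF ab] by blast
  show "\<forall>x\<in>mspace M. cmod (complex_of_real (plateau a b (\<rho> x))) \<le> 1"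
    using plateau_bounds by (simp add: abs_le_iff)
  show "\<forall>x\<in>mspace M - {x \<in> mspace M. \<rho> x \<le> b}. complex_of_real (plateau a b (\<rho> x)) = 0"
    by (auto intro!: plateau_eq_0[OF ab])
qed

end

text \<open>The difference of two corresponding arguments is zero, hence constant, on a
  neighbourhood of the support of \<open>f\<close>, so locality permits exchanging them one at a
  time.\<close>

lemma local_current_cong_args_near_support:
  assumes T: "local_current M m T" and f: "f \<in> test_functions M"
    and \<pi>: "\<And>i. i < m \<Longrightarrow> \<pi> i \<in> Lip_loc M" and \<rho>: "\<And>i. i < m \<Longrightarrow> \<rho> i \<in> Lip_loc M"
    and U: "openin (mtopology_of M) U" "fsupp M f \<subseteq> U"
    and eq: "\<And>i x. \<lbrakk>i < m; x \<in> U\<rbrakk> \<Longrightarrow> \<pi> i x = \<rho> i x"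
  shows "T f \<pi> = T f \<rho>"
proof -
  define \<sigma> where "\<sigma> n = (\<lambda>i. if i < n then \<rho> i else \<pi> i)" for n
  have \<sigma>: "\<sigma> n i \<in> Lip_loc M" if "i < m" for n i using that \<pi> \<rho> by (simp add: \<sigma>_def)
  have "T f (\<sigma> n) = T f \<pi>" if "n \<le> m" for n
    using that
  proof (induction n)
    case (Suc n)
    have n: "n < m" using Suc.prems by simp
    have "T f ((\<sigma> n)(n := \<lambda>x. 1 * \<rho> n x + (-1) * \<pi> n x)) = 0"
    proof (rule local_current_local[OF T f _ n U])
      show "((\<sigma> n)(n := \<lambda>x. 1 * \<rho> n x + (-1) * \<pi> n x)) i \<in> Lip_loc M" if "i < m" for i
        using that \<sigma> Lip_loc_lincomb[OF \<rho>[OF n] \<pi>[OF n], of 1 "-1"] by auto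
      show "((\<sigma> n)(n := \<lambda>x. 1 * \<rho> n x + (-1) * \<pi> n x)) n x = 0" if "x \<in> U" for x
        using eq[OF n that] by simp
    qed
    then have "T f ((\<sigma> n)(n := \<rho> n)) = T f ((\<sigma> n)(n := \<pi> n))"
      using local_current_lincomb_arg[where \<pi> = "\<sigma> n" and a = 1 and b = "-1", OF T f \<sigma> n \<rho>[OF n] \<pi>[OF n]] by simp
    moreover have "(\<sigma> n)(n := \<pi> n) = \<sigma> n" "(\<sigma> n)(n := \<rho> n) = \<sigma> (Suc n)"
      by (auto simp: \<sigma>_def fun_eq_iff less_Suc_eq)
    ultimately show ?case using Suc by simp
  qed (simp add: \<sigma>_def)
  from this[of m] have "T f (\<sigma> m) = T f \<pi>" by simp
  moreover have "T f (\<sigma> m) = T f \<rho>"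
    by (rule local_current_cong[OF T f f \<sigma> \<rho>]) (auto simp: \<sigma>_def)
  ultimately show ?thesis by simp
qed

text \<open>Push-forwards are computed only on test functions and locally Lipschitz arguments. The
  conditions on a current stay within such arguments, because these are stable under linear
  combinations.\<close>

lemma local_current_transfer_eq:
  assumes T: "local_current M m T"
    and eq: "\<And>f \<pi>. \<lbrakk>f \<in> test_functions M; \<And>i. i < m \<Longrightarrow> \<pi> i \<in> Lip_loc M\<rbrakk> \<Longrightarrow> R f \<pi> = T f \<pi>"
  shows "local_current M m R"
  unfolding local_current_def
proof (intro conjI ballI allI impI; (elim conjE exE)?)
  fix f g a b \<pi>
  assume *: "f \<in> test_functions M" "g \<in> test_functions M" "\<forall>i<m. \<pi> i \<in> Lip_loc M"
  have "(\<lambda>x. a * f x + b * g x) \<in> test_functions M"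
  proof -
    obtain L L' where "Lip_bound M (mspace M) L f" "Lip_bound M (mspace M) L' g"
      using * unfolding test_functions_iff by blast
    then have L: "Lip_bound M (mspace M) (cmod a * L + cmod b * L') (\<lambda>x. a * f x + b * g x)"
      by (rule Lip_bound_lincomb)
    have "compactin (mtopology_of M) (fsupp M f \<union> fsupp M g)"
      using * unfolding test_functions_iff by (simp add: compactin_Un)
    moreover have "fsupp M (\<lambda>x. a * f x + b * g x) \<subseteq> fsupp M f \<union> fsupp M g"
      by (rule fsupp_subset_closedin[OF closedin_Un[OF closedin_fsupp closedin_fsupp]])
        (use subset_fsupp[of _ M f] subset_fsupp[of _ M g] in fastforce)
    ultimately show ?thesis unfolding test_functions_iff using L compactin_fsupp_subset by blast
  qed
  then show "R (\<lambda>x. a * f x + b * g x) \<pi> = a * R f \<pi> + b * R g \<pi>"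
    using * by (simp add: eq local_current_lincomb[OF T])
next
  fix f \<pi> i v w a b
  assume "f \<in> test_functions M" "\<forall>i<m. \<pi> i \<in> Lip_loc M" "i < m" "v \<in> Lip_loc M" "w \<in> Lip_loc M"
  then show "R f (\<pi>(i := \<lambda>x. a * v x + b * w x)) = a * R f (\<pi>(i := v)) + b * R f (\<pi>(i := w))"
    by (simp add: eq local_current_lincomb_arg[OF T] Lip_loc_lincomb)
next
  fix F f P \<pi>
  assume *: "\<forall>j. F j \<in> test_functions M" "f \<in> test_functions M"
    "\<forall>i<m. (\<forall>j. P j i \<in> Lip_loc M) \<and> \<pi> i \<in> Lip_loc M"
    "converges_test M F f" "\<forall>i<m. converges_Lip_loc M (\<lambda>j. P j i) (\<pi> i)"
  have "(\<lambda>j. T (F j) (P j)) \<longlonglongrightarrow> T f \<pi>" by (rule local_current_tendsto[OF T]) (use * in auto)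
  then show "(\<lambda>j. R (F j) (P j)) \<longlonglongrightarrow> R f \<pi>" using * by (simp add: eq)
next
  fix f \<pi> i U c
  assume *: "f \<in> test_functions M" "\<forall>i<m. \<pi> i \<in> Lip_loc M" "i < m" "openin (mtopology_of M) U"
    "fsupp M f \<subseteq> U" "\<forall>x\<in>U. \<pi> i x = c"
  have "T f \<pi> = 0" by (rule local_current_local[OF T, where i = i and U = U and c = c]) (use * in auto)
  then show "R f \<pi> = 0" using * by (simp add: eq)
qed

lemma Hausdorff_space_mtopology_of: "Hausdorff_space (mtopology_of M)"
  by (simp add: mtopology_of_def Metric_space.Hausdorff_space_mtopology)

lemma closedin_csupp:
  assumes "local_current M m T"
  shows "closedin (mtopology_of M) (csupp M m T)"
  unfolding csupp_eq
proof (rule closedin_Inter)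
  show "{C. vanishes_off M m T C} \<noteq> {}" using vanishes_off_mspace[OF assms] by blast
qed (simp add: vanishes_off_def)

text \<open>
  Here \<open>k\<close> plays the role of the inverse of a chart, defined on the part of the arrangement at
  distance less than \<open>R\<close> from \<open>b\<close>.
\<close>

lemma current_on_subspace_as_pushforward:
  fixes Z :: "'a metric" and Y :: "(nat \<Rightarrow> complex) set" and R :: real and n :: nat
  defines "N \<equiv> submetric (cspace n) Y"
    and "\<psi> \<equiv> (\<lambda>i j z b. complex_of_real (plateau (real i * R / 5) (real j * R / 5) (mdist (cspace n) z b)))"
  assumes S: "compact_current N m S"
    and Y: "Y \<subseteq> mspace (cspace n)" and L: "complex_linear_subspace n L" "L \<subseteq> Y"
    and r: "Lipschitz_continuous_map N N r" "\<And>z. z \<in> Y \<Longrightarrow> r z \<in> L"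
    and b: "b \<in> mspace (cspace n)" and R: "0 < R"
    and k: "\<And>z. \<lbrakk>z \<in> Y; mdist (cspace n) z b < R\<rbrakk> \<Longrightarrow> k z \<in> mspace Z"
      "\<And>z w. \<lbrakk>z \<in> Y; w \<in> Y; mdist (cspace n) z b < R; mdist (cspace n) w b < R\<rbrakk> \<Longrightarrow>
        mdist Z (k z) (k w) \<le> C * mdist (cspace n) z w"
    and holo: "\<And>W f. \<lbrakk>openin (mtopology_of Z) W; f \<in> \<O> W\<rbrakk> \<Longrightarrow>
        f \<circ> k \<in> holo n {z \<in> Y. mdist (cspace n) z b < R \<and> k z \<in> W}"
  obtains d V h S' where
    "openin (ctop d) V"
    "holomorphic_map (subtopology (ctop d) V) (holo d) (mtopology_of Z) \<O> h"
    "locally_Lipschitz (submetric (cspace d) V) Z h"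
    "local_current (submetric (cspace d) V) m S'"
    "proper_map (subtopology (ctop d) (csupp (submetric (cspace d) V) m S')) (mtopology_of Z) h"
    "\<And>f \<pi>. \<lbrakk>f \<in> Lip_loc Z; \<And>i. i < m \<Longrightarrow> \<pi> i \<in> Lip_loc Z\<rbrakk> \<Longrightarrow>
      pushforward (submetric (cspace d) V) m h S' f \<pi> =
      S ((\<lambda>z. \<psi> 1 2 z b * f (k z)) \<circ> r) (\<lambda>i. (\<lambda>z. \<psi> 3 4 z b * \<pi> i (k z)) \<circ> r)"
proof -
  \<comment> \<open>Five equal steps up to the radius \<open>R\<close> of the domain of
    \<open>k\<close>: the function is cut off between \<open>s 1\<close> and \<open>s 2\<close>, the
    arguments between \<open>s 3\<close> and \<open>s 4\<close>. The gap from \<open>s 2\<close> to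
    \<open>s 3\<close> makes the second cut-off 1 near the support of the first.\<close>
  define s where "s i = real i * R / 5" for i :: nat
  have s: "s i < s j" if "i < j" for i j using that R by (simp add: s_def divide_strict_right_mono)
  have s4: "s 4 < R" using R by (simp add: s_def)
  have s24: "s 2 < s 4" "s 3 < s 4" "s 2 < s 3" "s 1 < s 2" by (simp_all add: s)
  have \<psi>_s: "\<psi> i j z b = complex_of_real (plateau (s i) (s j) (mdist (cspace n) z b))" for i j z
    by (simp add: \<psi>_def s_def)
  have NM: "mspace N = Y" using Y by (auto simp: N_def)
  have Nd: "mdist N = mdist (cspace n)" by (simp add: N_def)
  obtain d A B where A: "\<And>w. w \<in> mspace (cspace d) \<Longrightarrow> matrix_map d n A w \<in> L"
    and BA: "\<And>w. w \<in> mspace (cspace d) \<Longrightarrow> matrix_map n d B (matrix_map d n A w) = w"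
    and AB: "\<And>z. z \<in> L \<Longrightarrow> matrix_map d n A (matrix_map n d B z) = z"
    using linear_parametrisation[OF L(1)] by blast
  obtain KA where KA: "0 \<le> KA" "\<And>z w. mdist (cspace n) (matrix_map d n A z) (matrix_map d n A w) \<le> KA * mdist (cspace d) z w"
    using matrix_map_Lipschitz by blast
  obtain KB where KB: "0 \<le> KB" "\<And>z w. mdist (cspace d) (matrix_map n d B z) (matrix_map n d B w) \<le> KB * mdist (cspace n) z w"
    using matrix_map_Lipschitz by blast
  \<comment> \<open>Distance to \<open>b\<close> is measured in the ambient space, so that
    \<open>V\<close> below is exactly the part of the parameter space that \<open>A\<close> sends
    into the domain of \<open>k\<close>.\<close>
  define \<rho> where "\<rho> w = mdist (cspace n) (matrix_map d n A w) b" for w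
  have \<rho>nn: "0 \<le> \<rho> w" for w by (simp add: \<rho>_def)
  have \<rho>Lip: "\<bar>\<rho> v - \<rho> w\<bar> \<le> KA * mdist (cspace d) v w" for v w
    using mdist_Lipschitz[OF b matrix_map_in_mspace matrix_map_in_mspace] KA(2)[of v w]
    unfolding \<rho>_def by (meson order_trans)
  define V where "V = {w \<in> mspace (cspace d). \<rho> w < R}"
  define MV where "MV = submetric (cspace d) V"
  have V: "openin (ctop d) V" unfolding V_def by (rule openin_sublevel[OF \<rho>Lip \<rho>nn])
  have VM: "mspace MV = V" by (auto simp: MV_def V_def)
  have Vd: "mdist MV = mdist (cspace d)" by (simp add: MV_def)
  have \<rho>LipV: "\<bar>\<rho> v - \<rho> w\<bar> \<le> KA * mdist MV v w" for v w using \<rho>Lip Vd by simp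
  have cptV: "compactin (mtopology_of MV) {w \<in> mspace MV. \<rho> w \<le> c}" if c: "c < R" for c
  proof -
    have "{w \<in> mspace MV. \<rho> w \<le> c} = {w \<in> mspace (cspace d). \<rho> w \<le> c}" using c by (auto simp: VM V_def)
    moreover have "compactin (ctop d) {w \<in> mspace (cspace d). \<rho> w \<le> c}"
    proof (rule compactin_cspace_bounded[OF closedin_sublevel[OF \<rho>Lip \<rho>nn]])
      fix w assume w: "w \<in> {w \<in> mspace (cspace d). \<rho> w \<le> c}"
      \<comment> \<open>\<open>B\<close> undoes \<open>A\<close>, so a bound on the distance of
        \<open>A w\<close> to \<open>b\<close> bounds the distance of \<open>w\<close> to the image
        of \<open>b\<close> under \<open>B\<close>.\<close>
      have "mdist (cspace d) w (matrix_map n d B b) \<le> KB * \<rho> w"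
        using KB(2)[of "matrix_map d n A w" b] BA[of w] w by (simp add: \<rho>_def)
      also have "\<dots> \<le> KB * c" using w KB(1) by (intro mult_left_mono) auto
      finally show "mdist (cspace d) w (matrix_map n d B b) \<le> KB * c" .
    qed
    moreover have "{w \<in> mspace MV. \<rho> w \<le> c} \<subseteq> V" using VM by auto
    ultimately show ?thesis by (simp add: MV_def mtopology_of_submetric compactin_subtopology)
  qed
  \<comment> \<open>These are the coordinates of the retracted point. As \<open>A\<close> recovers
    \<open>r z\<close> from \<open>g z\<close>, the radius \<open>\<rho>\<close> at
    \<open>g z\<close> equals the radius \<open>\<rho>'\<close> at \<open>z\<close>, and cut-offs in
    the two radii correspond.\<close>
  define g where "g z = matrix_map n d B (r z)" for z
  define \<rho>' where "\<rho>' z = mdist (cspace n) (r z) b" for z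
  obtain Kr where Kr: "\<And>z w. \<lbrakk>z \<in> Y; w \<in> Y\<rbrakk> \<Longrightarrow> mdist (cspace n) (r z) (r w) \<le> Kr * mdist (cspace n) z w"
    using r(1) unfolding Lipschitz_continuous_map_def NM Nd by blast
  have rM: "r z \<in> mspace (cspace n)" if "z \<in> Y" for z using r(2)[OF that] complex_linear_subspace_mspace[OF L(1)] by blast
  have \<rho>'Lip: "\<bar>\<rho>' z - \<rho>' w\<bar> \<le> Kr * mdist N z w" if "z \<in> mspace N" "w \<in> mspace N" for z w
    using mdist_Lipschitz[OF b rM rM, of z w] Kr[of z w] that unfolding NM Nd \<rho>'_def by linarith
  have \<rho>'nn: "0 \<le> \<rho>' z" for z by (simp add: \<rho>'_def)
  have Ag: "matrix_map d n A (g z) = r z" if "z \<in> Y" for z unfolding g_def by (rule AB[OF r(2)[OF that]])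
  have \<rho>g: "\<rho> (g z) = \<rho>' z" if "z \<in> Y" for z by (simp add: \<rho>_def \<rho>'_def Ag[OF that])
  have gLip: "mdist MV (g z) (g w) \<le> (KB * Kr) * mdist N z w" if "z \<in> mspace N" "w \<in> mspace N" for z w
  proof -
    have "mdist MV (g z) (g w) \<le> KB * mdist (cspace n) (r z) (r w)" unfolding Vd g_def by (rule KB(2))
    also have "\<dots> \<le> KB * (Kr * mdist N z w)" using Kr that KB(1) unfolding NM Nd by (intro mult_left_mono) auto
    finally show ?thesis by simp
  qed
  have gV: "g z \<in> {w \<in> mspace MV. \<rho> w \<le> c}" if "z \<in> Y" "\<rho>' z \<le> c" "c < R" for z c
    using that \<rho>g[OF that(1)] by (auto simp: VM V_def g_def)
  have loc: "localised_map N MV {z \<in> mspace N. \<rho>' z \<le> s j} g (\<lambda>z. complex_of_real (plateau (s i) (s j) (\<rho>' z)))"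
    if ij: "i < j" "j \<le> 4" for i j
  proof (rule localised_map_plateau[OF \<rho>'Lip \<rho>'nn s[OF ij(1)] cptV])
    have "s j \<le> s 4" using s ij(2) by (cases "j = 4") (auto simp: less_imp_le)
    then show sj: "s j < R" using s4 by linarith
    show "g z \<in> {w \<in> mspace MV. \<rho> w \<le> s j}" if "z \<in> mspace N" "\<rho>' z \<le> s j" for z
      using gV[of z "s j"] that sj NM by simp
  qed (use gLip in auto)
  define S' where "S' = (\<lambda>f \<pi>. S (\<lambda>z. complex_of_real (plateau (s 1) (s 2) (\<rho>' z)) * f (g z))
    (\<lambda>i z. complex_of_real (plateau (s 3) (s 4) (\<rho>' z)) * \<pi> i (g z)))"
  have loc12: "localised_map N MV {z \<in> mspace N. \<rho>' z \<le> s 2} g (\<lambda>z. complex_of_real (plateau (s 1) (s 2) (\<rho>' z)))"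
    and loc34: "localised_map N MV {z \<in> mspace N. \<rho>' z \<le> s 4} g (\<lambda>z. complex_of_real (plateau (s 3) (s 4) (\<rho>' z)))"
    by (intro loc; simp)+
  have S': "compact_current MV m S'"
    unfolding S'_def
  proof (rule compact_current_transfer[OF S loc12 loc34])
    show "closedin (mtopology_of N) {z \<in> mspace N. \<rho>' z \<le> s 2}" by (rule closedin_sublevel[OF \<rho>'Lip \<rho>'nn])
    show "openin (mtopology_of N) {z \<in> mspace N. \<rho>' z < s 3}" by (rule openin_sublevel[OF \<rho>'Lip \<rho>'nn])
    show "complex_of_real (plateau (s 3) (s 4) (\<rho>' z)) = 1" if "z \<in> {z \<in> mspace N. \<rho>' z < s 3}" for z
      using that plateau_eq_1[OF s24(2), of "\<rho>' z"] by simp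
  qed (use s24 in auto)
  define E where "E = {w \<in> mspace MV. \<rho> w \<le> s 2}"
  have E: "closedin (mtopology_of MV) E" unfolding E_def by (rule closedin_sublevel[OF \<rho>LipV \<rho>nn])
  have s2R: "s 2 < R" using s4 s24 by linarith
  have Ecpt: "compactin (mtopology_of MV) E" unfolding E_def by (rule cptV[OF s2R])
  \<comment> \<open>The first cut-off vanishes where \<open>\<rho>'\<close> exceeds
    \<open>s 2\<close>, and elsewhere \<open>g\<close> takes values in \<open>E\<close>; so
    \<open>S'\<close> reads its first argument on \<open>E\<close> only.\<close>
  have dep: "S' f \<pi> = S' f' \<pi>"
    if f: "f \<in> Lip_loc MV" "f' \<in> Lip_loc MV" "\<And>i. i < m \<Longrightarrow> \<pi> i \<in> Lip_loc MV" "\<And>x. x \<in> E \<Longrightarrow> f x = f' x" for f f' \<pi>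
    unfolding S'_def
  proof (rule compact_current_cong[OF S])
    fix z assume z: "z \<in> mspace N"
    show "complex_of_real (plateau (s 1) (s 2) (\<rho>' z)) * f (g z) = complex_of_real (plateau (s 1) (s 2) (\<rho>' z)) * f' (g z)"
    proof (cases "\<rho>' z \<le> s 2")
      case True
      then show ?thesis using gV[of z "s 2"] f(4)[of "g z"] s2R z NM by (simp add: E_def)
    next
      case False
      then show ?thesis using plateau_eq_0[OF s24(4), of "\<rho>' z"] by simp
    qed
  qed (use f localised_map_Lip_loc[OF loc12] localised_map_Lip_loc[OF loc34] in auto)
  have csub: "csupp MV m S' \<subseteq> E" using S' E dep by (rule csupp_subset)
  \<comment> \<open>It has compact support within \<open>V\<close> because the sublevel set of
    radius \<open>s 4\<close> is compact, \<open>s 4\<close> being less than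
    \<open>R\<close>.\<close>
  define \<xi> where "\<xi> w = complex_of_real (plateau (s 3) (s 4) (\<rho> w))" for w
  have \<xi>: "cutoff MV E \<xi>"
    unfolding cutoff_def
  proof (intro conjI exI)
    show "\<xi> \<in> test_functions MV" unfolding \<xi>_def
      by (rule plateau_test_function[OF \<rho>LipV \<rho>nn s24(2) cptV[OF s4]])
    show "openin (mtopology_of MV) {w \<in> mspace MV. \<rho> w < s 3}" by (rule openin_sublevel[OF \<rho>LipV \<rho>nn])
    show "E \<subseteq> {w \<in> mspace MV. \<rho> w < s 3}" using s24 by (auto simp: E_def)
    show "\<forall>w\<in>{w \<in> mspace MV. \<rho> w < s 3}. \<xi> w = 1" using plateau_eq_1[OF s24(2)] by (simp add: \<xi>_def)
  qed
  define h where "h = k \<circ> matrix_map d n A"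
  have hV: "matrix_map d n A w \<in> Y" "mdist (cspace n) (matrix_map d n A w) b < R" if "w \<in> V" for w
    using that A[of w] L(2) by (auto simp: V_def \<rho>_def)
  have hLip: "Lipschitz_continuous_map MV Z h"
    unfolding Lipschitz_continuous_map_def
  proof (intro conjI exI[of _ "\<bar>C\<bar> * KA"] Pi_I ballI)
    show "h w \<in> mspace Z" if "w \<in> mspace MV" for w using k(1) hV that VM by (simp add: h_def)
    fix v w assume vw: "v \<in> mspace MV" "w \<in> mspace MV"
    have "mdist Z (h v) (h w) \<le> C * mdist (cspace n) (matrix_map d n A v) (matrix_map d n A w)"
      using k(2) hV vw VM by (simp add: h_def)
    also have "\<dots> \<le> \<bar>C\<bar> * mdist (cspace n) (matrix_map d n A v) (matrix_map d n A w)"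
      by (intro mult_right_mono) auto
    also have "\<dots> \<le> \<bar>C\<bar> * (KA * mdist (cspace d) v w)" by (intro mult_left_mono KA(2)) auto
    finally show "mdist Z (h v) (h w) \<le> \<bar>C\<bar> * KA * mdist MV v w" by (simp add: Vd)
  qed
  have hcont: "continuous_map (subtopology (ctop d) V) (mtopology_of Z) h"
    using Lipschitz_continuous_imp_continuous_map[OF hLip] by (simp add: MV_def mtopology_of_submetric)
  show thesis
  proof (rule that[OF V])
    show "holomorphic_map (subtopology (ctop d) V) (holo d) (mtopology_of Z) \<O> h"
      unfolding holomorphic_map_def
    proof (intro conjI allI impI; (elim conjE)?)
      show "continuous_map (subtopology (ctop d) V) (mtopology_of Z) h" by (rule hcont)
      fix W f assume W: "openin (mtopology_of Z) W" "f \<in> \<O> W"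
      have "(f \<circ> k) \<circ> matrix_map d n A \<in> holo d {w \<in> topspace (subtopology (ctop d) V). h w \<in> W}"
      proof (rule holo_compose_matrix_map[OF holo[OF W]])
        show "matrix_map d n A w \<in> {z \<in> Y. mdist (cspace n) z b < R \<and> k z \<in> W}"
          if "w \<in> {w \<in> topspace (subtopology (ctop d) V). h w \<in> W}" for w
          using that hV[of w] by (simp add: h_def)
      qed auto
      then show "f \<circ> h \<in> holo d {w \<in> topspace (subtopology (ctop d) V). h w \<in> W}"
        by (simp add: h_def comp_assoc)
    qed
    show "locally_Lipschitz (submetric (cspace d) V) Z h"
      unfolding locally_Lipschitz_def MV_def[symmetric]
      using Lipschitz_continuous_map_from_submetric[OF hLip] by blast
    show "local_current (submetric (cspace d) V) m S'"
      unfolding MV_def[symmetric] by (rule compact_current_imp_local_current[OF S'])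
    show "proper_map (subtopology (ctop d) (csupp (submetric (cspace d) V) m S')) (mtopology_of Z) h"
      unfolding MV_def[symmetric]
    proof (rule continuous_imp_proper_map)
      \<comment> \<open>The support is closed in the compact set \<open>E\<close>, and a continuous
        map from a compact space to a Hausdorff space is proper.\<close>
      have "compactin (mtopology_of MV) (csupp MV m S')"
        by (rule closed_compactin[OF Ecpt csub closedin_csupp[OF compact_current_imp_local_current[OF S']]])
      then have c: "compactin (ctop d) (csupp MV m S')" "csupp MV m S' \<subseteq> V"
        by (simp_all add: MV_def mtopology_of_submetric compactin_subtopology)
      then show "compact_space (subtopology (ctop d) (csupp MV m S'))" by (simp add: compact_space_subtopology)
      show "kc_space (mtopology_of Z)" by (rule Hausdorff_imp_kc_space[OF Hausdorff_space_mtopology_of])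
      show "continuous_map (subtopology (ctop d) (csupp MV m S')) (mtopology_of Z) h"
        by (rule continuous_map_from_subtopology_mono[OF hcont c(2)])
    qed
    fix f \<pi> assume f: "f \<in> Lip_loc Z" and \<pi>: "\<And>i. i < m \<Longrightarrow> \<pi> i \<in> Lip_loc Z"
    have fh: "f \<circ> h \<in> Lip_loc MV" and \<pi>h: "\<And>i. i < m \<Longrightarrow> \<pi> i \<circ> h \<in> Lip_loc MV"
      using f \<pi> hLip by (auto intro: Lip_loc_compose)
    have "pushforward MV m h S' f \<pi> = S' (f \<circ> h) (\<lambda>i. \<pi> i \<circ> h)"
      using S' E dep \<xi> fh \<pi>h by (rule pushforward_eq)
    \<comment> \<open>On \<open>Y\<close> the composition of \<open>g\<close> and \<open>h\<close>
      is \<open>k \<circ> r\<close>, because \<open>A\<close> cancels \<open>B\<close> on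
      \<open>L\<close>; so the parametrisation disappears from the formula.\<close>
    also have "\<dots> = S ((\<lambda>z. \<psi> 1 2 z b * f (k z)) \<circ> r) (\<lambda>i. (\<lambda>z. \<psi> 3 4 z b * \<pi> i (k z)) \<circ> r)"
      unfolding S'_def
    proof (rule compact_current_cong[OF S])
      show "(\<lambda>z. complex_of_real (plateau (s 1) (s 2) (\<rho>' z)) * (f \<circ> h) (g z)) \<in> Lip_loc N"
        by (rule localised_map_Lip_loc[OF loc12 fh])
      show "(\<lambda>z. complex_of_real (plateau (s 3) (s 4) (\<rho>' z)) * (\<pi> i \<circ> h) (g z)) \<in> Lip_loc N" if "i < m" for i
        by (rule localised_map_Lip_loc[OF loc34 \<pi>h[OF that]])
    qed (simp_all add: NM Ag h_def \<psi>_s \<rho>'_def)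
    finally show "pushforward (submetric (cspace d) V) m h S' f \<pi> =
        S ((\<lambda>z. \<psi> 1 2 z b * f (k z)) \<circ> r) (\<lambda>i. (\<lambda>z. \<psi> 3 4 z b * \<pi> i (k z)) \<circ> r)"
      unfolding MV_def .
  qed
qed


section \<open>Arrangements and charts\<close>

lemma intersection_closed_arrangement:
  assumes fin: "finite \<L>" and lin: "\<And>L. L \<in> \<L> \<Longrightarrow> complex_linear_subspace n L"
  obtains \<L>' where "finite \<L>'" "\<And>L. L \<in> \<L>' \<Longrightarrow> complex_linear_subspace n L"
    "\<And>F G. \<lbrakk>F \<in> \<L>'; G \<in> \<L>'\<rbrakk> \<Longrightarrow> F \<inter> G \<in> \<L>'" "\<Union>\<L>' = \<Union>\<L>"
proof
  \<comment> \<open>The empty subfamily is excluded because its intersection is the whole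
    type.\<close>
  define \<L>' where "\<L>' = Inter ` (Pow \<L> - {{}})"
  show "finite \<L>'" using fin by (simp add: \<L>'_def)
  show "complex_linear_subspace n L" if L: "L \<in> \<L>'" for L
  proof -
    obtain \<S> where \<S>': "L = \<Inter>\<S>" "\<S> \<in> Pow \<L> - {{}}" using L unfolding \<L>'_def by (rule imageE)
    then have \<S>: "\<S> \<subseteq> \<L>" "\<S> \<noteq> {}" by simp_all
    have "finite \<S>" using \<S>(1) fin by (rule finite_subset)
    from this \<S>(2,1) have "complex_linear_subspace n (\<Inter>\<S>)"
      by (induction \<S> rule: finite_ne_induct) (simp_all add: lin complex_linear_subspace_Int)
    then show ?thesis using \<S>'(1) by simp
  qed
  show "F \<inter> G \<in> \<L>'" if FG: "F \<in> \<L>'" "G \<in> \<L>'" for F G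
  proof -
    obtain \<S> where S: "F = \<Inter>\<S>" "\<S> \<in> Pow \<L> - {{}}" using FG(1) unfolding \<L>'_def by (rule imageE)
    obtain \<T> where T: "G = \<Inter>\<T>" "\<T> \<in> Pow \<L> - {{}}" using FG(2) unfolding \<L>'_def by (rule imageE)
    have "F \<inter> G = \<Inter>(\<S> \<union> \<T>)" unfolding S(1) T(1) by (rule Inter_Un_distrib[symmetric])
    moreover have "\<S> \<union> \<T> \<in> Pow \<L> - {{}}" using S(2) T(2) by simp
    ultimately show ?thesis unfolding \<L>'_def by (rule image_eqI)
  qed
  show "\<Union>\<L>' = \<Union>\<L>"
  proof
    show "\<Union>\<L>' \<subseteq> \<Union>\<L>" by (auto simp: \<L>'_def)
    show "\<Union>\<L> \<subseteq> \<Union>\<L>'"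
    proof
      fix z assume "z \<in> \<Union>\<L>"
      then obtain L where L: "L \<in> \<L>" "z \<in> L" by blast
      then have "L \<in> \<L>'" unfolding \<L>'_def by (intro image_eqI[of _ _ "{L}"]) auto
      then show "z \<in> \<Union>\<L>'" using L by blast
    qed
  qed
qed

text \<open>Any enumeration of the intersection-closed family will do, since every retraction
  preserves every flat.\<close>

proposition compact_current_arrangement_decomposition:
  assumes fin: "finite \<L>" and lin: "\<And>L. L \<in> \<L> \<Longrightarrow> complex_linear_subspace n L"
    and Q: "compact_current (submetric (cspace n) (\<Union>\<L>)) m Q"
  obtains k :: nat and L r S where
    "\<And>j. j < k \<Longrightarrow> complex_linear_subspace n (L j)" "\<And>j. j < k \<Longrightarrow> L j \<subseteq> \<Union>\<L>"
    "\<And>j. j < k \<Longrightarrow> Lipschitz_continuous_map (submetric (cspace n) (\<Union>\<L>)) (submetric (cspace n) (\<Union>\<L>)) (r j)"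
    "\<And>j z. \<lbrakk>j < k; z \<in> \<Union>\<L>\<rbrakk> \<Longrightarrow> r j z \<in> L j"
    "\<And>j. j < k \<Longrightarrow> compact_current (submetric (cspace n) (\<Union>\<L>)) m (S j)"
    "\<And>f \<pi>. \<lbrakk>f \<in> Lip_loc (submetric (cspace n) (\<Union>\<L>)); \<And>i. i < m \<Longrightarrow> \<pi> i \<in> Lip_loc (submetric (cspace n) (\<Union>\<L>))\<rbrakk> \<Longrightarrow>
       Q f \<pi> = (\<Sum>j<k. S j (f \<circ> r j) (\<lambda>i. \<pi> i \<circ> r j))"
proof -
  obtain \<L>' where \<L>': "finite \<L>'" "\<And>L. L \<in> \<L>' \<Longrightarrow> complex_linear_subspace n L"
    "\<And>F G. \<lbrakk>F \<in> \<L>'; G \<in> \<L>'\<rbrakk> \<Longrightarrow> F \<inter> G \<in> \<L>'" "\<Union>\<L>' = \<Union>\<L>"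
    by (rule intersection_closed_arrangement[OF fin lin]) blast+
  define M where "M = submetric (cspace n) (\<Union>\<L>)"
  define k where "k = card \<L>'"
  obtain L where L: "bij_betw L {..<k} \<L>'"
    using ex_bij_betw_nat_finite[OF \<L>'(1)] by (auto simp: k_def atLeast0LessThan)
  have LL: "L j \<in> \<L>'" if "j < k" for j using L that by (auto simp: bij_betw_def)
  have MY: "mspace M = \<Union>\<L>"
    using complex_linear_subspace_mspace[OF lin] by (auto simp: M_def)
  have "\<forall>j\<in>{..<k}. \<exists>r. Lipschitz_continuous_map M M r \<and> (\<forall>x\<in>mspace M. r x \<in> L j) \<and> (\<forall>x\<in>L j. r x = x) \<and>
      (\<forall>F\<in>\<L>'. \<forall>x\<in>F. r x \<in> F)"
  proof
    fix j assume "j \<in> {..<k}"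
    then have j: "L j \<in> \<L>'" using LL by simp
    show "\<exists>r. Lipschitz_continuous_map M M r \<and> (\<forall>x\<in>mspace M. r x \<in> L j) \<and> (\<forall>x\<in>L j. r x = x) \<and>
        (\<forall>F\<in>\<L>'. \<forall>x\<in>F. r x \<in> F)"
    proof (rule subspace_arrangement_retraction[OF \<L>'(1,2,3) j])
      fix r assume "Lipschitz_continuous_map (submetric (cspace n) (\<Union>\<L>')) (submetric (cspace n) (\<Union>\<L>')) r"
        "\<And>x. x \<in> \<Union>\<L>' \<Longrightarrow> r x \<in> L j" "\<And>x. x \<in> L j \<Longrightarrow> r x = x" "\<And>F x. \<lbrakk>F \<in> \<L>'; x \<in> F\<rbrakk> \<Longrightarrow> r x \<in> F"
      then show ?thesis unfolding MY \<L>'(4) M_def[symmetric] by (intro exI[of _ r] conjI ballI)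
    qed
  qed
  then obtain r where r': "\<forall>j\<in>{..<k}. Lipschitz_continuous_map M M (r j) \<and> (\<forall>x\<in>mspace M. r j x \<in> L j) \<and>
      (\<forall>x\<in>L j. r j x = x) \<and> (\<forall>F\<in>\<L>'. \<forall>x\<in>F. r j x \<in> F)"
    by (rule bchoice[THEN exE])
  then have r: "\<And>j. j < k \<Longrightarrow> Lipschitz_continuous_map M M (r j)"
    "\<And>j x. \<lbrakk>j < k; x \<in> mspace M\<rbrakk> \<Longrightarrow> r j x \<in> L j" "\<And>j x. \<lbrakk>j < k; x \<in> L j\<rbrakk> \<Longrightarrow> r j x = x"
    "\<And>j F x. \<lbrakk>j < k; F \<in> \<L>'; x \<in> F\<rbrakk> \<Longrightarrow> r j x \<in> F"
    by simp_all
  have Lsub: "L j \<subseteq> \<Union>\<L>" if "j < k" for j using LL[OF that] \<L>'(4) by blast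
  have "\<Union>\<L> \<subseteq> (\<Union>j<k. L j)" using L \<L>'(4) by (auto simp: bij_betw_def)
  then have cover: "mspace M \<subseteq> (\<Union>j<k. L j)" by (simp add: MY)
  have QM: "compact_current M m Q" using Q by (simp add: M_def)
  have LM: "L j \<subseteq> mspace M" if "j < k" for j using Lsub[OF that] MY by simp
  have into: "r j x \<in> L i" if "i < k" "j < k" "x \<in> L i" for i j x by (rule r(4)[OF that(2) LL[OF that(1)] that(3)])
  show thesis
  proof (rule compact_current_decomposition[OF QM r(1) LM cover r(3) into])
    fix S assume S: "\<And>j. j < k \<Longrightarrow> compact_current M m (S j)"
      "\<And>f \<pi>. \<lbrakk>f \<in> Lip_loc M; \<And>i. i < m \<Longrightarrow> \<pi> i \<in> Lip_loc M\<rbrakk> \<Longrightarrow>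
         Q f \<pi> = (\<Sum>j<k. S j (f \<circ> r j) (\<lambda>i. \<pi> i \<circ> r j))"
    show thesis
    proof (rule that[of k L r S, folded M_def])
      show "complex_linear_subspace n (L j)" if "j < k" for j by (rule \<L>'(2)[OF LL[OF that]])
      show "L j \<subseteq> \<Union>\<L>" if "j < k" for j by (rule Lsub[OF that])
      show "Lipschitz_continuous_map M M (r j)" if "j < k" for j by (rule r(1)[OF that])
      show "r j z \<in> L j" if "j < k" "z \<in> \<Union>\<L>" for j z by (rule r(2)[OF that(1)]) (use that(2) MY in simp)
      show "compact_current M m (S j)" if "j < k" for j by (rule S(1)[OF that])
      show "Q f \<pi> = (\<Sum>j<k. S j (f \<circ> r j) (\<lambda>i. \<pi> i \<circ> r j))"
        if "f \<in> Lip_loc M" "\<And>i. i < m \<Longrightarrow> \<pi> i \<in> Lip_loc M" for f \<pi> by (rule S(2)[OF that])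
    qed
  qed
qed

text \<open>
  The hypothesis on the distance applies to this chart because a union of linear subspaces is an
  analytic set.
\<close>

lemma chart_onto_subspace_arrangement:
  fixes X :: "'a metric"
  assumes sheaf: "function_sheaf (mtopology_of X) \<O>" and cm: "compatible_metric X \<O>"
    and lus: "locally_union_of_subspaces (mtopology_of X) \<O>"
    and \<Omega>: "openin (mtopology_of X) \<Omega>" and x: "x \<in> \<Omega>"
  obtains n \<L> \<phi> k R C G where "finite \<L>" "\<And>L. L \<in> \<L> \<Longrightarrow> complex_linear_subspace n L"
    "openin (mtopology_of X) G" "x \<in> G" "G \<subseteq> \<Omega>" "0 < R" "0 \<le> C"
    "\<And>y. y \<in> G \<Longrightarrow> \<phi> y \<in> \<Union>\<L>" "\<And>y. y \<in> G \<Longrightarrow> k (\<phi> y) = y"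
    "\<And>y z. \<lbrakk>y \<in> G; z \<in> G\<rbrakk> \<Longrightarrow> mdist (cspace n) (\<phi> y) (\<phi> z) \<le> C * mdist X y z"
    "\<And>z. \<lbrakk>z \<in> \<Union>\<L>; mdist (cspace n) z (\<phi> x) < R\<rbrakk> \<Longrightarrow> k z \<in> G"
    "\<And>z w. \<lbrakk>z \<in> \<Union>\<L>; w \<in> \<Union>\<L>; mdist (cspace n) z (\<phi> x) < R; mdist (cspace n) w (\<phi> x) < R\<rbrakk> \<Longrightarrow>
      mdist X (k z) (k w) \<le> C * mdist (cspace n) z w"
    "\<And>W f. \<lbrakk>openin (subtopology (mtopology_of X) \<Omega>) W; f \<in> \<O> W\<rbrakk> \<Longrightarrow>
      f \<circ> k \<in> holo n {z \<in> \<Union>\<L>. mdist (cspace n) z (\<phi> x) < R \<and> k z \<in> W}"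
proof -
  let ?\<tau> = "mtopology_of X"
  have xX: "x \<in> topspace ?\<tau>" using openin_subset[OF \<Omega>] x by blast
  obtain U n \<L> B \<phi> where U: "openin ?\<tau> U" "x \<in> U" and fin: "finite \<L>"
    and lin: "\<And>L. L \<in> \<L> \<Longrightarrow> complex_linear_subspace n L"
    and B: "openin (subtopology (ctop n) (\<Union>\<L>)) B"
    and bi: "biholomorphic_map (subtopology ?\<tau> U) \<O> (subtopology (ctop n) B) (holo n) \<phi>"
    using lus xX unfolding locally_union_of_subspaces_def by metis
  define Y where "Y = \<Union>\<L>"
  have Y: "Y \<subseteq> mspace (cspace n)" using complex_linear_subspace_mspace[OF lin] by (auto simp: Y_def)
  obtain D where D: "openin (ctop n) D" "B = D \<inter> Y" using B unfolding openin_subtopology Y_def by blast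
  have emb: "local_embedding ?\<tau> \<O> U n \<phi>"
  proof -
    have "analytic_subset n D B"
      unfolding D(2) Y_def by (rule analytic_subset_zero_locus[OF D(1) zero_locus_Union_subspaces[OF fin lin]])
    with U(1) D(1) bi show ?thesis unfolding local_embedding_def by blast
  qed
  obtain W C0 where W: "openin ?\<tau> W" "x \<in> W" "W \<subseteq> U"
    and C0: "\<And>y z. \<lbrakk>y \<in> W; z \<in> W\<rbrakk> \<Longrightarrow> mdist (cspace n) (\<phi> y) (\<phi> z) \<le> C0 * mdist X y z"
      "\<And>y z. \<lbrakk>y \<in> W; z \<in> W\<rbrakk> \<Longrightarrow> mdist X y z \<le> C0 * mdist (cspace n) (\<phi> y) (\<phi> z)"
    using cm emb U(2) unfolding compatible_metric_def by metis
  \<comment> \<open>The absolute value supplies a nonnegative constant, with which estimates can be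
    chained.\<close>
  define C where "C = \<bar>C0\<bar>"
  have C_ge: "C0 * t \<le> C * t" if "0 \<le> t" for t using that by (auto simp: C_def intro: mult_right_mono)
  have UX: "U \<subseteq> mspace X" using openin_subset[OF U(1)] by simp
  have BM: "B \<subseteq> mspace (cspace n)" using D(2) Y by auto
  obtain k where hk: "holomorphic_map (subtopology (ctop n) B) (holo n) (subtopology ?\<tau> U) \<O> k"
    and h\<phi>: "holomorphic_map (subtopology ?\<tau> U) \<O> (subtopology (ctop n) B) (holo n) \<phi>"
    and k\<phi>: "\<And>y. y \<in> U \<Longrightarrow> k (\<phi> y) = y" and \<phi>k: "\<And>z. z \<in> B \<Longrightarrow> \<phi> (k z) = z"
    using bi UX BM unfolding biholomorphic_map_def by (auto simp: Int_absorb1)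
  have \<phi>B: "\<phi> y \<in> B" if "y \<in> U" for y
  proof -
    have "continuous_map (subtopology ?\<tau> U) (subtopology (ctop n) B) \<phi>"
      using h\<phi> unfolding holomorphic_map_def by blast
    then have "\<phi> \<in> topspace (subtopology ?\<tau> U) \<rightarrow> topspace (subtopology (ctop n) B)"
      by (rule continuous_map_funspace)
    then show ?thesis using that UX by auto
  qed
  have kcont: "continuous_map (subtopology (ctop n) B) (subtopology ?\<tau> U) k"
    using hk unfolding holomorphic_map_def by blast
  define G where "G = W \<inter> \<Omega>"
  have G: "openin ?\<tau> G" unfolding G_def using W(1) \<Omega> by (rule openin_Int)
  have GU: "G \<subseteq> U" using W(3) by (auto simp: G_def)
  have "openin (subtopology ?\<tau> U) G" using G GU U(1) by (simp add: openin_open_subtopology)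
  from openin_continuous_map_preimage[OF kcont this]
  have "openin (subtopology (ctop n) B) {z \<in> B. k z \<in> G}" using BM by (simp add: Int_absorb1)
  moreover have "subtopology (ctop n) B = subtopology (subtopology (ctop n) Y) B"
    using D(2) by (simp add: subtopology_subtopology Int_absorb1)
  \<comment> \<open>\<open>k\<close> is continuous for the relative topology of \<open>B\<close>.
    Since \<open>B\<close> is open in \<open>Y\<close>, the preimage of \<open>G\<close> is open in
    \<open>Y\<close> and contains a ball of \<open>Y\<close> around \<open>\<phi> x\<close>.\<close>
  ultimately have "openin (subtopology (ctop n) Y) {z \<in> B. k z \<in> G}"
    using B unfolding Y_def[symmetric] by (metis openin_trans_full)
  then have "openin (mtopology_of (submetric (cspace n) Y)) {z \<in> B. k z \<in> G}"
    by (simp add: mtopology_of_submetric)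
  then have open_kG: "openin (Metric_space.mtopology (mspace (submetric (cspace n) Y)) (mdist (submetric (cspace n) Y))) {z \<in> B. k z \<in> G}"
    by (simp add: mtopology_of_def)
  have b: "\<phi> x \<in> {z \<in> B. k z \<in> G}" using \<phi>B k\<phi> U(2) W(2) x by (simp add: G_def)
  interpret N: Metric_space "mspace (submetric (cspace n) Y)" "mdist (submetric (cspace n) Y)" by (rule Metric_space_mspace_mdist)
  obtain R where R: "0 < R" "N.mball (\<phi> x) R \<subseteq> {z \<in> B. k z \<in> G}"
    using open_kG b unfolding N.openin_mtopology by blast
  have bY: "\<phi> x \<in> Y" using b D(2) by auto
  have kG: "z \<in> B" "k z \<in> G" if "z \<in> Y" "mdist (cspace n) z (\<phi> x) < R" for z
  proof -
    have "z \<in> N.mball (\<phi> x) R" 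
      unfolding N.in_mball using that bY Y N.commute[of z "\<phi> x"] by auto
    then show "z \<in> B" "k z \<in> G" using R(2) by auto
  qed
  show thesis
  proof (rule that[of \<L> n G R C \<phi> k])
    show "finite \<L>" "\<And>L. L \<in> \<L> \<Longrightarrow> complex_linear_subspace n L" by (fact fin lin)+
    show "openin ?\<tau> G" "0 < R" by (fact G R(1))+
    show "x \<in> G" "G \<subseteq> \<Omega>" using W(2) x by (auto simp: G_def)
    show "0 \<le> C" by (simp add: C_def)
    show "\<phi> y \<in> \<Union>\<L>" if "y \<in> G" for y using \<phi>B[of y] that GU D(2) by (auto simp: Y_def)
    show "k (\<phi> y) = y" if "y \<in> G" for y using k\<phi> that GU by blast
    show "mdist (cspace n) (\<phi> y) (\<phi> z) \<le> C * mdist X y z" if "y \<in> G" "z \<in> G" for y z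
      using C0(1)[of y z] C_ge[of "mdist X y z"] that by (simp add: G_def)
    show "k z \<in> G" if "z \<in> \<Union>\<L>" "mdist (cspace n) z (\<phi> x) < R" for z
      using kG(2) that unfolding Y_def by blast
    show "mdist X (k z) (k w) \<le> C * mdist (cspace n) z w"
      if "z \<in> \<Union>\<L>" "w \<in> \<Union>\<L>" "mdist (cspace n) z (\<phi> x) < R" "mdist (cspace n) w (\<phi> x) < R" for z w
    proof -
      have *: "z \<in> B" "w \<in> B" "k z \<in> W" "k w \<in> W"
        using kG[of z] kG[of w] that unfolding Y_def G_def by blast+
      then have "mdist X (k z) (k w) \<le> C0 * mdist (cspace n) z w"
        using C0(2)[of "k z" "k w"] \<phi>k by simp
      then show ?thesis using C_ge[of "mdist (cspace n) z w"] by simp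
    qed
    fix W' f assume W': "openin (subtopology ?\<tau> \<Omega>) W'" "f \<in> \<O> W'"
    have oW': "openin ?\<tau> W'" using W'(1) \<Omega> by (simp add: openin_open_subtopology)
    \<comment> \<open>As \<open>k\<close> is a holomorphic map into \<open>U\<close>, the section is
      first restricted to \<open>W' \<inter> U\<close>. On the ball \<open>k\<close> takes values in
      \<open>G\<close>, hence in \<open>U\<close>, so nothing is lost.\<close>
    have oWU: "openin ?\<tau> (W' \<inter> U)" by (rule openin_Int[OF oW' U(1)])
    then have "f \<in> \<O> (W' \<inter> U)" using sheaf oW' W'(2) unfolding function_sheaf_def by blast
    moreover have "openin (subtopology ?\<tau> U) (W' \<inter> U)" using oWU U(1) by (simp add: openin_open_subtopology)
    ultimately have "f \<circ> k \<in> holo n {z \<in> topspace (subtopology (ctop n) B). k z \<in> W' \<inter> U}"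
      using hk unfolding holomorphic_map_def by blast
    moreover have "{z \<in> \<Union>\<L>. mdist (cspace n) z (\<phi> x) < R \<and> k z \<in> W'}
        \<subseteq> {z \<in> topspace (subtopology (ctop n) B). k z \<in> W' \<inter> U}"
      using kG GU BM unfolding Y_def[symmetric] by auto
    ultimately show "f \<circ> k \<in> holo n {z \<in> \<Union>\<L>. mdist (cspace n) z (\<phi> x) < R \<and> k z \<in> W'}"
      unfolding holo_def by blast
  qed
qed


section \<open>Decomposition of currents\<close>

theorem proposition4p1p1:
  fixes X :: "'a metric"
    and \<O> :: "'a set \<Rightarrow> ('a \<Rightarrow> complex) set"
    and \<Omega> :: "'a set"
    and m :: nat
    and T :: "('a \<Rightarrow> complex) \<Rightarrow> (nat \<Rightarrow> 'a \<Rightarrow> complex) \<Rightarrow> complex"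
  assumes "reduced_complex_space (mtopology_of X) \<O>"
    and "compatible_metric X \<O>"
    and "locally_union_of_subspaces (mtopology_of X) \<O>"
    and "openin (mtopology_of X) \<Omega>"
    and "local_current (submetric X \<Omega>) m T"
  shows "\<forall>x\<in>\<Omega>. \<exists>\<omega>. openin (mtopology_of X) \<omega> \<and> x \<in> \<omega> \<and>
    compactin (mtopology_of X) (mtopology_of X closure_of \<omega>) \<and>
    mtopology_of X closure_of \<omega> \<subseteq> \<Omega> \<and>
    (\<exists>(k :: nat) (n :: nat \<Rightarrow> nat) (V :: nat \<Rightarrow> (nat \<Rightarrow> complex) set)
       (h :: nat \<Rightarrow> (nat \<Rightarrow> complex) \<Rightarrow> 'a)
       (S :: nat \<Rightarrow> ((nat \<Rightarrow> complex) \<Rightarrow> complex) \<Rightarrow> (nat \<Rightarrow> (nat \<Rightarrow> complex) \<Rightarrow> complex) \<Rightarrow> complex).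
       (\<forall>i<k. openin (ctop (n i)) (V i) \<and>
          holomorphic_map (subtopology (ctop (n i)) (V i)) (holo (n i))
            (subtopology (mtopology_of X) \<Omega>) \<O> (h i) \<and>
          locally_Lipschitz (submetric (cspace (n i)) (V i)) (submetric X \<Omega>) (h i) \<and>
          local_current (submetric (cspace (n i)) (V i)) m (S i) \<and>
          proper_map (subtopology (ctop (n i)) (csupp (submetric (cspace (n i)) (V i)) m (S i)))
            (subtopology (mtopology_of X) \<Omega>) (h i)) \<and>
       (let R = (\<lambda>f \<pi>. T f \<pi> - (\<Sum>i<k. pushforward (submetric (cspace (n i)) (V i)) m (h i) (S i) f \<pi>))
        in local_current (submetric X \<Omega>) m R \<and>
           csupp (submetric X \<Omega>) m R \<inter> mtopology_of X closure_of \<omega> = {}))"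
proof
  fix x assume x: "x \<in> \<Omega>"
  let ?\<tau> = "mtopology_of X"
  note \<Omega> = assms(4) and T = assms(5)
  have \<Omega>X: "\<Omega> \<subseteq> mspace X" using openin_subset[OF \<Omega>] by simp
  have sheaf: "function_sheaf ?\<tau> \<O>" using assms(1) by (simp add: reduced_complex_space_def)
  obtain n \<L> \<phi> k R C G where fin: "finite \<L>" and lin: "\<And>L. L \<in> \<L> \<Longrightarrow> complex_linear_subspace n L"
    and G: "openin ?\<tau> G" "x \<in> G" "G \<subseteq> \<Omega>" and R: "0 < R" and C: "0 \<le> C"
    and \<phi>: "\<And>y. y \<in> G \<Longrightarrow> \<phi> y \<in> \<Union>\<L>" "\<And>y. y \<in> G \<Longrightarrow> k (\<phi> y) = y"
      "\<And>y z. \<lbrakk>y \<in> G; z \<in> G\<rbrakk> \<Longrightarrow> mdist (cspace n) (\<phi> y) (\<phi> z) \<le> C * mdist X y z"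
    and kG: "\<And>z. \<lbrakk>z \<in> \<Union>\<L>; mdist (cspace n) z (\<phi> x) < R\<rbrakk> \<Longrightarrow> k z \<in> G"
    and kLip: "\<And>z w. \<lbrakk>z \<in> \<Union>\<L>; w \<in> \<Union>\<L>; mdist (cspace n) z (\<phi> x) < R; mdist (cspace n) w (\<phi> x) < R\<rbrakk> \<Longrightarrow>
      mdist X (k z) (k w) \<le> C * mdist (cspace n) z w"
    and kholo: "\<And>W f. \<lbrakk>openin (subtopology ?\<tau> \<Omega>) W; f \<in> \<O> W\<rbrakk> \<Longrightarrow>
      f \<circ> k \<in> holo n {z \<in> \<Union>\<L>. mdist (cspace n) z (\<phi> x) < R \<and> k z \<in> W}"
    by (rule chart_onto_subspace_arrangement[OF sheaf assms(2,3) \<Omega> x]) (rule that)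
  define Y where "Y = \<Union>\<L>"
  define N where "N = submetric (cspace n) Y"
  define Z where "Z = submetric X \<Omega>"
  define b where "b = \<phi> x"
  have Y: "Y \<subseteq> mspace (cspace n)" using complex_linear_subspace_mspace[OF lin] by (auto simp: Y_def)
  have NM: "mspace N = Y" and Nd: "mdist N = mdist (cspace n)" using Y by (auto simp: N_def)
  have ZM: "mspace Z = \<Omega>" and Zd: "mdist Z = mdist X" using \<Omega>X by (auto simp: Z_def)
  have Ztop: "mtopology_of Z = subtopology ?\<tau> \<Omega>" by (simp add: Z_def mtopology_of_submetric)
  have TZ: "local_current Z m T" using T by (simp add: Z_def)
  have xX: "x \<in> mspace X" using x \<Omega>X by blast
  have bY: "b \<in> Y" using \<phi>(1)[OF G(2)] by (simp add: b_def Y_def)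
  have bM: "b \<in> mspace (cspace n)" using bY Y by blast
  define s where "s i = real i * R / 5" for i :: nat
  have s: "s i < s j" if "i < j" for i j using that R by (simp add: s_def divide_strict_right_mono)
  have s': "s 1 < s 2" "s 2 < s 4" "s 3 < s 4" "s 1 < s 3" by (simp_all add: s)
  have s4: "s 4 < R" using R by (simp add: s_def)
  have normN: "\<bar>mdist (cspace n) z b - mdist (cspace n) w b\<bar> \<le> 1 * mdist N z w"
    if "z \<in> mspace N" "w \<in> mspace N" for z w
    using mdist_Lipschitz[OF bM, of z w] that Y by (auto simp: NM Nd)
  have normZ: "\<bar>mdist X y x - mdist X z x\<bar> \<le> 1 * mdist Z y z" if "y \<in> mspace Z" "z \<in> mspace Z" for y z
    using mdist_Lipschitz[OF xX, of y z] that \<Omega>X by (auto simp: ZM Zd)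
  have normX: "\<bar>mdist X y x - mdist X z x\<bar> \<le> 1 * mdist X y z" if "y \<in> mspace X" "z \<in> mspace X" for y z
    using mdist_Lipschitz[OF xX that] by simp

  interpret X: Metric_space "mspace X" "mdist X" by (rule Metric_space_mspace_mdist)
  obtain e where e: "0 < e" "X.mball x e \<subseteq> G"
    using G(1,2) unfolding mtopology_of_def X.openin_mtopology by blast
  \<comment> \<open>This is the unit for all radii around \<open>x\<close>. The ball of radius
    \<open>5 * t\<close> lies in \<open>G\<close>, and \<open>\<phi>\<close> maps it to within
    \<open>s 1\<close> of \<open>b\<close>, where the cut-offs in the chart are 1. The denominator
    has \<open>C + 1\<close> to cover \<open>C = 0\<close>.\<close>
  define t where "t = min (e / 6) (R / (30 * (C + 1)))"
  have t: "0 < t" "5 * t < e" using e R C by (auto simp: t_def)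
  have Ct: "C * (5 * t) \<le> s 1"
  proof -
    have "C * (5 * t) \<le> (C + 1) * (5 * (R / (30 * (C + 1))))"
      using C R t by (intro mult_mono) (auto simp: t_def)
    also have "\<dots> = R / 6" using C by (simp add: field_simps)
    also have "\<dots> \<le> s 1" using R by (simp add: s_def)
    finally show ?thesis .
  qed
  have nearG: "y \<in> G" if "y \<in> mspace X" "mdist X y x \<le> 5 * t" for y
  proof -
    have "y \<in> X.mball x e" unfolding X.in_mball using that xX t(2) X.commute[of x y] by simp
    then show ?thesis using e(2) by blast
  qed
  have near: "mdist (cspace n) (\<phi> y) b \<le> s 1" if "y \<in> mspace X" "mdist X y x \<le> 5 * t" for y
  proof -
    have "mdist (cspace n) (\<phi> y) b \<le> C * mdist X y x"
      unfolding b_def by (rule \<phi>(3)[OF nearG[OF that] G(2)])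
    also have "\<dots> \<le> C * (5 * t)" using that(2) C by (rule mult_left_mono)
    finally show ?thesis using Ct by linarith
  qed

  \<comment> \<open>Compactness in \<open>X\<close> is imported from the chart: \<open>E\<close> is
    closed and bounded, so its image under \<open>k\<close> is compact, and the small closed balls
    around \<open>x\<close> are closed subsets of that image.\<close>
  define E where "E = {z \<in> mspace N. mdist (cspace n) z b \<le> s 4}"
  have Ecpt: "compactin (mtopology_of N) E"
  proof -
    have "closedin (ctop n) Y" unfolding Y_def
      by (rule closedin_Union[OF fin]) (rule closedin_complex_linear_subspace[OF lin])
    moreover have "closedin (ctop n) {z \<in> mspace (cspace n). mdist (cspace n) z b \<le> s 4}"
      by (rule closedin_sublevel[of "cspace n" "\<lambda>z. mdist (cspace n) z b" 1]) (simp_all add: mdist_Lipschitz[OF bM])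
    ultimately have "closedin (ctop n) (Y \<inter> {z \<in> mspace (cspace n). mdist (cspace n) z b \<le> s 4})"
      by (rule closedin_Int)
    moreover have "E = Y \<inter> {z \<in> mspace (cspace n). mdist (cspace n) z b \<le> s 4}"
      using Y by (auto simp: E_def NM)
    ultimately have "compactin (ctop n) E"
      by (intro compactin_cspace_bounded[where b = b and R = "s 4"]) auto
    then show ?thesis by (auto simp: N_def mtopology_of_submetric compactin_subtopology E_def)
  qed
  have kE: "compactin (mtopology_of Z) (k ` E)"
  proof -
    have "Lipschitz_continuous_map (submetric N E) Z k"
      unfolding Lipschitz_continuous_map_def
    proof (intro conjI exI[of _ C] Pi_I ballI)
      show "k z \<in> mspace Z" if "z \<in> mspace (submetric N E)" for z
        using kG[of z] that G(3) s4 by (auto simp: ZM E_def NM Y_def b_def)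
      show "mdist Z (k z) (k w) \<le> C * mdist (submetric N E) z w"
        if "z \<in> mspace (submetric N E)" "w \<in> mspace (submetric N E)" for z w
        using kLip[of z w] that s4 by (simp add: Zd Nd E_def NM Y_def b_def)
    qed
    then have "continuous_map (subtopology (mtopology_of N) E) (mtopology_of Z) k"
      using Lipschitz_continuous_imp_continuous_map mtopology_of_submetric by metis
    moreover have "compactin (subtopology (mtopology_of N) E) E" using Ecpt by (simp add: compactin_subtopology)
    ultimately show ?thesis by (rule image_compactin[rotated])
  qed
  have ball_sub: "{y \<in> mspace X. mdist X y x \<le> c} \<subseteq> k ` E" if "c \<le> 5 * t" for c
  proof
    fix y assume "y \<in> {y \<in> mspace X. mdist X y x \<le> c}"
    then have y: "y \<in> mspace X" "mdist X y x \<le> 5 * t" using that by auto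
    have "\<phi> y \<in> E" using \<phi>(1)[OF nearG[OF y]] near[OF y] s' by (simp add: E_def NM Y_def)
    moreover have "y = k (\<phi> y)" using \<phi>(2)[OF nearG[OF y]] by simp
    ultimately show "y \<in> k ` E" by blast
  qed
  have ball_cpt: "compactin (mtopology_of Z) {y \<in> mspace Z. mdist X y x \<le> c}" if "c \<le> 5 * t" for c
  proof (rule closed_compactin[OF kE])
    show "{y \<in> mspace Z. mdist X y x \<le> c} \<subseteq> k ` E" using ball_sub[OF that] \<Omega>X ZM by blast
    show "closedin (mtopology_of Z) {y \<in> mspace Z. mdist X y x \<le> c}"
      by (rule closedin_sublevel[OF normZ]) auto
  qed

  \<comment> \<open>\<open>\<eta>\<close> cuts off the current, while \<open>\<theta>1\<close> and
    \<open>\<theta>2\<close> turn functions on the chart into functions on all of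
    \<open>\<Omega>\<close>. Each is 1 wherever the preceding one is nonzero, and the gap of width
    \<open>t\<close> between \<open>\<theta>1\<close> and \<open>\<theta>2\<close> leaves room for
    the open set that locality requires.\<close>
  define \<eta> where "\<eta> = (\<lambda>y. complex_of_real (plateau t (2 * t) (mdist X y x)))"
  define \<theta>1 where "\<theta>1 = (\<lambda>y. complex_of_real (plateau (2 * t) (3 * t) (mdist X y x)))"
  define \<theta>2 where "\<theta>2 = (\<lambda>y. complex_of_real (plateau (4 * t) (5 * t) (mdist X y x)))"
  have \<eta>: "\<eta> \<in> test_functions Z" "fsupp Z \<eta> \<subseteq> {y \<in> mspace Z. mdist X y x \<le> 2 * t}"
    unfolding \<eta>_def using plateau_test_function[OF normZ _ _ ball_cpt, of t "2 * t"] t by simp_all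
  have locZ: "localised_map Z N {y \<in> mspace Z. mdist X y x \<le> d} \<phi> (\<lambda>y. complex_of_real (plateau c d (mdist X y x)))"
    if "c < d" "d \<le> 5 * t" for c d
  proof (rule localised_map_plateau[OF normZ _ that(1) Ecpt])
    fix y assume "y \<in> mspace Z" "mdist X y x \<le> d"
    then have y: "y \<in> mspace X" "mdist X y x \<le> 5 * t" using that \<Omega>X ZM by auto
    show "\<phi> y \<in> E" using \<phi>(1)[OF nearG[OF y]] near[OF y] s' by (simp add: E_def NM Y_def)
  next
    fix y z assume "y \<in> mspace Z" "z \<in> mspace Z" "mdist X y x \<le> d" "mdist X z x \<le> d"
    then have "y \<in> G" "z \<in> G" using that \<Omega>X ZM by (auto intro!: nearG)
    then show "mdist N (\<phi> y) (\<phi> z) \<le> C * mdist Z y z" using \<phi>(3) by (simp add: Nd Zd)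
  qed simp_all
  have loc1: "localised_map Z N {y \<in> mspace Z. mdist X y x \<le> 3 * t} \<phi> \<theta>1"
    and loc2: "localised_map Z N {y \<in> mspace Z. mdist X y x \<le> 5 * t} \<phi> \<theta>2"
    unfolding \<theta>1_def \<theta>2_def using t by (intro locZ; simp)+
  \<comment> \<open>This is the push-forward under the chart of \<open>T\<close> multiplied by
    \<open>\<eta>\<close>.\<close>
  define Q where "Q = (\<lambda>f \<pi>. T (\<lambda>y. \<eta> y * (\<theta>1 y * f (\<phi> y))) (\<lambda>i y. \<theta>2 y * \<pi> i (\<phi> y)))"
  have Q: "compact_current N m Q"
    unfolding Q_def
  proof (rule compact_current_transfer[OF compact_current_mult[OF TZ \<eta>(1)] loc1 loc2])
    show "closedin (mtopology_of Z) {y \<in> mspace Z. mdist X y x \<le> 3 * t}"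
      by (rule closedin_sublevel[OF normZ]) auto
    show "openin (mtopology_of Z) {y \<in> mspace Z. mdist X y x < 4 * t}"
      by (rule openin_sublevel[OF normZ]) auto
    show "\<theta>2 y = 1" if "y \<in> {y \<in> mspace Z. mdist X y x < 4 * t}" for y
      using that t plateau_eq_1[of "4 * t" "5 * t" "mdist X y x"] by (simp add: \<theta>2_def)
  qed (use t in auto)

  obtain K :: nat and L r S where L: "\<And>j. j < K \<Longrightarrow> complex_linear_subspace n (L j)" "\<And>j. j < K \<Longrightarrow> L j \<subseteq> Y"
    and r: "\<And>j. j < K \<Longrightarrow> Lipschitz_continuous_map N N (r j)" "\<And>j z. \<lbrakk>j < K; z \<in> Y\<rbrakk> \<Longrightarrow> r j z \<in> L j"
    and S: "\<And>j. j < K \<Longrightarrow> compact_current N m (S j)"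
    and QS: "\<And>f \<pi>. \<lbrakk>f \<in> Lip_loc N; \<And>i. i < m \<Longrightarrow> \<pi> i \<in> Lip_loc N\<rbrakk> \<Longrightarrow>
       Q f \<pi> = (\<Sum>j<K. S j (f \<circ> r j) (\<lambda>i. \<pi> i \<circ> r j))"
  proof (rule compact_current_arrangement_decomposition[OF fin lin Q[unfolded N_def Y_def], folded Y_def, folded N_def])
    fix K :: nat and L r S
    assume dec: "\<And>j. j < K \<Longrightarrow> complex_linear_subspace n (L j)" "\<And>j. j < K \<Longrightarrow> L j \<subseteq> Y"
      "\<And>j. j < K \<Longrightarrow> Lipschitz_continuous_map N N (r j)" "\<And>j z. \<lbrakk>j < K; z \<in> Y\<rbrakk> \<Longrightarrow> r j z \<in> L j"
      "\<And>j. j < K \<Longrightarrow> compact_current N m (S j)"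
      "\<And>f \<pi>. \<lbrakk>f \<in> Lip_loc N; \<And>i. i < m \<Longrightarrow> \<pi> i \<in> Lip_loc N\<rbrakk> \<Longrightarrow>
        Q f \<pi> = (\<Sum>j<K. S j (f \<circ> r j) (\<lambda>i. \<pi> i \<circ> r j))"
    show ?thesis
    proof (rule that[of K L r S])
      fix f \<pi> assume "f \<in> Lip_loc N" "\<And>i. i < m \<Longrightarrow> \<pi> i \<in> Lip_loc N"
      then show "Q f \<pi> = (\<Sum>j<K. S j (f \<circ> r j) (\<lambda>i. \<pi> i \<circ> r j))" by (rule dec(6))
    qed (rule dec; assumption)+
  qed

  define \<psi> where "\<psi> = (\<lambda>i j z. complex_of_real (plateau (s i) (s j) (mdist (cspace n) z b)))"
  \<comment> \<open>All requirements on one piece are gathered in one predicate, so that its four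
    data can be chosen for all \<open>j\<close> at once, as a quadruple.\<close>
  define piece where "piece j d V h S' \<longleftrightarrow> openin (ctop d) V \<and>
    holomorphic_map (subtopology (ctop d) V) (holo d) (mtopology_of Z) \<O> h \<and>
    locally_Lipschitz (submetric (cspace d) V) Z h \<and>
    local_current (submetric (cspace d) V) m S' \<and>
    proper_map (subtopology (ctop d) (csupp (submetric (cspace d) V) m S')) (mtopology_of Z) h \<and>
    (\<forall>f \<pi>. f \<in> Lip_loc Z \<longrightarrow> (\<forall>i<m. \<pi> i \<in> Lip_loc Z) \<longrightarrow>
      pushforward (submetric (cspace d) V) m h S' f \<pi> =
      S j ((\<lambda>z. \<psi> 1 2 z * f (k z)) \<circ> r j) (\<lambda>i. (\<lambda>z. \<psi> 3 4 z * \<pi> i (k z)) \<circ> r j))" for j d V h S'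
  have "\<forall>j\<in>{..<K}. \<exists>p. piece j (fst p) (fst (snd p)) (fst (snd (snd p))) (snd (snd (snd p)))"
  proof
    fix j assume "j \<in> {..<K}"
    then have j: "j < K" by simp
    show "\<exists>p. piece j (fst p) (fst (snd p)) (fst (snd (snd p))) (snd (snd (snd p)))"
    proof (rule current_on_subspace_as_pushforward[of n Y m "S j" "L j" "r j" b R k Z C \<O>])
      show "compact_current (submetric (cspace n) Y) m (S j)" using S[OF j] by (simp add: N_def)
      show "Y \<subseteq> mspace (cspace n)" "complex_linear_subspace n (L j)" "L j \<subseteq> Y" by (fact Y L(1)[OF j] L(2)[OF j])+
      show "Lipschitz_continuous_map (submetric (cspace n) Y) (submetric (cspace n) Y) (r j)"
        using r(1)[OF j] by (simp add: N_def)
      show "r j z \<in> L j" if "z \<in> Y" for z by (rule r(2)[OF j that])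
      show "b \<in> mspace (cspace n)" "0 < R" by (fact bM R)+
      show "k z \<in> mspace Z" if "z \<in> Y" "mdist (cspace n) z b < R" for z
        using kG[of z] that G(3) by (auto simp: ZM Y_def b_def)
      show "mdist Z (k z) (k w) \<le> C * mdist (cspace n) z w"
        if "z \<in> Y" "w \<in> Y" "mdist (cspace n) z b < R" "mdist (cspace n) w b < R" for z w
        using kLip[of z w] that by (simp add: Zd Y_def b_def)
      show "f \<circ> k \<in> holo n {z \<in> Y. mdist (cspace n) z b < R \<and> k z \<in> W}"
        if "openin (mtopology_of Z) W" "f \<in> \<O> W" for W f
        using kholo[of W f] that by (simp add: Ztop Y_def b_def)
    next
      fix d V h S'
      assume p: "openin (ctop d) V"
        "holomorphic_map (subtopology (ctop d) V) (holo d) (mtopology_of Z) \<O> h"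
        "locally_Lipschitz (submetric (cspace d) V) Z h"
        "local_current (submetric (cspace d) V) m S'"
        "proper_map (subtopology (ctop d) (csupp (submetric (cspace d) V) m S')) (mtopology_of Z) h"
        "\<And>f \<pi>. \<lbrakk>f \<in> Lip_loc Z; \<And>i. i < m \<Longrightarrow> \<pi> i \<in> Lip_loc Z\<rbrakk> \<Longrightarrow>
          pushforward (submetric (cspace d) V) m h S' f \<pi> =
          S j ((\<lambda>z. complex_of_real (plateau (real 1 * R / 5) (real 2 * R / 5) (mdist (cspace n) z b)) * f (k z)) \<circ> r j)
            (\<lambda>i. (\<lambda>z. complex_of_real (plateau (real 3 * R / 5) (real 4 * R / 5) (mdist (cspace n) z b)) * \<pi> i (k z)) \<circ> r j)"
      have "piece j d V h S'"
        unfolding piece_def \<psi>_def s_def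
      proof (intro conjI allI impI)
        fix f \<pi> assume "f \<in> Lip_loc Z" "\<forall>i<m. \<pi> i \<in> Lip_loc Z"
        then show "pushforward (submetric (cspace d) V) m h S' f \<pi> =
          S j ((\<lambda>z. complex_of_real (plateau (real 1 * R / 5) (real 2 * R / 5) (mdist (cspace n) z b)) * f (k z)) \<circ> r j)
            (\<lambda>i. (\<lambda>z. complex_of_real (plateau (real 3 * R / 5) (real 4 * R / 5) (mdist (cspace n) z b)) * \<pi> i (k z)) \<circ> r j)"
          by (intro p(6)) simp_all
      qed (fact p(1-5))+
      then show "\<exists>p. piece j (fst p) (fst (snd p)) (fst (snd (snd p))) (snd (snd (snd p)))"
        by (intro exI[of _ "(d, V, h, S')"]) simp
    qed
  qed
  then obtain p where p: "\<forall>j\<in>{..<K}. piece j (fst (p j)) (fst (snd (p j))) (fst (snd (snd (p j)))) (snd (snd (snd (p j))))"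
    by (rule bchoice[THEN exE])
  define d V h S' where "d j = fst (p j)" and "V j = fst (snd (p j))" and "h j = fst (snd (snd (p j)))"
    and "S' j = snd (snd (snd (p j)))" for j
  have piece: "piece j (d j) (V j) (h j) (S' j)" if "j < K" for j
    using p that by (simp add: d_def V_def h_def S'_def)

  have locN: "localised_map N Z {z \<in> mspace N. mdist (cspace n) z b \<le> s j} k (\<psi> i j)"
    if "i < j" "j \<le> 4" for i j
    unfolding \<psi>_def
  proof (rule localised_map_plateau[OF normN _ s[OF that(1)] kE])
    have sj: "s j \<le> s 4" using s that(2) by (cases "j = 4") (auto simp: less_imp_le)
    show "k z \<in> k ` E" if "z \<in> mspace N" "mdist (cspace n) z b \<le> s j" for z
      using that sj by (auto simp: E_def)
    show "mdist Z (k z) (k w) \<le> C * mdist N z w"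
      if "z \<in> mspace N" "w \<in> mspace N" "mdist (cspace n) z b \<le> s j" "mdist (cspace n) w b \<le> s j" for z w
      using kLip[of z w] that sj s4 by (simp add: Zd Nd NM Y_def b_def)
  qed simp_all
  have loc12: "localised_map N Z {z \<in> mspace N. mdist (cspace n) z b \<le> s 2} k (\<psi> 1 2)"
    and loc34: "localised_map N Z {z \<in> mspace N. mdist (cspace n) z b \<le> s 4} k (\<psi> 3 4)"
    by (rule locN; simp)+
  \<comment> \<open>The arguments are carried to the chart by \<open>k\<close>, decomposed there,
    and carried back by \<open>\<phi>\<close>. On the ball of radius \<open>5 * t\<close> the
    composition of \<open>\<phi>\<close> with \<open>k\<close> is the identity and the cut-offs in
    the chart are 1, so only the factor \<open>\<eta>\<close> remains.\<close>
  have sum_eq: "(\<Sum>j<K. pushforward (submetric (cspace (d j)) (V j)) m (h j) (S' j) f \<pi>) = T (\<lambda>y. \<eta> y * f y) \<pi>"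
    if f: "f \<in> test_functions Z" and \<pi>: "\<And>i. i < m \<Longrightarrow> \<pi> i \<in> Lip_loc Z" for f \<pi>
  proof -
    have fL: "f \<in> Lip_loc Z" by (rule test_functions_Lip_loc[OF f])
    define F where "F = (\<lambda>z. \<psi> 1 2 z * f (k z))"
    define P where "P = (\<lambda>i z. \<psi> 3 4 z * \<pi> i (k z))"
    have F: "F \<in> Lip_loc N" unfolding F_def by (rule localised_map_Lip_loc[OF loc12 fL])
    have P: "P i \<in> Lip_loc N" if "i < m" for i unfolding P_def by (rule localised_map_Lip_loc[OF loc34 \<pi>[OF that]])
    have "(\<Sum>j<K. pushforward (submetric (cspace (d j)) (V j)) m (h j) (S' j) f \<pi>)
        = (\<Sum>j<K. S j (F \<circ> r j) (\<lambda>i. P i \<circ> r j))"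
      using piece fL \<pi> unfolding piece_def F_def P_def by (intro sum.cong) auto
    also have "\<dots> = Q F P" by (rule QS[symmetric, OF F P])
    also have "\<dots> = T (\<lambda>y. \<eta> y * (\<theta>1 y * F (\<phi> y))) (\<lambda>i y. \<theta>2 y * P i (\<phi> y))" by (simp add: Q_def)
    also have "\<dots> = T (\<lambda>y. \<eta> y * f y) \<pi>"
    proof -
      have \<theta>P: "(\<lambda>y. \<theta>2 y * P i (\<phi> y)) \<in> Lip_loc Z" if "i < m" for i
        by (rule localised_map_Lip_loc[OF loc2 P[OF that]])
      have \<theta>F: "(\<lambda>y. \<eta> y * (\<theta>1 y * F (\<phi> y))) \<in> test_functions Z"
        by (rule test_functions_mult[OF \<eta>(1) localised_map_Lip_loc[OF loc1 F]])
      have \<eta>f: "(\<lambda>y. \<eta> y * f y) \<in> test_functions Z" by (rule test_functions_mult[OF \<eta>(1) fL])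
      have inner: "\<psi> i j (\<phi> y) = 1" "k (\<phi> y) = y"
        if "y \<in> mspace Z" "mdist X y x \<le> 5 * t" "s 1 \<le> s i" "s i < s j" for i j y
      proof -
        have y: "y \<in> mspace X" using that(1) \<Omega>X ZM by blast
        show "k (\<phi> y) = y" by (rule \<phi>(2)[OF nearG[OF y that(2)]])
        have "mdist (cspace n) (\<phi> y) b \<le> s i" using near[OF y that(2)] that(3) by linarith
        then show "\<psi> i j (\<phi> y) = 1" using plateau_eq_1[OF that(4)] by (simp add: \<psi>_def)
      qed
      have 1: "\<eta> y * (\<theta>1 y * F (\<phi> y)) = \<eta> y * f y" if y: "y \<in> mspace Z" for y
      proof (cases "mdist X y x \<le> 2 * t")
        case True
        then have "\<theta>1 y = 1" using t plateau_eq_1[of "2 * t" "3 * t"] by (simp add: \<theta>1_def)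
        moreover have "F (\<phi> y) = f y" using inner[of y 1 2] y True t s' by (simp add: F_def)
        ultimately show ?thesis by simp
      next
        case False
        then have "\<eta> y = 0" using t plateau_eq_0[of t "2 * t"] by (simp add: \<eta>_def)
        then show ?thesis by simp
      qed
      \<comment> \<open>The functions agree on all of \<open>\<Omega>\<close> because
        \<open>\<eta>\<close> vanishes far from \<open>x\<close>, but the arguments agree only near
        the support of \<open>\<eta>\<close>; for these locality has to be invoked.\<close>
      have 2: "\<theta>2 y * P i (\<phi> y) = \<pi> i y" if y: "y \<in> {y \<in> mspace Z. mdist X y x < 4 * t}" for i y
      proof -
        have "\<theta>2 y = 1" using y t plateau_eq_1[of "4 * t" "5 * t"] by (simp add: \<theta>2_def)
        moreover have "P i (\<phi> y) = \<pi> i y" using inner[of y 3 4] y t s' by (simp add: P_def)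
        ultimately show ?thesis by simp
      qed
      have "T (\<lambda>y. \<eta> y * (\<theta>1 y * F (\<phi> y))) (\<lambda>i y. \<theta>2 y * P i (\<phi> y)) = T (\<lambda>y. \<eta> y * f y) (\<lambda>i y. \<theta>2 y * P i (\<phi> y))"
        by (rule local_current_cong[OF TZ \<theta>F \<eta>f \<theta>P \<theta>P 1 refl])
      also have "\<dots> = T (\<lambda>y. \<eta> y * f y) \<pi>"
      proof (rule local_current_cong_args_near_support[OF TZ \<eta>f \<theta>P \<pi>])
        show "openin (mtopology_of Z) {y \<in> mspace Z. mdist X y x < 4 * t}"
          by (rule openin_sublevel[OF normZ]) auto
        show "fsupp Z (\<lambda>y. \<eta> y * f y) \<subseteq> {y \<in> mspace Z. mdist X y x < 4 * t}"
          using fsupp_mult_subset[of Z \<eta> f] \<eta>(2) t by fastforce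
        show "\<theta>2 y * P i (\<phi> y) = \<pi> i y" if "y \<in> {y \<in> mspace Z. mdist X y x < 4 * t}" for i y by (rule 2[OF that])
      qed
      finally show ?thesis .
    qed
    finally show ?thesis .
  qed
  define R' where "R' = (\<lambda>f \<pi>. T f \<pi> - (\<Sum>j<K. pushforward (submetric (cspace (d j)) (V j)) m (h j) (S' j) f \<pi>))"
  have \<eta>L: "(\<lambda>y. 1 - \<eta> y) \<in> Lip_loc Z"
    using Lip_loc_diff[OF Lip_loc_const test_functions_Lip_loc[OF \<eta>(1)]] by simp
  have R'_eq: "R' f \<pi> = T (\<lambda>y. f y * (1 - \<eta> y)) \<pi>"
    if f: "f \<in> test_functions Z" and \<pi>: "\<And>i. i < m \<Longrightarrow> \<pi> i \<in> Lip_loc Z" for f \<pi>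
  proof -
    have "T (\<lambda>y. 1 * f y + (-1) * (\<eta> y * f y)) \<pi> = T f \<pi> - T (\<lambda>y. \<eta> y * f y) \<pi>"
      using local_current_lincomb[OF TZ f test_functions_mult[OF \<eta>(1) test_functions_Lip_loc[OF f]] \<pi>,
          where a = 1 and b = "-1"] by simp
    moreover have "(\<lambda>y. 1 * f y + (-1) * (\<eta> y * f y)) = (\<lambda>y. f y * (1 - \<eta> y))"
      by (simp add: algebra_simps)
    ultimately show ?thesis by (simp add: R'_def sum_eq[OF f \<pi>])
  qed
  have R': "local_current Z m R'"
    by (rule local_current_transfer_eq[OF local_current_mult[OF TZ \<eta>L] R'_eq])
  \<comment> \<open>\<open>\<eta>\<close> is 1 on the ball of radius \<open>t\<close>, so the factor
    \<open>1 - \<eta>\<close> annihilates every test function supported there.\<close>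
  have off: "vanishes_off Z m R' (mspace Z - {y \<in> mspace Z. mdist X y x < t})"
    unfolding vanishes_off_def
  proof (intro conjI ballI allI impI; (elim conjE)?)
    have "openin (mtopology_of Z) {y \<in> mspace Z. mdist X y x < t}" by (rule openin_sublevel[OF normZ]) auto
    then show "closedin (mtopology_of Z) (mspace Z - {y \<in> mspace Z. mdist X y x < t})"
      using closedin_diff[OF closedin_topspace] by (metis topspace_mtopology_of)
    fix f \<pi> assume f: "f \<in> test_functions Z" and \<pi>: "\<forall>i<m. \<pi> i \<in> Lip_loc Z"
      and disj: "fsupp Z f \<inter> (mspace Z - {y \<in> mspace Z. mdist X y x < t}) = {}"
    have "T (\<lambda>y. f y * (1 - \<eta> y)) \<pi> = 0"
    proof (rule local_current_0[OF TZ test_functions_mult[OF f \<eta>L]])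
      fix y assume y: "y \<in> mspace Z"
      show "f y * (1 - \<eta> y) = 0"
      proof (cases "f y = 0")
        case False
        then have "mdist X y x < t" using subset_fsupp[of y Z f] disj y by blast
        then have "\<eta> y = 1" using t plateau_eq_1[of t "2 * t"] by (simp add: \<eta>_def)
        then show ?thesis by simp
      qed simp
    qed (use \<pi> in simp)
    then show "R' f \<pi> = 0" using R'_eq f \<pi> by simp
  qed
  \<comment> \<open>With half the radius, the closure of \<open>\<omega>\<close> stays inside the
    open ball of radius \<open>t\<close>, which the support of the remainder avoids.\<close>
  define \<omega> where "\<omega> = {y \<in> mspace X. mdist X y x < t / 2}"
  have cl: "?\<tau> closure_of \<omega> \<subseteq> {y \<in> mspace X. mdist X y x \<le> t / 2}"
  proof (rule closure_of_minimal)
    show "closedin ?\<tau> {y \<in> mspace X. mdist X y x \<le> t / 2}" by (rule closedin_sublevel[OF normX]) auto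
  qed (auto simp: \<omega>_def)
  have clE: "?\<tau> closure_of \<omega> \<subseteq> k ` E" using cl ball_sub[of "t / 2"] t by auto
  have kE': "compactin ?\<tau> (k ` E)" "k ` E \<subseteq> \<Omega>" using kE unfolding Ztop compactin_subtopology by auto
  show "\<exists>\<omega>. openin (mtopology_of X) \<omega> \<and> x \<in> \<omega> \<and>
    compactin (mtopology_of X) (mtopology_of X closure_of \<omega>) \<and>
    mtopology_of X closure_of \<omega> \<subseteq> \<Omega> \<and>
    (\<exists>(k :: nat) (n :: nat \<Rightarrow> nat) (V :: nat \<Rightarrow> (nat \<Rightarrow> complex) set)
       (h :: nat \<Rightarrow> (nat \<Rightarrow> complex) \<Rightarrow> 'a)
       (S :: nat \<Rightarrow> ((nat \<Rightarrow> complex) \<Rightarrow> complex) \<Rightarrow> (nat \<Rightarrow> (nat \<Rightarrow> complex) \<Rightarrow> complex) \<Rightarrow> complex).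
       (\<forall>i<k. openin (ctop (n i)) (V i) \<and>
          holomorphic_map (subtopology (ctop (n i)) (V i)) (holo (n i))
            (subtopology (mtopology_of X) \<Omega>) \<O> (h i) \<and>
          locally_Lipschitz (submetric (cspace (n i)) (V i)) (submetric X \<Omega>) (h i) \<and>
          local_current (submetric (cspace (n i)) (V i)) m (S i) \<and>
          proper_map (subtopology (ctop (n i)) (csupp (submetric (cspace (n i)) (V i)) m (S i)))
            (subtopology (mtopology_of X) \<Omega>) (h i)) \<and>
       (let R = (\<lambda>f \<pi>. T f \<pi> - (\<Sum>i<k. pushforward (submetric (cspace (n i)) (V i)) m (h i) (S i) f \<pi>))
        in local_current (submetric X \<Omega>) m R \<and>
           csupp (submetric X \<Omega>) m R \<inter> mtopology_of X closure_of \<omega> = {}))"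
    (is "\<exists>\<omega>. ?A \<omega> \<and> ?B \<omega> \<and> ?C \<omega> \<and> ?D \<omega> \<and> ?E \<omega>")
  proof (intro exI[of _ \<omega>] conjI)
    show "openin ?\<tau> \<omega>" unfolding \<omega>_def by (rule openin_sublevel[OF normX]) auto
    show "x \<in> \<omega>" using xX t by (simp add: \<omega>_def)
    show "compactin ?\<tau> (?\<tau> closure_of \<omega>)" by (rule closed_compactin[OF kE'(1) clE closedin_closure_of])
    show "?\<tau> closure_of \<omega> \<subseteq> \<Omega>" using clE kE'(2) by blast
    have "csupp Z m R' \<subseteq> mspace Z - {y \<in> mspace Z. mdist X y x < t}" using off unfolding csupp_eq by blast
    moreover have "?\<tau> closure_of \<omega> \<inter> (mspace Z - {y \<in> mspace Z. mdist X y x < t}) = {}" using cl t by force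
    ultimately have disj: "csupp Z m R' \<inter> ?\<tau> closure_of \<omega> = {}" by blast
    show "?E \<omega>"
      unfolding Let_def Z_def[symmetric] Ztop[symmetric]
    proof (rule exI[of _ K], rule exI[of _ d], rule exI[of _ V], rule exI[of _ h], rule exI[of _ S'], intro conjI allI impI)
      fix j assume "j < K"
      then show "openin (ctop (d j)) (V j)"
        "holomorphic_map (subtopology (ctop (d j)) (V j)) (holo (d j)) (mtopology_of Z) \<O> (h j)"
        "locally_Lipschitz (submetric (cspace (d j)) (V j)) Z (h j)"
        "local_current (submetric (cspace (d j)) (V j)) m (S' j)"
        "proper_map (subtopology (ctop (d j)) (csupp (submetric (cspace (d j)) (V j)) m (S' j))) (mtopology_of Z) (h j)"
        using piece[of j] unfolding piece_def by blast+
    next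
      show "local_current Z m (\<lambda>f \<pi>. T f \<pi> - (\<Sum>i<K. pushforward (submetric (cspace (d i)) (V i)) m (h i) (S' i) f \<pi>))"
        using R' unfolding R'_def .
      show "csupp Z m (\<lambda>f \<pi>. T f \<pi> - (\<Sum>i<K. pushforward (submetric (cspace (d i)) (V i)) m (h i) (S' i) f \<pi>))
          \<inter> ?\<tau> closure_of \<omega> = {}"
        using disj unfolding R'_def .
    qed
  qed
qed

end
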